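(* Let $\Gamma$ be a countable simplicial graph with clique number $\omega(\Gamma)\le k$. Suppose that $\{G_v\}_{v\in V(\Gamma)}$ is a collection of finitely generated groups with $0<\operatorname{asdim}G_v\le n$ for all $v\in V(\Gamma)$. Then, in a left-invariant proper metric, the graph product satisfies $\operatorname{asdim}\Gamma\mathfrak{G}\le nk$.
   Context: The clique number $\omega(\Gamma)$ is the maximum number of vertices of a complete subgraph of $\Gamma$. The graph product $\Gamma\mathfrak{G}$ is the free product of the $G_v$ modulo the relations $gg'=g'g$ for $g\in G_v$, $g'\in G_{v'}$ whenever $\{v,v'\}$ is an edge; it is a countable group. A metric is proper if balls are finite (bounded sets are finite). Finitely generated groups carry a word metric. A metric space $X$ has $\operatorname{asdim}X\le n$ if for every $R>0$, $X$ is a union of $n+1$ families of subsets, each uniformly bounded and $R$-disjoint (distinct members are at distance $>R$). *)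

theory Defs
  imports "HOL-Algebra.Algebra" "HOL-Library.Countable_Set"
begin

definition simplicial_graph :: "'v set \<Rightarrow> ('v \<Rightarrow> 'v \<Rightarrow> bool) \<Rightarrow> bool" where
  "simplicial_graph V E \<longleftrightarrow>
     (\<forall>u v. E u v \<longrightarrow> u \<in> V \<and> v \<in> V) \<and>
     (\<forall>u v. E u v \<longrightarrow> E v u) \<and> (\<forall>v. \<not> E v v)"

definition is_clique :: "'v set \<Rightarrow> ('v \<Rightarrow> 'v \<Rightarrow> bool) \<Rightarrow> 'v set \<Rightarrow> bool" where
  "is_clique V E C \<longleftrightarrow> C \<subseteq> V \<and> (\<forall>u\<in>C. \<forall>v\<in>C. u \<noteq> v \<longrightarrow> E u v)"

definition clique_number_le :: "'v set \<Rightarrow> ('v \<Rightarrow> 'v \<Rightarrow> bool) \<Rightarrow> nat \<Rightarrow> bool" where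
  "clique_number_le V E k \<longleftrightarrow> (\<forall>C. is_clique V E C \<longrightarrow> finite C \<and> card C \<le> k)"

definition metric_on :: "'a set \<Rightarrow> ('a \<Rightarrow> 'a \<Rightarrow> real) \<Rightarrow> bool" where
  "metric_on M d \<longleftrightarrow>
     (\<forall>x\<in>M. \<forall>y\<in>M. 0 \<le> d x y \<and> (d x y = 0 \<longleftrightarrow> x = y) \<and> d x y = d y x) \<and>
     (\<forall>x\<in>M. \<forall>y\<in>M. \<forall>z\<in>M. d x z \<le> d x y + d y z)"

definition proper_metric_on :: "'a set \<Rightarrow> ('a \<Rightarrow> 'a \<Rightarrow> real) \<Rightarrow> bool" where
  "proper_metric_on M d \<longleftrightarrow> metric_on M d \<and>
     (\<forall>x\<in>M. \<forall>r::real. finite {y\<in>M. d x y \<le> r})"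

definition asdim_le :: "'a set \<Rightarrow> ('a \<Rightarrow> 'a \<Rightarrow> real) \<Rightarrow> nat \<Rightarrow> bool" where
  "asdim_le M d n \<longleftrightarrow>
     (\<forall>R>0. \<exists>U :: nat \<Rightarrow> 'a set set.
        M = (\<Union>i\<le>n. \<Union>(U i)) \<and>
        (\<forall>i\<le>n. \<exists>B::real. \<forall>A\<in>U i. \<forall>x\<in>A. \<forall>y\<in>A. d x y \<le> B) \<and>
        (\<forall>i\<le>n. \<forall>A\<in>U i. \<forall>A'\<in>U i. A \<noteq> A' \<longrightarrow> (\<forall>x\<in>A. \<forall>y\<in>A'. d x y > R)))"

definition word_length :: "('g, 'b) monoid_scheme \<Rightarrow> 'g set \<Rightarrow> 'g \<Rightarrow> nat" where
  "word_length G S g = (LEAST m. \<exists>xs. length xs = m \<and>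
       set xs \<subseteq> S \<union> m_inv G ` S \<and> foldr (\<lambda>x acc. x \<otimes>\<^bsub>G\<^esub> acc) xs \<one>\<^bsub>G\<^esub> = g)"

definition word_metric :: "('g, 'b) monoid_scheme \<Rightarrow> 'g set \<Rightarrow> 'g \<Rightarrow> 'g \<Rightarrow> real" where
  "word_metric G S g h = real (word_length G S (inv\<^bsub>G\<^esub> g \<otimes>\<^bsub>G\<^esub> h))"

definition finite_generating_set :: "('g, 'b) monoid_scheme \<Rightarrow> 'g set \<Rightarrow> bool" where
  "finite_generating_set G S \<longleftrightarrow> finite S \<and> S \<subseteq> carrier G \<and> generate G S = carrier G"

definition gp_word :: "'v set \<Rightarrow> ('v \<Rightarrow> ('g, 'b) monoid_scheme) \<Rightarrow> ('v \<times> 'g) list \<Rightarrow> bool" where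
  "gp_word V G xs \<longleftrightarrow> (\<forall>(v, g)\<in>set xs. v \<in> V \<and> g \<in> carrier (G v))"

text \<open>Defining relations of the graph product, as a monoid presentation of the
  free product of the G_v modulo commutation of adjacent vertex groups.\<close>
inductive gp_basic :: "'v set \<Rightarrow> ('v \<Rightarrow> 'v \<Rightarrow> bool) \<Rightarrow> ('v \<Rightarrow> ('g, 'b) monoid_scheme)
    \<Rightarrow> ('v \<times> 'g) list \<Rightarrow> ('v \<times> 'g) list \<Rightarrow> bool"
  for V E G where
  unit: "v \<in> V \<Longrightarrow> gp_basic V E G [(v, \<one>\<^bsub>G v\<^esub>)] []"
| mult: "v \<in> V \<Longrightarrow> g \<in> carrier (G v) \<Longrightarrow> h \<in> carrier (G v) \<Longrightarrow>
          gp_basic V E G [(v, g), (v, h)] [(v, g \<otimes>\<^bsub>G v\<^esub> h)]"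
| comm: "E v w \<Longrightarrow> g \<in> carrier (G v) \<Longrightarrow> h \<in> carrier (G w) \<Longrightarrow>
          gp_basic V E G [(v, g), (w, h)] [(w, h), (v, g)]"

definition gp_step :: "'v set \<Rightarrow> ('v \<Rightarrow> 'v \<Rightarrow> bool) \<Rightarrow> ('v \<Rightarrow> ('g, 'b) monoid_scheme)
    \<Rightarrow> ('v \<times> 'g) list \<Rightarrow> ('v \<times> 'g) list \<Rightarrow> bool" where
  "gp_step V E G xs ys \<longleftrightarrow>
     (\<exists>a b l r. gp_basic V E G l r \<and> xs = a @ l @ b \<and> ys = a @ r @ b)"

definition gp_eqv :: "'v set \<Rightarrow> ('v \<Rightarrow> 'v \<Rightarrow> bool) \<Rightarrow> ('v \<Rightarrow> ('g, 'b) monoid_scheme)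
    \<Rightarrow> ('v \<times> 'g) list \<Rightarrow> ('v \<times> 'g) list \<Rightarrow> bool" where
  "gp_eqv V E G = equivclp (gp_step V E G)"

definition gp_class :: "'v set \<Rightarrow> ('v \<Rightarrow> 'v \<Rightarrow> bool) \<Rightarrow> ('v \<Rightarrow> ('g, 'b) monoid_scheme)
    \<Rightarrow> ('v \<times> 'g) list \<Rightarrow> ('v \<times> 'g) list set" where
  "gp_class V E G xs = {ys. gp_word V G ys \<and> gp_eqv V E G xs ys}"

definition graph_product :: "'v set \<Rightarrow> ('v \<Rightarrow> 'v \<Rightarrow> bool) \<Rightarrow> ('v \<Rightarrow> ('g, 'b) monoid_scheme)
    \<Rightarrow> ('v \<times> 'g) list set monoid" where
  "graph_product V E G =
     \<lparr>carrier = {gp_class V E G xs | xs. gp_word V G xs},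
      monoid.mult = (\<lambda>A B. gp_class V E G ((SOME xs. xs \<in> A) @ (SOME ys. ys \<in> B))),
      monoid.one = gp_class V E G []\<rparr>"

definition left_invariant :: "('a, 'b) monoid_scheme \<Rightarrow> ('a \<Rightarrow> 'a \<Rightarrow> real) \<Rightarrow> bool" where
  "left_invariant H d \<longleftrightarrow>
     (\<forall>g\<in>carrier H. \<forall>x\<in>carrier H. \<forall>y\<in>carrier H. d (g \<otimes>\<^bsub>H\<^esub> x) (g \<otimes>\<^bsub>H\<^esub> y) = d x y)"

end

theory Submission
  imports Defs
begin

text \<open>For a proper left-invariant metric, the elements of norm at most \<open>R\<close> involve only a finite
  set \<open>W\<close> of vertices, and different cosets of the subgroup \<open>G_W\<close> generated by their vertex groups are
  more than \<open>R\<close> apart. So it suffices to treat \<open>G_W\<close> with its word metric, by induction on \<open>|W|\<close>.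
  For a vertex \<open>v\<close> of \<open>W\<close> the group \<open>G_W\<close> is an amalgam of \<open>A = G_{W - v}\<close> and \<open>C \<times> G_v\<close> over
  \<open>C = G_{lk v}\<close>. Here \<open>asdim C \<le> n (k - 1) < n k\<close>, as the cliques of the link are smaller, and
  \<open>asdim (C \<times> G_v) \<le> n (k - 1) + n\<close> by the product inequality. It remains to see that an amalgam
  has dimension at most \<open>N\<close> if both factors do and \<open>asdim C < N\<close>. Elements of bounded syllable length
  have dimension at most \<open>N\<close> by the union theorem. Cut the tree of cosets at widely spaced levels into
  regions of bounded syllable length and colour each region separately. Since \<open>asdim C < N\<close>,
  a neighbourhood of the coset of \<open>C\<close> through which a region is entered can be coloured, through the
  retraction to \<open>C\<close>, in such a way that no colour crosses it; hence monochromatic components do not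
  spread from one region to the next.\<close>

section \<open>Colourings with bounded components\<close>

text \<open>The difficulty is to save a colour: an extra colour reserved for the passages between
  regions would cost one dimension, while reusing the colours carelessly lets components run on
  through unboundedly many regions. If \<open>C\<close> has dimension below the bound
  \<open>N\<close>, Kolmogorov's trick covers it by \<open>N + 1\<close> classes so that every point
  lies in two of them; every colour can then be given a layer of its own in which it is dropped. The
  strict inequality n (k - 1) < n k rests on the positive dimension of the vertex groups, which
  excludes n = 0. The tree is encoded by stacks that are computed letter by letter along a word.
  Their invariance under the defining relations turns them into functions of the group element and
  so takes the place of a normal form theorem. Deleting all letters outside a set of vertices
  respects the relations. Hence every vertex subgroup is a 1-Lipschitz retract. This makes the word
  metrics of nested subgroups agree, splits off the factor \<open>G_v\<close> over the link, and
  supplies the map through which entries are coloured.\<close>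

locale pseudo_metric =
  fixes d :: "'a \<Rightarrow> 'a \<Rightarrow> nat"
  assumes d_refl [simp]: "d x x = 0"
    and d_sym: "d x y = d y x"
    and d_tri: "d x z \<le> d x y + d y z"
begin

text \<open>Asymptotic dimension is expressed by colour classes instead of families of sets: the
  components of a class under chains of step at most \<open>r\<close> play the role of an \<open>r\<close>-disjoint
  family of uniformly bounded sets.\<close>

definition step :: "nat \<Rightarrow> 'a set \<Rightarrow> 'a \<Rightarrow> 'a \<Rightarrow> bool" where
  "step r A a b \<longleftrightarrow> a \<in> A \<and> b \<in> A \<and> d a b \<le> r"

definition chain_bounded :: "nat \<Rightarrow> nat \<Rightarrow> 'a set \<Rightarrow> bool" where
  "chain_bounded r B A \<longleftrightarrow> (\<forall>x y. (step r A)\<^sup>*\<^sup>* x y \<longrightarrow> d x y \<le> B)"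

text \<open>The bound \<open>B\<close> is a parameter because the union theorem needs one bound for
  a whole family of sets. The classes may overlap and may leave \<open>A\<close>.\<close>

definition colourable :: "nat \<Rightarrow> nat \<Rightarrow> nat \<Rightarrow> 'a set \<Rightarrow> bool" where
  "colourable n r B A \<longleftrightarrow> (\<exists>C. A \<subseteq> (\<Union>i\<le>n. C i) \<and> (\<forall>i\<le>n. chain_bounded r B (C i)))"

definition asd :: "'a set \<Rightarrow> nat \<Rightarrow> bool" where
  "asd A n \<longleftrightarrow> (\<forall>r. \<exists>B. colourable n r B A)"

lemma conn_map:
  assumes "(step r A)\<^sup>*\<^sup>* x y"
    and "\<And>a b. step r A a b \<Longrightarrow> step s Y (f a) (f b)"
  shows "(step s Y)\<^sup>*\<^sup>* (f x) (f y)"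
  using assms(1)
  by (induction rule: rtranclp_induct) (auto intro: rtranclp.rtrancl_into_rtrancl assms(2))

lemma conn_mono:
  "(step r A)\<^sup>*\<^sup>* x y \<Longrightarrow> A \<subseteq> Y \<Longrightarrow> r \<le> s \<Longrightarrow> (step s Y)\<^sup>*\<^sup>* x y"
  using conn_map[of r A x y s Y "\<lambda>x. x"] by (auto simp: step_def)

lemma conn_mem: "(step r A)\<^sup>*\<^sup>* x y \<Longrightarrow> x \<in> A \<longleftrightarrow> y \<in> A"
  by (induction rule: rtranclp_induct) (auto simp: step_def)

lemma conn_source: "(step r A)\<^sup>*\<^sup>* x y \<Longrightarrow> x \<noteq> y \<Longrightarrow> x \<in> A"
  by (erule converse_rtranclpE) (simp_all add: step_def)

lemma chain_bounded_mono: "chain_bounded s B Y \<Longrightarrow> A \<subseteq> Y \<Longrightarrow> r \<le> s \<Longrightarrow> B \<le> B' \<Longrightarrow> chain_bounded r B' A"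
  unfolding chain_bounded_def using conn_mono[of r A _ _ Y s] by (meson order_trans)

lemma chain_boundedD: "chain_bounded r B A \<Longrightarrow> (step r A)\<^sup>*\<^sup>* x y \<Longrightarrow> d x y \<le> B"
  by (auto simp: chain_bounded_def)

lemma colourable_mono: "colourable n s B Y \<Longrightarrow> A \<subseteq> Y \<Longrightarrow> r \<le> s \<Longrightarrow> B \<le> B' \<Longrightarrow> colourable n r B' A"
  unfolding colourable_def using chain_bounded_mono[OF _ order_refl] by (meson order_trans)

lemma colourable_more_colours: "colourable m r B A \<Longrightarrow> m \<le> n \<Longrightarrow> colourable n r B A"
proof -
  assume "colourable m r B A" "m \<le> n"
  then obtain C where C: "A \<subseteq> (\<Union>i\<le>m. C i)" "\<And>i. i \<le> m \<Longrightarrow> chain_bounded r B (C i)"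
    unfolding colourable_def by auto
  have "A \<subseteq> (\<Union>i\<le>n. C (if i \<le> m then i else m))"
    using C(1) \<open>m \<le> n\<close> by (fastforce dest: subsetD)
  then show ?thesis
    unfolding colourable_def using C(2) by (intro exI[of _ "\<lambda>i. C (if i \<le> m then i else m)"]) auto
qed

lemma asd_mono: "asd Y m \<Longrightarrow> A \<subseteq> Y \<Longrightarrow> m \<le> n \<Longrightarrow> asd A n"
  unfolding asd_def by (meson colourable_mono colourable_more_colours order_refl)

text \<open>Classes are pulled back along \<open>f\<close> without loss in \<open>B\<close>, so that
  all translates of a set share one bound.\<close>

lemma colourable_isometry:
  assumes "colourable n r B A" "\<And>x. x \<in> Y \<Longrightarrow> f x \<in> A"
    "\<And>x y. x \<in> Y \<Longrightarrow> y \<in> Y \<Longrightarrow> d (f x) (f y) = d x y"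
  shows "colourable n r B Y"
proof -
  obtain C where C: "A \<subseteq> (\<Union>i\<le>n. C i)" "\<And>i. i \<le> n \<Longrightarrow> chain_bounded r B (C i)"
    using assms(1) unfolding colourable_def by auto
  have "chain_bounded r B {x\<in>Y. f x \<in> C i}" if "i \<le> n" for i
    unfolding chain_bounded_def
  proof (intro allI impI)
    fix x y assume xy: "(step r {x\<in>Y. f x \<in> C i})\<^sup>*\<^sup>* x y"
    show "d x y \<le> B"
    proof (cases "x = y")
      case False
      then have "x \<in> Y" "y \<in> Y"
        using conn_source[OF xy] conn_mem[OF xy] by auto
      moreover have "(step r (C i))\<^sup>*\<^sup>* (f x) (f y)"
        by (rule conn_map[OF xy]) (auto simp: step_def assms(3))
      ultimately show ?thesis
        using chain_boundedD[OF C(2)[OF that]] assms(3) by metis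
    qed simp
  qed
  moreover have "Y \<subseteq> (\<Union>i\<le>n. {x\<in>Y. f x \<in> C i})" using C(1) assms(2) by blast
  ultimately show ?thesis unfolding colourable_def by blast
qed

text \<open>Replacing each point by a chosen point of \<open>A\<close> within \<open>s\<close> turns
  steps of size \<open>r\<close> into steps of size \<open>r + 2 * s\<close> and moves each end of a
  chain by at most \<open>s\<close>.\<close>

lemma chain_bounded_nbhd:
  assumes "chain_bounded (r + 2 * s) B A"
  shows "chain_bounded r (B + 2 * s) {x. \<exists>z\<in>A. d x z \<le> s}"
  unfolding chain_bounded_def
proof (intro allI impI)
  let ?N = "{x. \<exists>z\<in>A. d x z \<le> s}"
  fix x y assume xy: "(step r ?N)\<^sup>*\<^sup>* x y"
  define q where "q x = (SOME z. z \<in> A \<and> d x z \<le> s)" for x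
  have q: "q x \<in> A" "d x (q x) \<le> s" if "x \<in> ?N" for x
    using that someI_ex[of "\<lambda>z. z \<in> A \<and> d x z \<le> s"] unfolding q_def by auto
  have qc: "(step (r + 2 * s) A)\<^sup>*\<^sup>* (q x) (q y)"
  proof (rule conn_map[OF xy])
    fix a b assume ab: "step r ?N a b"
    then have N: "a \<in> ?N" "b \<in> ?N" "d a b \<le> r" by (auto simp: step_def)
    have "d (q a) (q b) \<le> r + 2 * s"
      using q(2)[OF N(1)] q(2)[OF N(2)] N(3) d_tri[of "q a" "q b" a] d_tri[of a "q b" b] d_sym[of a "q a"]
      by linarith
    then show "step (r + 2 * s) A (q a) (q b)"
      using q(1) N by (auto simp: step_def)
  qed
  show "d x y \<le> B + 2 * s"
  proof (cases "x = y")
    case False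
    then have "x \<in> ?N" "y \<in> ?N"
      using conn_source[OF xy] conn_mem[OF xy] by auto
    then show ?thesis
      using chain_boundedD[OF assms qc] q(2)[of x] q(2)[of y]
        d_tri[of x y "q x"] d_tri[of "q x" y "q y"] d_sym[of y "q y"] by linarith
  qed simp
qed

lemma asd_nbhd:
  assumes "asd A n" shows "asd {x. \<exists>z\<in>A. d x z \<le> s} n"
  unfolding asd_def
proof
  fix r
  obtain B C where C: "A \<subseteq> (\<Union>i\<le>n. C i)" "\<And>i. i \<le> n \<Longrightarrow> chain_bounded (r + 2 * s) B (C i)"
    using assms unfolding asd_def colourable_def by metis
  have "{x. \<exists>z\<in>A. d x z \<le> s} \<subseteq> (\<Union>i\<le>n. {x. \<exists>z\<in>C i. d x z \<le> s})"
    using C(1) by blast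
  then show "\<exists>B. colourable n r B {x. \<exists>z\<in>A. d x z \<le> s}"
    unfolding colourable_def using chain_bounded_nbhd[OF C(2)] by (intro exI[of _ "B + 2 * s"] exI) auto
qed

text \<open>The points of \<open>Y\<close> visited by an \<open>r\<close>-chain in \<open>Z \<union> Y\<close> form a \<open>K\<close>-chain, because the
  excursions between them are \<open>r\<close>-chains in \<open>Z\<close>.\<close>

lemma chain_bounded_merge:
  assumes Z: "chain_bounded r B1 Z"
    and near: "\<And>y y'. y \<in> Y \<Longrightarrow> y' \<in> Y \<Longrightarrow> d y y' \<le> r \<Longrightarrow> K y y'"
    and exc: "\<And>y y' z z'. y \<in> Y \<Longrightarrow> y' \<in> Y \<Longrightarrow> z \<in> Z \<Longrightarrow> d y z \<le> r \<Longrightarrow> (step r Z)\<^sup>*\<^sup>* z z'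
      \<Longrightarrow> d z' y' \<le> r \<Longrightarrow> K y y'"
    and K: "\<And>y y'. K\<^sup>*\<^sup>* y y' \<Longrightarrow> d y y' \<le> B2"
  shows "chain_bounded r (B2 + 2 * (B1 + r)) (Z \<union> Y)"
  unfolding chain_bounded_def
proof (intro allI impI)
  fix x y assume xy: "(step r (Z \<union> Y))\<^sup>*\<^sup>* x y"
  have "(step r Z)\<^sup>*\<^sup>* x y \<or>
      (\<exists>u\<in>Y. \<exists>v\<in>Y. d x u \<le> B1 + r \<and> K\<^sup>*\<^sup>* u v \<and> (v = y \<or> (\<exists>z\<in>Z. d v z \<le> r \<and> (step r Z)\<^sup>*\<^sup>* z y)))"
    using xy
  proof (induction rule: rtranclp_induct)
    case (step y w)
    have w: "w \<in> Z \<or> w \<in> Y" "d y w \<le> r" "y \<in> Z \<union> Y" using step.hyps(2) by (auto simp: step_def)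
    from step.IH show ?case
    proof (elim disjE bexE conjE)
      assume xy: "(step r Z)\<^sup>*\<^sup>* x y"
      show ?case
      proof (cases "w \<in> Y")
        case True
        have "d x w \<le> B1 + r" using chain_boundedD[OF Z xy] w d_tri[of x w y] by linarith
        then show ?thesis using True by blast
      next
        case False
        then have wZ: "w \<in> Z" using w by simp
        show ?thesis
        proof (cases "y \<in> Z")
          case True
          then have "step r Z y w" using wZ w by (auto simp: step_def)
          then show ?thesis using xy by (meson rtranclp.rtrancl_into_rtrancl)
        next
          case False
          then have "x = y" using xy by (auto elim: rtranclp.cases simp: step_def)
          moreover have "y \<in> Y" using w False by auto
          ultimately show ?thesis using w wZ by (intro disjI2 bexI[of _ y]) auto
        qed
      qed
    next
      fix u v assume uv: "u \<in> Y" "v \<in> Y" "d x u \<le> B1 + r" "K\<^sup>*\<^sup>* u v" and "v = y"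
      show ?case
      proof (cases "w \<in> Y")
        case True
        then have "K v w" using near uv w \<open>v = y\<close> by auto
        with uv(4) have "K\<^sup>*\<^sup>* u w" by (rule rtranclp.rtrancl_into_rtrancl)
        then show ?thesis using uv True by blast
      next
        case False
        then show ?thesis using uv w \<open>v = y\<close> by blast
      qed
    next
      fix u v z assume uv: "u \<in> Y" "v \<in> Y" "d x u \<le> B1 + r" "K\<^sup>*\<^sup>* u v"
        and z: "z \<in> Z" "d v z \<le> r" "(step r Z)\<^sup>*\<^sup>* z y"
      show ?case
      proof (cases "w \<in> Y")
        case True
        then have "K v w" using exc[of v w z y] uv w z by auto
        with uv(4) have "K\<^sup>*\<^sup>* u w" by (rule rtranclp.rtrancl_into_rtrancl)
        then show ?thesis using uv True by blast
      next
        case False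
        then have "step r Z y w" using w z conn_mem[OF z(3)] by (auto simp: step_def)
        then have "(step r Z)\<^sup>*\<^sup>* z w" using z(3) by auto
        then show ?thesis using uv z by blast
      qed
    qed
  qed simp
  then show "d x y \<le> B2 + 2 * (B1 + r)"
  proof (elim disjE bexE conjE)
    assume "(step r Z)\<^sup>*\<^sup>* x y" then show ?thesis using chain_boundedD[OF Z] by fastforce
  next
    fix u v assume "d x u \<le> B1 + r" "K\<^sup>*\<^sup>* u v" "v = y"
    then show ?thesis using K[of u v] d_tri[of x y u] by simp
  next
    fix u v z assume "d x u \<le> B1 + r" "K\<^sup>*\<^sup>* u v" "d v z \<le> r" "(step r Z)\<^sup>*\<^sup>* z y"
    then show ?thesis using K[of u v] chain_boundedD[OF Z, of z y] d_tri[of x y u] d_tri[of u y v] d_tri[of v y z]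
      by simp
  qed
qed

text \<open>An excursion through \<open>Z\<close> between two points of \<open>Y\<close> spans at
  most \<open>r + B1 + r\<close>, which fixes the scale at which \<open>Y\<close> has to be
  bounded.\<close>

lemma chain_bounded_union:
  assumes Z: "chain_bounded r B1 Z" and Y: "chain_bounded (B1 + 2 * r) B2 Y"
  shows "chain_bounded r (B2 + 2 * (B1 + r)) (Z \<union> Y)"
proof (rule chain_bounded_merge[where K = "step (B1 + 2 * r) Y", OF Z])
  fix y y' z z' assume "y \<in> Y" "y' \<in> Y" "d y z \<le> r" "(step r Z)\<^sup>*\<^sup>* z z'" "d z' y' \<le> r"
  then show "step (B1 + 2 * r) Y y y'"
    using chain_boundedD[OF Z, of z z'] d_tri[of y y' z] d_tri[of z y' z'] by (simp add: step_def)
qed (use Y in \<open>auto simp: step_def chain_bounded_def\<close>)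

text \<open>The union theorem for infinite families. Outside \<open>Y\<close> the pieces are
  separated at scale \<open>r\<close>, so colours chosen piece by piece do not mix; the scale for
  \<open>Y\<close> is set once the common bound of the pieces is known.\<close>

lemma asd_union:
  assumes pieces: "\<And>r. \<exists>B. \<forall>i\<in>I. colourable n r B (P i)"
    and sep: "\<And>r. \<exists>Y. asd Y n \<and> A \<subseteq> Y \<union> (\<Union>i\<in>I. P i) \<and>
      (\<forall>i\<in>I. \<forall>j\<in>I. \<forall>x\<in>P i - Y. \<forall>y\<in>P j - Y. d x y \<le> r \<longrightarrow> i = j)"
  shows "asd A n"
  unfolding asd_def
proof
  fix r
  obtain Y where Y: "asd Y n" "A \<subseteq> Y \<union> (\<Union>i\<in>I. P i)"
    and disj: "\<And>i j x y. i \<in> I \<Longrightarrow> j \<in> I \<Longrightarrow> x \<in> P i - Y \<Longrightarrow> y \<in> P j - Y \<Longrightarrow> d x y \<le> r \<Longrightarrow> i = j"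
    using sep[of r] by meson
  obtain B1 where "\<forall>i\<in>I. colourable n r B1 (P i)" using pieces by blast
  then obtain C where C: "\<And>i. i \<in> I \<Longrightarrow> P i \<subseteq> (\<Union>c\<le>n. C i c)"
      "\<And>i c. i \<in> I \<Longrightarrow> c \<le> n \<Longrightarrow> chain_bounded r B1 (C i c)"
    unfolding colourable_def by metis
  obtain B2 D where D: "Y \<subseteq> (\<Union>c\<le>n. D c)" "\<And>c. c \<le> n \<Longrightarrow> chain_bounded (B1 + 2 * r) B2 (D c)"
    using Y(1) unfolding asd_def colourable_def by metis
  define Z where "Z c = (\<Union>i\<in>I. (P i - Y) \<inter> C i c)" for c
  have Z: "chain_bounded r B1 (Z c)" if "c \<le> n" for c
    unfolding chain_bounded_def
  proof (intro allI impI)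
    fix x y assume xy: "(step r (Z c))\<^sup>*\<^sup>* x y"
    show "d x y \<le> B1"
    proof (cases "x = y")
      case False
      then have "x \<in> Z c" using conn_source[OF xy] by simp
      then obtain i where i: "i \<in> I" "x \<in> (P i - Y) \<inter> C i c" unfolding Z_def by auto
      from xy have "(step r (C i c))\<^sup>*\<^sup>* x y \<and> y \<in> (P i - Y) \<inter> C i c"
      proof (induction rule: rtranclp_induct)
        case (step y w)
        then obtain j where j: "j \<in> I" "w \<in> (P j - Y) \<inter> C j c"
          by (auto simp: step_def Z_def)
        have "j = i" using disj[of i j y w] step i j by (auto simp: step_def)
        then have "step r (C i c) y w" using step j by (auto simp: step_def)
        then show ?case using step j \<open>j = i\<close> by auto
      qed (use i in auto)
      then show ?thesis using chain_boundedD[OF C(2)[OF i(1) that]] by blast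
    qed simp
  qed
  have "A \<subseteq> (\<Union>c\<le>n. Z c \<union> D c)"
  proof
    fix x assume "x \<in> A"
    show "x \<in> (\<Union>c\<le>n. Z c \<union> D c)"
    proof (cases "x \<in> Y")
      case False
      then obtain i where i: "i \<in> I" "x \<in> P i" using Y(2) \<open>x \<in> A\<close> by auto
      then obtain c where "c \<le> n" "x \<in> C i c" using C(1)[OF i(1)] by auto
      then show ?thesis using i False unfolding Z_def by blast
    qed (use D(1) in auto)
  qed
  then show "\<exists>B. colourable n r B A"
    unfolding colourable_def using chain_bounded_union[OF Z D(2)] by (intro exI conjI) auto
qed

text \<open>Kolmogorov's trick: \<open>j\<close> additional colours make every point belong to at least \<open>j + 1\<close> of
  the colour classes. The new class consists of the points which lie in no more than the
  minimal number of thickened old classes; along a chain of such points the set of old classes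
  is constant.\<close>

lemma kolmogorov:
  assumes "asd A n"
  shows "\<exists>B C. (\<forall>x\<in>A. j < card {i. i \<le> n + j \<and> x \<in> C i}) \<and> (\<forall>i\<le>n+j. chain_bounded r B (C i))"
proof (induction j arbitrary: r)
  case 0
  obtain B C where C: "A \<subseteq> (\<Union>i\<le>n. C i)" "\<And>i. i \<le> n \<Longrightarrow> chain_bounded r B (C i)"
    using assms unfolding asd_def colourable_def by metis
  have "0 < card {i. i \<le> n + 0 \<and> x \<in> C i}" if "x \<in> A" for x
    using that C(1) by (auto simp: card_gt_0_iff)
  then show ?case using C(2) by auto
next
  case (Suc j)
  \<comment> \<open>The old classes are going to be thickened by \<open>r\<close>, which uses up
    \<open>2 * r\<close> of their scale.\<close>
  obtain B C where C: "\<And>x. x \<in> A \<Longrightarrow> j < card {i. i \<le> n + j \<and> x \<in> C i}"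
      "\<And>i. i \<le> n + j \<Longrightarrow> chain_bounded (r + 2 * r) B (C i)"
    using Suc.IH[of "r + 2 * r"] by auto
  define N where "N i = {x. \<exists>z\<in>C i. d x z \<le> r}" for i
  define S where "S x = {i. i \<le> n + j \<and> x \<in> C i}" for x
  define T where "T x = {i. i \<le> n + j \<and> x \<in> N i}" for x
  define Q where "Q = {x\<in>A. card (T x) = Suc j}"
  define D where "D i = (if i \<le> n + j then N i else Q)" for i
  have fin: "finite (S x)" "finite (T x)" for x unfolding S_def T_def by auto
  have sub: "S x \<subseteq> T y" if "d x y \<le> r" for x y
    using that d_sym unfolding S_def T_def N_def by fastforce
  have card_T: "Suc j \<le> card (T x)" if "x \<in> A" for x
    using C(1)[OF that] card_mono[OF fin(2) sub, of x x] unfolding S_def by simp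
  \<comment> \<open>On \<open>Q\<close> the thickened count is minimal, so thickening adds no class
    there. With \<open>sub\<close> this makes \<open>S\<close> constant along chains in
    \<open>Q\<close>.\<close>
  have S_T: "S x = T x" if "x \<in> Q" for x
  proof (rule card_seteq[OF fin(2) sub])
    show "card (T x) \<le> card (S x)" using that C(1)[of x] unfolding Q_def S_def by simp
  qed simp
  have "chain_bounded r B Q"
    unfolding chain_bounded_def
  proof (intro allI impI)
    fix x y assume xy: "(step r Q)\<^sup>*\<^sup>* x y"
    show "d x y \<le> B"
    proof (cases "x = y")
      case False
      then have xQ: "x \<in> Q" using conn_source[OF xy] by simp
      then have "card (S x) > 0" using C(1)[of x] unfolding Q_def S_def by auto
      then obtain i where i: "i \<in> S x" by (auto simp: card_gt_0_iff)
      from xy have "(step r (C i))\<^sup>*\<^sup>* x y \<and> y \<in> Q \<and> S y = S x"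
      proof (induction rule: rtranclp_induct)
        case (step y w)
        then have w: "w \<in> Q" "d y w \<le> r" by (auto simp: step_def)
        have "S y \<subseteq> S w" "S w \<subseteq> S y"
          using sub[of y w] sub[of w y] S_T[of w] S_T[of y] w step d_sym[of y w] by auto
        then have "S w = S x" using step by simp
        then have "step r (C i) y w" using i w step.IH by (auto simp: step_def S_def)
        then show ?case using step w \<open>S w = S x\<close> by auto
      qed (use xQ in auto)
      then have "(step (r + 2 * r) (C i))\<^sup>*\<^sup>* x y" by (auto intro: conn_mono)
      then show ?thesis using C(2)[of i] i chain_boundedD unfolding S_def by blast
    qed simp
  qed
  then have "chain_bounded r (B + 2 * r) (D i)" if "i \<le> n + Suc j" for i
    unfolding D_def N_def using chain_bounded_nbhd[OF C(2)] chain_bounded_mono by auto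
  moreover have "Suc j < card {i. i \<le> n + Suc j \<and> x \<in> D i}" if x: "x \<in> A" for x
  proof (cases "x \<in> Q")
    case True
    have "insert (n + Suc j) (T x) \<subseteq> {i. i \<le> n + Suc j \<and> x \<in> D i}"
      using True by (auto simp: D_def T_def)
    moreover have "card (insert (n + Suc j) (T x)) = Suc (Suc j)"
      using True fin(2)[of x] by (subst card_insert_disjoint) (auto simp: T_def Q_def)
    ultimately have "Suc (Suc j) \<le> card {i. i \<le> n + Suc j \<and> x \<in> D i}"
      using card_mono[of "{i. i \<le> n + Suc j \<and> x \<in> D i}" "insert (n + Suc j) (T x)"] by simp
    then show ?thesis by simp
  next
    case False
    have "T x \<subseteq> {i. i \<le> n + Suc j \<and> x \<in> D i}" by (auto simp: D_def T_def)
    then have "card (T x) \<le> card {i. i \<le> n + Suc j \<and> x \<in> D i}" by (intro card_mono) auto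
    then show ?thesis using False x card_T[OF x] unfolding Q_def by auto
  qed
  ultimately show ?case by blast
qed

text \<open>Pigeonhole on \<open>a + b + 1\<close> colours: \<open>f x\<close> lies in at least
  \<open>b + 1\<close> classes and \<open>g x\<close> in at least \<open>a + 1\<close>, so some
  colour serves both.\<close>

lemma asd_product:
  assumes "asd Y a" "asd Z b"
    and f: "\<And>x. x \<in> A \<Longrightarrow> f x \<in> Y" "\<And>x y. x \<in> A \<Longrightarrow> y \<in> A \<Longrightarrow> d (f x) (f y) \<le> d x y"
    and g: "\<And>x. x \<in> A \<Longrightarrow> g x \<in> Z" "\<And>x y. x \<in> A \<Longrightarrow> y \<in> A \<Longrightarrow> d (g x) (g y) \<le> d x y"
    and fg: "\<And>x y. x \<in> A \<Longrightarrow> y \<in> A \<Longrightarrow> d x y \<le> d (f x) (f y) + d (g x) (g y)"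
  shows "asd A (a + b)"
  unfolding asd_def
proof
  fix r
  obtain B C where C: "\<And>x. x \<in> Y \<Longrightarrow> b < card {i. i \<le> a + b \<and> x \<in> C i}"
      "\<And>i. i \<le> a + b \<Longrightarrow> chain_bounded r B (C i)"
    using kolmogorov[OF assms(1), of b r] by auto
  obtain B' D where D: "\<And>x. x \<in> Z \<Longrightarrow> a < card {i. i \<le> a + b \<and> x \<in> D i}"
      "\<And>i. i \<le> a + b \<Longrightarrow> chain_bounded r B' (D i)"
    using kolmogorov[OF assms(2), of a r] by (auto simp: add.commute)
  define U where "U i = {x\<in>A. f x \<in> C i \<and> g x \<in> D i}" for i
  have "A \<subseteq> (\<Union>i\<le>a+b. U i)"
  proof
    fix x assume x: "x \<in> A"
    define S where "S = {i. i \<le> a + b \<and> f x \<in> C i}"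
    define T where "T = {i. i \<le> a + b \<and> g x \<in> D i}"
    have fin: "finite S" "finite T" unfolding S_def T_def by auto
    have "card (S \<union> T) \<le> card {..a + b}"
      by (intro card_mono) (auto simp: S_def T_def)
    then have "card (S \<inter> T) > 0"
      using card_Un_Int[OF fin] C(1)[OF f(1)[OF x]] D(1)[OF g(1)[OF x]]
      unfolding S_def[symmetric] T_def[symmetric] by simp
    then obtain i where "i \<in> S \<inter> T" by (auto simp: card_gt_0_iff)
    then show "x \<in> (\<Union>i\<le>a+b. U i)" using x by (auto simp: U_def S_def T_def)
  qed
  moreover have "chain_bounded r (B + B') (U i)" if i: "i \<le> a + b" for i
    unfolding chain_bounded_def
  proof (intro allI impI)
    fix x y assume xy: "(step r (U i))\<^sup>*\<^sup>* x y"
    show "d x y \<le> B + B'"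
    proof (cases "x = y")
      case False
      then have "x \<in> A" "y \<in> A"
        using conn_source[OF xy] conn_mem[OF xy] by (auto simp: U_def)
      moreover have "(step r (C i))\<^sup>*\<^sup>* (f x) (f y)"
        by (rule conn_map[OF xy]) (use f(2) in \<open>fastforce simp: step_def U_def\<close>)
      moreover have "(step r (D i))\<^sup>*\<^sup>* (g x) (g y)"
        by (rule conn_map[OF xy]) (use g(2) in \<open>fastforce simp: step_def U_def\<close>)
      ultimately show ?thesis
        using fg[of x y] chain_boundedD[OF C(2)[OF i]] chain_boundedD[OF D(2)[OF i]] by (meson add_mono le_trans)
    qed simp
  qed
  ultimately show "\<exists>B. colourable (a + b) r B A" unfolding colourable_def by blast
qed

text \<open>The set \<open>M\<close> is a tree of regions \<open>e x\<close>, entered where \<open>f\<close> is small. Near the entry, up to \<open>\<rho>\<close>,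
  points are coloured through the map \<open>p\<close> to a space of smaller dimension. There at least two
  colours are available for every point, so colour \<open>t\<close> can be avoided on the \<open>t\<close>-th level set of
  \<open>f\<close>, and no monochromatic chain passes from the entry to the rest of the region.\<close>

lemma colourable_barrier:
  assumes N: "asd N m" "m < n"
    and p: "\<And>x. x \<in> M \<Longrightarrow> p x \<in> N" "\<And>x y. x \<in> M \<Longrightarrow> y \<in> M \<Longrightarrow> d (p x) (p y) \<le> d x y"
    and \<rho>: "\<rho> = 2 * r + Suc n * Suc r + r"
    and lip: "\<And>x y. x \<in> M \<Longrightarrow> y \<in> M \<Longrightarrow> d x y \<le> r \<Longrightarrow> e x = e y \<Longrightarrow> f x \<le> f y + r"
    and cross: "\<And>x y. x \<in> M \<Longrightarrow> y \<in> M \<Longrightarrow> d x y \<le> r \<Longrightarrow> e x \<noteq> e y \<Longrightarrow>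
      (f x \<le> 2 * r \<and> \<rho> < f y \<and> par (e x) = e y) \<or> (f y \<le> 2 * r \<and> \<rho> < f x \<and> par (e y) = e x)"
    and reg: "\<And>s. \<exists>B. \<forall>i. colourable n s B {x\<in>M. e x = i}"
    and near: "\<And>b. \<exists>b'. \<forall>x\<in>M. \<forall>y\<in>M. e x = e y \<longrightarrow> f x \<le> \<rho> \<longrightarrow> f y \<le> \<rho> \<longrightarrow> d (p x) (p y) \<le> b \<longrightarrow> d x y \<le> b'"
  shows "\<exists>B. colourable n r B M"
proof -
  \<comment> \<open>With \<open>n - m\<close> additional colours the total is \<open>n + 1\<close>,
    and every point lies in at least \<open>n - m + 1\<close>, hence two, classes.\<close>
  obtain B0 C where C: "\<And>x. x \<in> N \<Longrightarrow> n - m < card {i. i \<le> n \<and> x \<in> C i}"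
      "\<And>i. i \<le> n \<Longrightarrow> chain_bounded r B0 (C i)"
    using kolmogorov[OF N(1), of "n - m" r] N(2) by auto
  obtain b' where b': "\<And>x y. x \<in> M \<Longrightarrow> y \<in> M \<Longrightarrow> e x = e y \<Longrightarrow> f x \<le> \<rho> \<Longrightarrow> f y \<le> \<rho> \<Longrightarrow>
      d (p x) (p y) \<le> B0 \<Longrightarrow> d x y \<le> b'"
    using near[of B0] by blast
  \<comment> \<open>An excursion from the far part into an entry zone and back spans at most
    \<open>r + b' + r\<close>.\<close>
  define R where "R = b' + 2 * r"
  obtain B2 where "\<forall>i. colourable n R B2 {x\<in>M. e x = i}" using reg by blast
  then obtain D where D: "\<And>i. {x\<in>M. e x = i} \<subseteq> (\<Union>c\<le>n. D i c)"
      "\<And>i c. c \<le> n \<Longrightarrow> chain_bounded R B2 (D i c)"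
    unfolding colourable_def by metis
  \<comment> \<open>The blocks start at \<open>2 * r\<close>, above all contacts with the parent
    region, and their width \<open>r + 1\<close> is too large for an \<open>r\<close>-step to jump
    across. One block for each of the \<open>n + 1\<close> colours and a margin \<open>r\<close> add
    up to \<open>\<rho>\<close>.\<close>
  define lev where "lev t = 2 * r + t * Suc r" for t
  define block where "block t x \<longleftrightarrow> lev t < f x \<and> f x \<le> lev (Suc t)" for t x
  define Z where "Z c = {x\<in>M. f x \<le> \<rho> \<and> p x \<in> C c \<and> \<not> block c x}" for c
  define Y where "Y c = {x\<in>M. \<rho> < f x \<and> x \<in> D (e x) c}" for c
  have lev_mono: "lev s \<le> lev t" if "s \<le> t" for s t
    unfolding lev_def by (rule add_left_mono[OF mult_le_mono1[OF that]])
  have \<rho>_lev: "\<rho> = lev (Suc n) + r" unfolding \<rho> lev_def by simp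
  have block_unique: "s = t" if "block s x" "block t x" for s t x
  proof (rule ccontr)
    assume "s \<noteq> t"
    then have "Suc s \<le> t \<or> Suc t \<le> s" by auto
    then show False using lev_mono[of "Suc s" t] lev_mono[of "Suc t" s] that
      unfolding block_def by linarith
  qed
  \<comment> \<open>The barrier: a chain of colour \<open>c\<close> in an entry zone cannot change
    region, since one end of a crossing lies beyond \<open>\<rho>\<close>, and it cannot pass block
    \<open>c\<close>.\<close>
  have Z_chain: "y \<in> Z c \<and> e y = e x \<and> (step r (C c))\<^sup>*\<^sup>* (p x) (p y) \<and> (f x \<le> lev c \<longleftrightarrow> f y \<le> lev c)"
    if "(step r (Z c))\<^sup>*\<^sup>* x y" "x \<in> Z c" for x y c
    using that
  proof (induction rule: rtranclp_induct)
    case (step y w)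
    then have yw: "y \<in> Z c" "w \<in> Z c" "d y w \<le> r" "d w y \<le> r"
      using d_sym[of y w] by (auto simp: step_def)
    then have M: "y \<in> M" "w \<in> M" "f y \<le> \<rho>" "f w \<le> \<rho>" by (auto simp: Z_def)
    have e: "e y = e w" using cross[OF M(1,2) yw(3)] M(3,4) by linarith
    have "f y \<le> lev c \<longleftrightarrow> f w \<le> lev c"
      using lip[OF M(1,2) yw(3) e] lip[OF M(2,1) yw(4) e[symmetric]] yw(1,2)
      unfolding Z_def block_def lev_def by auto
    moreover have "step r (C c) (p y) (p w)"
      using yw p(2)[OF M(1,2)] by (auto simp: step_def Z_def)
    ultimately show ?case using step e yw by auto
  qed auto
  have Z_bounded: "chain_bounded r b' (Z c)" if c: "c \<le> n" for c
    unfolding chain_bounded_def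
  proof (intro allI impI)
    fix x y assume xy: "(step r (Z c))\<^sup>*\<^sup>* x y"
    show "d x y \<le> b'"
    proof (cases "x = y")
      case False
      then have x: "x \<in> Z c" using conn_source[OF xy] by simp
      then show ?thesis
        using Z_chain[OF xy x] b'[of x y] chain_boundedD[OF C(2)[OF c], of "p x" "p y"] unfolding Z_def by auto
    qed simp
  qed
  have "chain_bounded r (B2 + 2 * (b' + r)) (Z c \<union> Y c)" if c: "c \<le> n" for c
  proof (rule chain_bounded_merge[where K = "\<lambda>y y'. y \<in> Y c \<and> y' \<in> Y c \<and> e y = e y' \<and> d y y' \<le> R", OF Z_bounded[OF c]])
    fix y y' assume y: "y \<in> Y c" "y' \<in> Y c" "d y y' \<le> r"
    then show "y \<in> Y c \<and> y' \<in> Y c \<and> e y = e y' \<and> d y y' \<le> R"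
      using cross[of y y'] \<rho> unfolding Y_def R_def by auto
  next
    fix y y' z z' assume y: "y \<in> Y c" "y' \<in> Y c" and z: "z \<in> Z c" and yz: "d y z \<le> r"
      and zz: "(step r (Z c))\<^sup>*\<^sup>* z z'" and zy: "d z' y' \<le> r"
    have z': "z' \<in> Z c" "e z' = e z" "f z \<le> lev c \<longleftrightarrow> f z' \<le> lev c" using Z_chain[OF zz z] by auto
    \<comment> \<open>A far point touches the entry zone of a child region below block
      \<open>c\<close> and that of its own region above it. Since the side is constant along the
      excursion, both of its ends lie in the same region.\<close>
    have side: "(e w \<noteq> e u \<and> e w = par (e u) \<and> f u \<le> lev c) \<or> (e w = e u \<and> \<not> f u \<le> lev c)"
      if "w \<in> Y c" "u \<in> Z c" "d w u \<le> r" for w u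
    proof -
      have M: "w \<in> M" "u \<in> M" "\<rho> < f w" using that by (auto simp: Y_def Z_def)
      show ?thesis
      proof (cases "e w = e u")
        case True
        then show ?thesis
          using lip[OF M(1,2) that(3)] M(3) \<rho>_lev lev_mono[of c "Suc n"] c by auto
      next
        case False
        then show ?thesis
          using cross[OF M(1,2) that(3)] M(3) \<rho> unfolding lev_def by auto
      qed
    qed
    have "e y = e y'"
      using side[OF y(1) z yz] side[OF y(2) z'(1)] zy z' d_sym[of z' y'] by auto
    moreover have "d y y' \<le> R"
      using chain_boundedD[OF Z_bounded[OF c] zz] yz zy d_tri[of y y' z] d_tri[of z y' z'] unfolding R_def by linarith
    ultimately show "y \<in> Y c \<and> y' \<in> Y c \<and> e y = e y' \<and> d y y' \<le> R" using y by blast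
  next
    fix y y' assume "(\<lambda>y y'. y \<in> Y c \<and> y' \<in> Y c \<and> e y = e y' \<and> d y y' \<le> R)\<^sup>*\<^sup>* y y'"
    then have "(step R (D (e y) c))\<^sup>*\<^sup>* y y' \<and> e y = e y'"
    proof (induction rule: rtranclp_induct)
      case (step u w)
      then have "step R (D (e y) c) u w" by (auto simp: step_def Y_def)
      then show ?case using step by auto
    qed simp
    then show "d y y' \<le> B2" using chain_boundedD[OF D(2)[OF c]] by blast
  qed
  moreover have "M \<subseteq> (\<Union>c\<le>n. Z c \<union> Y c)"
  proof
    fix x assume x: "x \<in> M"
    show "x \<in> (\<Union>c\<le>n. Z c \<union> Y c)"
    proof (cases "f x \<le> \<rho>")
      case True
      \<comment> \<open>Two colours are available, and at most one of them is excluded, because the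
        blocks are disjoint.\<close>
      have "\<not> card {i. i \<le> n \<and> p x \<in> C i} \<le> Suc 0" using C(1)[OF p(1)[OF x]] N(2) by linarith
      then obtain a b where "a \<le> n" "b \<le> n" "p x \<in> C a" "p x \<in> C b" "a \<noteq> b"
        using card_le_Suc0_iff_eq[of "{i. i \<le> n \<and> p x \<in> C i}"] by auto
      then show ?thesis using block_unique[of a x b] x True unfolding Z_def by auto
    next
      case False
      then show ?thesis using x D(1)[of "e x"] unfolding Y_def by auto
    qed
  qed
  ultimately show ?thesis unfolding colourable_def by blast
qed

end

section \<open>Stacks of an amalgam\<close>

lemma (in group) l_coset_iff: "z \<in> x <# S \<longleftrightarrow> (\<exists>s\<in>S. z = x \<otimes> s)"
  by (auto simp: l_coset_def)

lemma (in group) l_coset_self: "subgroup S G \<Longrightarrow> x \<in> carrier G \<Longrightarrow> x \<in> x <# S"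
  by (metis l_coset_iff r_one subgroup.one_closed)

lemma (in group) l_coset_mult:
  "subgroup S G \<Longrightarrow> x \<in> carrier G \<Longrightarrow> s \<in> S \<Longrightarrow> (x \<otimes> s) <# S = x <# S"
  by (metis l_coset_iff l_repr_independence)

text \<open>Freeness of the amalgam is not an axiom here; it enters later, as the existence of a
  function from elements to stacks.\<close>

locale amalgam = group H for H (structure) +
  fixes A C K
  assumes A: "subgroup A H" and C: "subgroup C H" and K: "subgroup K H" and CA: "C \<subseteq> A"
    and CK: "\<And>c k. c \<in> C \<Longrightarrow> k \<in> K \<Longrightarrow> c \<otimes> k = k \<otimes> c"
begin

lemmas A_car [simp] = subgroup.mem_carrier[OF A]
lemmas C_car [simp] = subgroup.mem_carrier[OF C]
lemmas K_car [simp] = subgroup.mem_carrier[OF K]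

text \<open>A stack lists, from the top, the crossings between cosets of \<open>A\<close> on the way from \<open>A\<close> to an
  element: \<open>(Y, s)\<close> leaves a coset of \<open>A\<close> along the coset \<open>Y\<close> of \<open>C\<close> by multiplication with
  \<open>s \<in> K\<close>.\<close>

fun entry where
  "entry [] = {}"
| "entry ((Y, s) # \<sigma>) = (\<lambda>y. y \<otimes> s) ` Y"

fun piece where
  "piece [] = A"
| "piece ((Y, s) # \<sigma>) = {y \<otimes> s \<otimes> a | y a. y \<in> Y \<and> a \<in> A}"

text \<open>Well-formed stacks are reduced words modulo \<open>C\<close>: no crossing is trivial,
  and none leaves along the coset just used for entering. Storing the whole coset \<open>Y\<close>
  removes the choice of a representative.\<close>

fun wf where
  "wf [] = True"
| "wf ((Y, s) # \<sigma>) \<longleftrightarrow> wf \<sigma> \<and> s \<in> K \<and> s \<noteq> \<one> \<and> (\<exists>y\<in>piece \<sigma> - entry \<sigma>. Y = y <# C)"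

text \<open>Right multiplication by \<open>k\<close> as seen by the stack. On the entry coset the
  last crossing can still be altered, so \<open>k\<close> is absorbed into it and may cancel it;
  elsewhere a new crossing begins. \<open>hd\<close> and \<open>tl\<close> are harmless since
  \<open>entry [] = {}\<close>.\<close>

definition upd where
  "upd x \<sigma> k = (if k = \<one> then \<sigma> else if x \<in> entry \<sigma> then
     (if snd (hd \<sigma>) \<otimes> k = \<one> then tl \<sigma> else (fst (hd \<sigma>), snd (hd \<sigma>) \<otimes> k) # tl \<sigma>)
     else (x <# C, k) # \<sigma>)"

lemma upd_one [simp]: "upd x \<sigma> \<one> = \<sigma>"
  by (simp add: upd_def)

lemma upd_push: "k \<noteq> \<one> \<Longrightarrow> x \<notin> entry \<sigma> \<Longrightarrow> upd x \<sigma> k = (x <# C, k) # \<sigma>"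
  by (simp add: upd_def)

lemma upd_top:
  "k \<noteq> \<one> \<Longrightarrow> x \<in> entry ((Y, s) # \<sigma>) \<Longrightarrow>
    upd x ((Y, s) # \<sigma>) k = (if s \<otimes> k = \<one> then \<sigma> else (Y, s \<otimes> k) # \<sigma>)"
  by (simp add: upd_def)

lemma wf_piece: "wf \<sigma> \<Longrightarrow> piece \<sigma> \<subseteq> carrier H"
proof (induction \<sigma>)
  case (Cons q \<sigma>)
  obtain Y s where q: "q = (Y, s)" by fastforce
  then have "Y \<subseteq> carrier H" "s \<in> carrier H"
    using Cons l_coset_subset_G[OF subgroup.subset[OF C]] by auto
  then show ?case using q by auto
qed (simp add: subgroup.subset[OF A])

lemma commute: "y \<in> carrier H \<Longrightarrow> c \<in> C \<Longrightarrow> k \<in> K \<Longrightarrow> y \<otimes> c \<otimes> k = y \<otimes> k \<otimes> c"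
  using CK[of c k] by (simp add: m_assoc)

text \<open>Elements of \<open>C\<close> slide past \<open>s\<close>, so the right translate of a
  left coset of \<open>C\<close> is again a left coset.\<close>

lemma top_sets:
  assumes "y \<in> carrier H" "s \<in> K"
  shows "entry ((y <# C, s) # \<sigma>) = (y \<otimes> s) <# C" "piece ((y <# C, s) # \<sigma>) = (y \<otimes> s) <# A"
proof -
  have "y \<otimes> c \<otimes> s = y \<otimes> s \<otimes> c" if "c \<in> C" for c using commute[OF assms(1) that assms(2)] .
  then show "entry ((y <# C, s) # \<sigma>) = (y \<otimes> s) <# C"
    by (auto simp: l_coset_def image_iff)
  show "piece ((y <# C, s) # \<sigma>) = (y \<otimes> s) <# A"
  proof (intro equalityI subsetI)
    fix z assume "z \<in> piece ((y <# C, s) # \<sigma>)"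
    then obtain c a where ca: "c \<in> C" "a \<in> A" "z = y \<otimes> c \<otimes> s \<otimes> a"
      by (auto simp: l_coset_iff)
    have "z = (y \<otimes> s) \<otimes> (c \<otimes> a)"
      using ca assms commute[OF assms(1) ca(1) assms(2)] by (simp add: m_assoc)
    moreover have "c \<otimes> a \<in> A" using ca CA subgroup.m_closed[OF A] by auto
    ultimately show "z \<in> (y \<otimes> s) <# A" by (auto simp: l_coset_iff)
  next
    fix z assume "z \<in> (y \<otimes> s) <# A"
    then show "z \<in> piece ((y <# C, s) # \<sigma>)"
      using l_coset_self[OF C assms(1)] by (auto simp: l_coset_iff)
  qed
qed

lemma wf_topE:
  assumes "wf ((Y, s) # \<sigma>)"
  obtains y where "y \<in> piece \<sigma>" "y \<notin> entry \<sigma>" "Y = y <# C" "y \<in> carrier H" "s \<in> K" "s \<noteq> \<one>"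
    "wf \<sigma>" "entry ((Y, s) # \<sigma>) = (y \<otimes> s) <# C" "piece ((Y, s) # \<sigma>) = (y \<otimes> s) <# A"
proof -
  obtain y where y: "y \<in> piece \<sigma>" "y \<notin> entry \<sigma>" "Y = y <# C" using assms by auto
  moreover have "y \<in> carrier H" using wf_piece y(1) assms by auto
  ultimately show ?thesis using that[of y] assms top_sets[of y s \<sigma>] by auto
qed

lemma piece_mult_A: "wf \<sigma> \<Longrightarrow> x \<in> piece \<sigma> \<Longrightarrow> a \<in> A \<Longrightarrow> x \<otimes> a \<in> piece \<sigma>"
proof (cases \<sigma>)
  case (Cons q \<sigma>')
  assume *: "wf \<sigma>" "x \<in> piece \<sigma>" "a \<in> A"
  obtain Y s where "\<sigma> = (Y, s) # \<sigma>'" using Cons by (cases q) auto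
  moreover obtain y where "y \<in> carrier H" "s \<in> K" "piece ((Y, s) # \<sigma>') = (y \<otimes> s) <# A"
    using wf_topE * calculation by metis
  ultimately show ?thesis using * subgroup.m_closed[OF A] by (fastforce simp: l_coset_iff m_assoc)
qed (use subgroup.m_closed[OF A] in auto)

lemma entry_mult_C:
  assumes "wf \<sigma>" "x \<in> carrier H" "c \<in> C"
  shows "x \<otimes> c \<in> entry \<sigma> \<longleftrightarrow> x \<in> entry \<sigma>"
proof (cases \<sigma>)
  case (Cons q \<sigma>')
  obtain Y s where "\<sigma> = (Y, s) # \<sigma>'" using Cons by (cases q) auto
  moreover obtain y where y: "y \<in> carrier H" "s \<in> K" "entry ((Y, s) # \<sigma>') = (y \<otimes> s) <# C"
    using wf_topE assms calculation by metis
  moreover have "x \<otimes> c \<in> (y \<otimes> s) <# C \<Longrightarrow> x \<in> (y \<otimes> s) <# C"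
    using l_coset_mult[OF C assms(2,3)] l_coset_self[OF C assms(2)] l_repr_independence[OF _ _ C] y
    by (metis K_car m_closed)
  moreover have "x \<in> (y \<otimes> s) <# C \<Longrightarrow> x \<otimes> c \<in> (y \<otimes> s) <# C"
    using assms y subgroup.m_closed[OF C] by (fastforce simp: l_coset_iff m_assoc)
  ultimately show ?thesis by auto
qed simp

text \<open>This is what the commutation relations between \<open>v\<close> and its link require of
  stacks.\<close>

lemma upd_mult_C:
  assumes "wf \<sigma>" "x \<in> carrier H" "c \<in> C"
  shows "upd (x \<otimes> c) \<sigma> k = upd x \<sigma> k"
  using entry_mult_C[OF assms] l_coset_mult[OF C assms(2,3)] by (simp add: upd_def)

text \<open>The representative of \<open>Y\<close> is adapted to \<open>x\<close>: the element of
  \<open>C\<close> by which they differ slides past \<open>s\<close> and is absorbed into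
  \<open>y\<close>, so that \<open>x = y \<otimes> s\<close> holds exactly.\<close>

lemma entryE:
  assumes "wf \<sigma>" "x \<in> entry \<sigma>"
  obtains Y s \<sigma>' y where "\<sigma> = (Y, s) # \<sigma>'" "y \<in> piece \<sigma>'" "y \<notin> entry \<sigma>'" "Y = y <# C"
    "y \<in> carrier H" "s \<in> K" "s \<noteq> \<one>" "wf \<sigma>'" "x = y \<otimes> s"
proof -
  obtain Y s \<sigma>' where \<sigma>: "\<sigma> = (Y, s) # \<sigma>'" using assms by (cases \<sigma>) auto
  obtain z where z: "z \<in> piece \<sigma>'" "z \<notin> entry \<sigma>'" "Y = z <# C" "z \<in> carrier H" "s \<in> K" "s \<noteq> \<one>" "wf \<sigma>'"
    using wf_topE assms \<sigma> by metis
  obtain c where c: "c \<in> C" "x = z \<otimes> c \<otimes> s" using assms(2) \<sigma> z(3) by (auto simp: l_coset_iff)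
  show ?thesis
    using that[OF \<sigma>, of "z \<otimes> c"] c z piece_mult_A[OF z(7,1)] CA entry_mult_C[OF z(7,4) c(1)]
      l_coset_mult[OF C z(4) c(1)] by auto
qed

lemma upd_good:
  assumes "wf \<sigma>" "x \<in> piece \<sigma>" "k \<in> K"
  shows "wf (upd x \<sigma> k) \<and> x \<otimes> k \<in> piece (upd x \<sigma> k)"
proof (cases "k = \<one> \<or> x \<notin> entry \<sigma>")
  case True
  have x: "x \<in> carrier H" using assms wf_piece by auto
  show ?thesis
  proof (cases "k = \<one>")
    case False
    then have "x \<notin> entry \<sigma>" using True by simp
    moreover have "x \<otimes> k \<in> piece ((x <# C, k) # \<sigma>)"
      using x assms l_coset_self[OF A] by (simp del: piece.simps add: top_sets)
    ultimately show ?thesis using assms False by (auto simp: upd_push simp del: piece.simps)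
  qed (use assms x in simp)
next
  case False
  then have k: "k \<noteq> \<one>" "x \<in> entry \<sigma>" by auto
  then obtain Y s \<sigma>' y where y: "\<sigma> = (Y, s) # \<sigma>'" "y \<in> piece \<sigma>'" "y \<notin> entry \<sigma>'" "Y = y <# C"
    "y \<in> carrier H" "s \<in> K" "s \<noteq> \<one>" "wf \<sigma>'" "x = y \<otimes> s"
    using entryE[OF assms(1)] by metis
  have u: "upd x \<sigma> k = (if s \<otimes> k = \<one> then \<sigma>' else (Y, s \<otimes> k) # \<sigma>')"
    using upd_top[OF k(1)] k(2) y(1) by simp
  have sk: "s \<otimes> k \<in> K" using y assms subgroup.m_closed[OF K] by auto
  have xk: "x \<otimes> k = y \<otimes> (s \<otimes> k)" using y assms by (simp add: m_assoc)
  show ?thesis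
  proof (cases "s \<otimes> k = \<one>")
    case True
    then show ?thesis using u xk y by simp
  next
    case False
    have "x \<otimes> k \<in> piece ((Y, s \<otimes> k) # \<sigma>')"
      unfolding xk y(4) using y(5) sk l_coset_self[OF A] by (simp del: piece.simps add: top_sets)
    then show ?thesis using u False y sk by (auto simp del: piece.simps)
  qed
qed

text \<open>This is what the multiplication relations of the vertex group at \<open>v\<close>
  require of stacks. The delicate case is cancellation: when \<open>s\<close> removes the top
  crossing, \<open>t\<close> reopens it along the same coset \<open>Y\<close>.\<close>

lemma upd_upd:
  assumes "wf \<sigma>" "x \<in> piece \<sigma>" "s \<in> K" "t \<in> K"
  shows "upd (x \<otimes> s) (upd x \<sigma> s) t = upd x \<sigma> (s \<otimes> t)"
proof (cases "s = \<one> \<or> t = \<one>")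
  case True
  then show ?thesis using assms wf_piece[OF assms(1)] by auto
next
  case False
  then have st: "s \<noteq> \<one>" "t \<noteq> \<one>" by auto
  have x: "x \<in> carrier H" using assms wf_piece by auto
  show ?thesis
  proof (cases "x \<in> entry \<sigma>")
    case False
    have "x \<otimes> s \<in> entry ((x <# C, s) # \<sigma>)" using l_coset_self[OF C x] by auto
    then show ?thesis using False st
      by (simp add: upd_push upd_top del: entry.simps)
  next
    case True
    then obtain Y q \<sigma>' y where y: "\<sigma> = (Y, q) # \<sigma>'" "y \<in> piece \<sigma>'" "y \<notin> entry \<sigma>'" "Y = y <# C"
      "y \<in> carrier H" "q \<in> K" "q \<noteq> \<one>" "wf \<sigma>'" "x = y \<otimes> q"
      using entryE[OF assms(1)] by metis
    have u: "upd x \<sigma> k = (if q \<otimes> k = \<one> then \<sigma>' else (Y, q \<otimes> k) # \<sigma>')" if "k \<noteq> \<one>" for k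
      using upd_top[OF that] True y(1) by simp
    have cars: "q \<in> carrier H" "s \<in> carrier H" "t \<in> carrier H" using y assms by auto
    have xs: "x \<otimes> s = y \<otimes> (q \<otimes> s)" using y cars by (simp add: m_assoc)
    have qst: "q \<otimes> s \<otimes> t = q \<otimes> (s \<otimes> t)" using cars by (simp add: m_assoc)
    show ?thesis
    proof (cases "q \<otimes> s = \<one>")
      case True
      have "upd (x \<otimes> s) (upd x \<sigma> s) t = (Y, t) # \<sigma>'"
        using u[OF st(1)] True xs y st by (simp add: upd_push)
      moreover have "upd x \<sigma> (s \<otimes> t) = (Y, t) # \<sigma>'"
      proof (cases "s \<otimes> t = \<one>")
        case T: True
        have "t = q" using True T cars qst by simp
        then show ?thesis using T y(1) by simp
      next
        case F: False
        then show ?thesis using u[OF F] qst True st cars by simp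
      qed
      ultimately show ?thesis by simp
    next
      case False
      have "x \<otimes> s \<in> entry ((Y, q \<otimes> s) # \<sigma>')" unfolding xs using y l_coset_self[OF C y(5)] by auto
      then have "upd (x \<otimes> s) (upd x \<sigma> s) t = (if q \<otimes> s \<otimes> t = \<one> then \<sigma>' else (Y, q \<otimes> s \<otimes> t) # \<sigma>')"
        using u[OF st(1)] False upd_top[OF st(2)] by simp
      moreover have "upd x \<sigma> (s \<otimes> t) = (if q \<otimes> s \<otimes> t = \<one> then \<sigma>' else (Y, q \<otimes> s \<otimes> t) # \<sigma>')"
      proof (cases "s \<otimes> t = \<one>")
        case True
        then show ?thesis using qst cars y(1,7) by simp
      next
        case F: False
        then show ?thesis using u[OF F] qst by simp
      qed
      ultimately show ?thesis by simp
    qed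
  qed
qed

lemma upd_length:
  "length \<sigma> \<le> Suc (length (upd x \<sigma> k)) \<and> length (upd x \<sigma> k) \<le> Suc (length \<sigma>)"
  by (cases \<sigma>) (auto simp: upd_def)

lemma upd_longer:
  "length \<sigma> < length (upd x \<sigma> k) \<Longrightarrow> k \<noteq> \<one> \<and> upd x \<sigma> k = (x <# C, k) # \<sigma>"
  by (cases \<sigma>) (auto simp: upd_def split: if_splits)

lemma upd_cases:
  "upd x \<sigma> k = \<sigma> \<or> (k \<noteq> \<one> \<and> x \<notin> entry \<sigma> \<and> upd x \<sigma> k = (x <# C, k) # \<sigma>) \<or>
    (x \<in> entry \<sigma> \<and> (\<exists>Y s \<sigma>'. \<sigma> = (Y, s) # \<sigma>' \<and> (upd x \<sigma> k = \<sigma>' \<or> upd x \<sigma> k = (Y, s \<otimes> k) # \<sigma>')))"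
  by (cases \<sigma>) (auto simp: upd_def)

end

section \<open>Asymptotic dimension of an amalgam\<close>

text \<open>The three equations for \<open>stk\<close> carry the freeness of the amalgam. By
  \<open>path\<close>, distances are realised by short moves along factors from \<open>A\<close> and
  \<open>K\<close>, so that separation in the tree has metric consequences.\<close>

locale metric_amalgam = amalgam H A C K + pseudo_metric d
  for H :: "('a, 'b) monoid_scheme" (structure) and A C K and d :: "'a \<Rightarrow> 'a \<Rightarrow> nat" +
  fixes M :: "'a set" and p :: "'a \<Rightarrow> 'a" and stk :: "'a \<Rightarrow> ('a set \<times> 'a) list"
  assumes M: "subgroup M H" and AM: "A \<subseteq> M" and KM: "K \<subseteq> M"
    and stk_one: "stk \<one> = []"
    and stk_A: "\<And>x a. x \<in> M \<Longrightarrow> a \<in> A \<Longrightarrow> stk (x \<otimes> a) = stk x"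
    and stk_K: "\<And>x k. x \<in> M \<Longrightarrow> k \<in> K \<Longrightarrow> stk (x \<otimes> k) = upd x (stk x) k"
    and path: "\<And>x y. x \<in> M \<Longrightarrow> y \<in> M \<Longrightarrow>
      \<exists>l\<le>d x y. ((\<lambda>u w. u \<in> M \<and> d u w \<le> 1 \<and> (\<exists>t\<in>A \<union> K. w = u \<otimes> t)) ^^ l) x y"
    and d_mult: "\<And>g x y. g \<in> M \<Longrightarrow> x \<in> M \<Longrightarrow> y \<in> M \<Longrightarrow> d (g \<otimes> x) (g \<otimes> y) = d x y"
    and p_C: "\<And>x. x \<in> M \<Longrightarrow> p x \<in> C"
    and p_mult: "\<And>x c. x \<in> M \<Longrightarrow> c \<in> C \<Longrightarrow> p (x \<otimes> c) = p x \<otimes> c"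
    and p_lip: "\<And>x y. x \<in> M \<Longrightarrow> y \<in> M \<Longrightarrow> d (p x) (p y) \<le> d x y"
begin

definition adj where "adj u w \<longleftrightarrow> u \<in> M \<and> d u w \<le> 1 \<and> (\<exists>t\<in>A \<union> K. w = u \<otimes> t)"

definition depth where "depth x = length (stk x)"

text \<open>The subtree beyond the crossing on top of \<open>\<sigma>\<close>. Stacks grow at the
  head, so the crossings nearest to the root form a suffix.\<close>

definition above where "above \<sigma> x \<longleftrightarrow> (\<exists>\<tau>. stk x = \<tau> @ \<sigma>)"

definition ball_M where "ball_M j = {x\<in>M. depth x \<le> j}"

text \<open>The layer between two balls: in the Bass-Serre tree cosets of \<open>A\<close> alternate
  with cosets of \<open>C <#> K\<close>, and one unit of \<open>depth\<close> passes both
  kinds.\<close>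

definition cross_M where "cross_M j = {x \<otimes> k | x k. x \<in> ball_M j \<and> k \<in> K}"

lemmas M_car [simp] = subgroup.mem_carrier[OF M]
lemmas M_closed = subgroup.m_closed[OF M] subgroup.m_inv_closed[OF M] subgroup.one_closed[OF M]

lemma in_M [simp]: "a \<in> A \<Longrightarrow> a \<in> M" "k \<in> K \<Longrightarrow> k \<in> M" "c \<in> C \<Longrightarrow> c \<in> M" "c \<in> C \<Longrightarrow> c \<in> A"
  using AM KM CA by auto

section \<open>The tree of stacks and its separation properties\<close>

lemma adj_path: "x \<in> M \<Longrightarrow> y \<in> M \<Longrightarrow> \<exists>l\<le>d x y. (adj ^^ l) x y"
  using path unfolding adj_def by simp

lemma adj_M: "adj u w \<Longrightarrow> w \<in> M"
  unfolding adj_def using M_closed(1) by auto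

lemma adj_dist: "(adj ^^ l) x y \<Longrightarrow> d x y \<le> l"
proof (induction l arbitrary: y)
  case (Suc l)
  then obtain z where "(adj ^^ l) x z" "adj z y" by auto
  moreover have "d z y \<le> 1" using \<open>adj z y\<close> by (simp add: adj_def)
  ultimately show ?case using Suc.IH[of z] d_tri[of x y z] by simp
qed simp

lemma M_induct [consumes 1, case_names one mult]:
  assumes "x \<in> M" "P \<one>" "\<And>x t. x \<in> M \<Longrightarrow> P x \<Longrightarrow> t \<in> A \<union> K \<Longrightarrow> P (x \<otimes> t)"
  shows "P x"
proof -
  obtain l where "(adj ^^ l) \<one> x" using adj_path[of \<one> x] assms(1) M_closed(3) by auto
  then show ?thesis
  proof (induction l arbitrary: x)
    case (Suc l)
    then obtain z where "(adj ^^ l) \<one> z" "adj z x" by auto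
    moreover obtain t where "z \<in> M" "t \<in> A \<union> K" "x = z \<otimes> t"
      using \<open>adj z x\<close> unfolding adj_def by blast
    ultimately show ?case using Suc.IH[of z] assms(3) by blast
  qed (use assms(2) in simp)
qed

lemma good: "x \<in> M \<Longrightarrow> wf (stk x) \<and> x \<in> piece (stk x)"
proof (induction rule: M_induct)
  case one
  show ?case using subgroup.one_closed[OF A] by (simp add: stk_one)
next
  case (mult x t)
  then show ?case using upd_good piece_mult_A by (auto simp: stk_A stk_K)
qed

text \<open>Uniqueness of reduced forms: building the element up from the bottom of a well-formed
  stack uses pushes only, so the stack is reproduced.\<close>

lemma wf_stk: "wf \<sigma> \<Longrightarrow> x \<in> piece \<sigma> \<Longrightarrow> x \<in> M \<and> stk x = \<sigma>"
proof (induction \<sigma> arbitrary: x)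
  case Nil
  then show ?case using stk_A[of \<one> x] M_closed(3) by (simp add: stk_one)
next
  case (Cons q \<sigma>)
  obtain Y s where q: "q = (Y, s)" by fastforce
  obtain y where y: "y \<in> piece \<sigma>" "y \<notin> entry \<sigma>" "Y = y <# C" "s \<in> K" "s \<noteq> \<one>" "wf \<sigma>"
    "piece ((Y, s) # \<sigma>) = (y \<otimes> s) <# A"
    using wf_topE Cons.prems(1) q by metis
  obtain a where a: "a \<in> A" "x = (y \<otimes> s) \<otimes> a" using Cons.prems(2) unfolding q y(7) l_coset_iff by auto
  have yM: "y \<in> M" "stk y = \<sigma>" using Cons.IH y by auto
  then have "stk (y \<otimes> s) = q # \<sigma>" using y q by (simp add: stk_K upd_push)
  then show ?case using a yM y M_closed(1) by (simp add: stk_A)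
qed

lemma piece_iff: "wf \<sigma> \<Longrightarrow> x \<in> piece \<sigma> \<longleftrightarrow> x \<in> M \<and> stk x = \<sigma>"
  using wf_stk good by auto

lemma entry_piece: "wf \<sigma> \<Longrightarrow> x \<in> entry \<sigma> \<Longrightarrow> x \<in> piece \<sigma>"
proof -
  assume *: "wf \<sigma>" "x \<in> entry \<sigma>"
  then obtain Y s \<sigma>' where \<sigma>: "\<sigma> = (Y, s) # \<sigma>'" by (cases \<sigma>) auto
  then show ?thesis using * subgroup.one_closed[OF A] wf_topE
    by (metis (no_types, lifting) CA l_coset_iff subsetD)
qed

lemma wf_coset:
  assumes "wf \<sigma>"
  obtains g where "g \<in> M" "piece \<sigma> = g <# A" "\<sigma> \<noteq> [] \<Longrightarrow> entry \<sigma> = g <# C" "\<sigma> \<noteq> [] \<Longrightarrow> g \<in> entry \<sigma>"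
proof (cases \<sigma>)
  case Nil
  have "A = \<one> <# A" using subgroup.subset[OF A] by (auto simp: l_coset_iff)
  then show ?thesis using that[of \<one>] Nil M_closed(3) by simp
next
  case (Cons q \<sigma>')
  then obtain Y s where \<sigma>: "\<sigma> = (Y, s) # \<sigma>'" by (cases q) auto
  then obtain y where y: "y \<in> carrier H" "s \<in> K" "entry \<sigma> = (y \<otimes> s) <# C" "piece \<sigma> = (y \<otimes> s) <# A"
    using wf_topE assms by metis
  then have "y \<otimes> s \<in> piece \<sigma>" "y \<otimes> s \<in> entry \<sigma>"
    using l_coset_self[OF A, of "y \<otimes> s"] l_coset_self[OF C, of "y \<otimes> s"] by auto
  then show ?thesis using that[of "y \<otimes> s"] y piece_iff[OF assms] by blast
qed

lemma wf_suffix: "wf (\<tau> @ \<sigma>) \<Longrightarrow> wf \<sigma>"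
  by (induction \<tau>) auto

text \<open>A path of length at most \<open>d x y\<close> has to leave \<open>Q\<close> somewhere,
  and the point of \<open>T\<close> met there is no farther along it than \<open>y\<close>.\<close>

lemma path_crossing:
  assumes "x \<in> M" "y \<in> M" "Q x" "\<not> Q y"
    and "\<And>a b. adj a b \<Longrightarrow> Q a \<Longrightarrow> \<not> Q b \<Longrightarrow> a \<in> T \<or> b \<in> T"
  shows "\<exists>z\<in>T. d x z \<le> d x y"
proof -
  obtain l where l: "l \<le> d x y" "(adj ^^ l) x y" using adj_path assms by blast
  have "\<exists>z\<in>T. d x z \<le> l" using l(2) assms(4)
  proof (induction l arbitrary: y)
    case (Suc l)
    then obtain z where z: "(adj ^^ l) x z" "adj z y" by auto
    then have "d x z \<le> l" "d x y \<le> Suc l" using adj_dist Suc.prems(1) by blast+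
    then show ?case using Suc.IH[OF z(1)] assms(5)[OF z(2)] Suc.prems(2)
      by (metis le_SucI)
  qed (use assms(3) in simp)
  then show ?thesis using l(1) by (meson order_trans)
qed

lemma depth_adj: "adj a b \<Longrightarrow> depth a \<le> Suc (depth b)"
proof -
  assume "adj a b"
  then obtain t where t: "a \<in> M" "t \<in> A \<union> K" "b = a \<otimes> t" by (auto simp: adj_def)
  then show ?thesis
    using upd_length[of "stk a" a t] unfolding depth_def by (auto simp: stk_A stk_K)
qed

lemma depth_lip: "x \<in> M \<Longrightarrow> y \<in> M \<Longrightarrow> depth x \<le> depth y + d x y"
proof -
  assume "x \<in> M" "y \<in> M"
  then obtain l where l: "l \<le> d x y" "(adj ^^ l) x y" using adj_path by blast
  from l(2) have "depth x \<le> depth y + l"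
  proof (induction l arbitrary: y)
    case (Suc l)
    then obtain z where "(adj ^^ l) x z" "adj z y" by auto
    then show ?case using Suc.IH[of z] depth_adj[of z y] by simp
  qed simp
  then show ?thesis using l by simp
qed

text \<open>A push stays in the subtree, and a change of a crossing above \<open>\<sigma>\<close>
  leaves \<open>\<sigma>\<close> intact. Only the top crossing of \<open>\<sigma>\<close> itself can
  be altered, which happens on its entry coset.\<close>

lemma above_exit:
  assumes "adj a b" "above \<sigma> a" "\<not> above \<sigma> b"
  shows "stk a = \<sigma>" "a \<in> entry \<sigma>"
proof -
  obtain t where t: "a \<in> M" "t \<in> A \<union> K" "b = a \<otimes> t" using assms by (auto simp: adj_def)
  obtain \<tau> where \<tau>: "stk a = \<tau> @ \<sigma>" using assms by (auto simp: above_def)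
  have "t \<in> K" "stk b \<noteq> stk a" using t assms by (auto simp: stk_A above_def)
  then have b: "stk b = upd a (stk a) t" using t stk_K by simp
  have "\<tau> = []"
  proof (rule ccontr)
    assume "\<tau> \<noteq> []"
    then have "above \<sigma> b" using upd_cases[of a "stk a" t] b \<tau> by (cases \<tau>) (auto simp: above_def)
    then show False using assms by simp
  qed
  then show "stk a = \<sigma>" using \<tau> by simp
  have "stk b \<noteq> (a <# C, t) # stk a" using assms(3) \<tau> by (auto simp: above_def)
  then show "a \<in> entry \<sigma>"
    using upd_cases[of a "stk a" t] b \<open>stk b \<noteq> stk a\<close> \<open>stk a = \<sigma>\<close> by auto
qed

lemma exit_above:
  assumes "x \<in> M" "y \<in> M" "above \<sigma> x" "\<not> above \<sigma> y"
  shows "\<exists>z\<in>entry \<sigma>. d x z \<le> d x y"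
  by (rule path_crossing[where Q = "above \<sigma>", OF assms]) (use above_exit in auto)

lemma entry_depth: "wf \<sigma> \<Longrightarrow> x \<in> entry \<sigma> \<Longrightarrow> x \<in> M \<and> stk x = \<sigma>"
  using entry_piece piece_iff by blast

text \<open>Left translations by \<open>M\<close> are isometries, so one colouring of
  \<open>S\<close> serves all subsets of its translates.\<close>

lemma uniform_translate:
  assumes "asd S n" "\<And>P. P \<in> I \<Longrightarrow> \<exists>g\<in>M. P \<subseteq> g <# S" "S \<subseteq> M"
  shows "\<exists>B. \<forall>P\<in>I. colourable n r B P"
proof -
  obtain B where B: "colourable n r B S" using assms(1) unfolding asd_def by blast
  have "colourable n r B P" if P: "P \<in> I" for P
  proof -
    obtain g where g: "g \<in> M" "P \<subseteq> g <# S" using assms(2)[OF P] by blast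
    have "inv g \<otimes> x \<in> S" "x \<in> M" if x: "x \<in> P" for x
    proof -
      obtain s where "s \<in> S" "x = g \<otimes> s" using subsetD[OF g(2) x] unfolding l_coset_iff by blast
      then show "inv g \<otimes> x \<in> S" "x \<in> M" using g assms(3) M_closed
        by (auto simp: m_assoc[symmetric] subset_iff)
    qed
    then show ?thesis
      using g M_closed(2) by (intro colourable_isometry[OF B, of P "\<lambda>x. inv g \<otimes> x"]) (auto simp: d_mult)
  qed
  then show ?thesis by blast
qed

section \<open>Elements of bounded syllable length\<close>

lemma ball_sub: "ball_M j \<subseteq> cross_M j"
proof
  fix x assume "x \<in> ball_M j"
  moreover have "x = x \<otimes> \<one>" using \<open>x \<in> ball_M j\<close> by (simp add: ball_M_def)
  ultimately show "x \<in> cross_M j" using subgroup.one_closed[OF K] unfolding cross_M_def by blast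
qed

text \<open>The union theorem for the cosets of \<open>C <#> K\<close> that meet the ball. Away from
  the ball, different cosets lie in different branches, and a path between branches descends into
  the ball.\<close>

lemma asd_cross:
  assumes "asd (C <#> K) n" "asd (ball_M j) n"
  shows "asd (cross_M j) n"
proof (rule asd_union[where I = "(\<lambda>x. x <# (C <#> K)) ` ball_M j" and P = "\<lambda>P. P"])
  have CKM: "C <#> K \<subseteq> M" using M_closed(1) by (auto simp: set_mult_def)
  show "\<exists>B. \<forall>P\<in>(\<lambda>x. x <# (C <#> K)) ` ball_M j. colourable n r B P" for r
    by (rule uniform_translate[OF assms(1) _ CKM]) (auto simp: ball_M_def)
  fix r
  define Y where "Y = {x. \<exists>z\<in>ball_M j. d x z \<le> r}"
  have below: "depth z > j" if "d x z \<le> r" "x \<notin> Y" "z \<in> M" for x z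
    using that by (force simp: Y_def ball_M_def)
  have pushed: "\<exists>k\<in>K. k \<noteq> \<one> \<and> stk u = (x <# C, k) # stk x \<and> depth x = j"
    if xu: "x \<in> ball_M j" "u \<in> x <# (C <#> K)" "u \<notin> Y" for x u
  proof -
    obtain c k where ck: "c \<in> C" "k \<in> K" "u = x \<otimes> (c \<otimes> k)"
      using xu(2) by (auto simp: l_coset_iff set_mult_def)
    have x: "x \<in> M" "depth x \<le> j" using that by (auto simp: ball_M_def)
    have u: "u = (x \<otimes> c) \<otimes> k" using ck x by (simp add: m_assoc)
    have xc: "x \<otimes> c \<in> M" "stk (x \<otimes> c) = stk x" using ck x M_closed by (auto simp: stk_A)
    have uM: "u \<in> M" using u xc ck M_closed(1) by auto
    have su: "stk u = upd x (stk x) k"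
      using u xc ck x upd_mult_C[of "stk x" x c k] good[OF x(1)] by (simp add: stk_K)
    have "depth u > j" using below[of u u] xu uM by simp
    then show ?thesis
      using upd_longer[of "stk x" x k] upd_length[of "stk x" x k] su x(2) ck(2) unfolding depth_def by auto
  qed
  have "P = P'" if P: "P \<in> (\<lambda>x. x <# (C <#> K)) ` ball_M j" "P' \<in> (\<lambda>x. x <# (C <#> K)) ` ball_M j"
    and uw: "u \<in> P - Y" "w \<in> P' - Y" "d u w \<le> r" for P P' u w
  proof -
    obtain x x' where x: "x \<in> ball_M j" "P = x <# (C <#> K)" "x' \<in> ball_M j" "P' = x' <# (C <#> K)"
      using P by auto
    obtain k where k: "k \<in> K" "k \<noteq> \<one>" "stk u = (x <# C, k) # stk x" "depth x = j"
      using pushed[of x u] x uw by auto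
    obtain k' where k': "stk w = (x' <# C, k') # stk x'" "depth x' = j"
      using pushed[of x' w] x uw by auto
    have xM: "x \<in> M" "x' \<in> M" using x by (auto simp: ball_M_def)
    have M: "u \<in> M" "w \<in> M" using x uw xM CKM M_closed(1) by (auto simp: l_coset_iff)
    \<comment> \<open>The factor \<open>q\<close> is left free because a step inside the coset of
      \<open>C <#> K\<close> may replace it without leaving the branch at
      \<open>x <# C\<close>.\<close>
    define Q where "Q z \<longleftrightarrow> (\<exists>\<tau> q. stk z = \<tau> @ (x <# C, q) # stk x)" for z
    have "Q w"
    proof (rule ccontr)
      assume "\<not> Q w"
      have "\<exists>z\<in>ball_M j. d u z \<le> d u w"
      proof (rule path_crossing[where Q = Q, OF M])
        show "Q u" unfolding Q_def using k(3) by (metis append_Nil)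
        fix a b assume ab: "adj a b" "Q a" "\<not> Q b"
        obtain \<tau> q where \<tau>: "stk a = \<tau> @ (x <# C, q) # stk x" using ab(2) Q_def by auto
        have "above ((x <# C, q) # stk x) a" "\<not> above ((x <# C, q) # stk x) b"
          using ab \<tau> by (auto simp: Q_def above_def)
        note e = above_exit[OF ab(1) this]
        obtain t where t: "a \<in> M" "t \<in> A \<union> K" "b = a \<otimes> t" using ab by (auto simp: adj_def)
        have "stk b \<noteq> stk a" using ab \<tau> by (auto simp: Q_def)
        then have b: "stk b = upd a (stk a) t" using t by (auto simp: stk_A stk_K)
        have "stk b \<noteq> (x <# C, q') # stk x" for q' using ab(3) unfolding Q_def by (metis append_Nil)
        then have "stk b = stk x" using upd_cases[of a "stk a" t] b e \<open>stk b \<noteq> stk a\<close> by auto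
        then have "b \<in> ball_M j" using k(4) adj_M[OF ab(1)] by (simp add: ball_M_def depth_def)
        then show "a \<in> ball_M j \<or> b \<in> ball_M j" by simp
      qed (use \<open>\<not> Q w\<close> in simp)
      then show False using uw by (auto simp: Y_def)
    qed
    then obtain \<tau> q where "(x' <# C, k') # stk x' = \<tau> @ (x <# C, q) # stk x"
      unfolding Q_def k'(1) by auto
    moreover from arg_cong[OF this, of length] have "\<tau> = []"
      using k(4) k'(2) by (simp add: depth_def)
    ultimately have "x' <# C = x <# C" by simp
    then obtain c where c: "c \<in> C" "x' = x \<otimes> c"
      using l_coset_self[OF C, of x'] xM by (auto simp: l_coset_iff)
    have "c <# (C <#> K) = C <#> K"
      using coset_join3[OF _ C] setmult_lcos_assoc[OF subgroup.subset[OF C] subgroup.subset[OF K], of c] c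
      by simp
    then have "x' <# (C <#> K) = x <# (C <#> K)"
      using c(2) lcos_m_assoc[of "C <#> K" x c] xM c(1) CKM by (auto simp: subset_iff)
    then show ?thesis using x by simp
  qed
  moreover have "cross_M j \<subseteq> Y \<union> (\<Union>P\<in>(\<lambda>x. x <# (C <#> K)) ` ball_M j. P)"
  proof
    fix u assume "u \<in> cross_M j"
    then obtain x k where xk: "x \<in> ball_M j" "k \<in> K" "u = x \<otimes> k" by (auto simp: cross_M_def)
    then have "u = x \<otimes> (\<one> \<otimes> k)" by simp
    moreover have "\<one> \<otimes> k \<in> C <#> K" using xk subgroup.one_closed[OF C] unfolding set_mult_def by blast
    ultimately have "u \<in> x <# (C <#> K)" unfolding l_coset_iff by blast
    then show "u \<in> Y \<union> (\<Union>P\<in>(\<lambda>x. x <# (C <#> K)) ` ball_M j. P)" using xk by auto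
  qed
  ultimately show "\<exists>Y. asd Y n \<and> cross_M j \<subseteq> Y \<union> (\<Union>P\<in>(\<lambda>x. x <# (C <#> K)) ` ball_M j. P) \<and>
      (\<forall>i\<in>(\<lambda>x. x <# (C <#> K)) ` ball_M j. \<forall>j\<in>(\<lambda>x. x <# (C <#> K)) ` ball_M j.
        \<forall>x\<in>i - Y. \<forall>y\<in>j - Y. d x y \<le> r \<longrightarrow> i = j)"
    using asd_nbhd[OF assms(2), of r] unfolding Y_def[symmetric] by (intro exI[of _ Y]) blast
qed

lemma entry_cross:
  assumes "wf \<sigma>" "x \<in> entry \<sigma>" "length \<sigma> = Suc j"
  shows "x \<in> cross_M j"
proof -
  obtain Y s \<sigma>' y where y: "\<sigma> = (Y, s) # \<sigma>'" "y \<in> piece \<sigma>'" "s \<in> K" "wf \<sigma>'" "x = y \<otimes> s"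
    using entryE[OF assms(1,2)] by metis
  then have "y \<in> ball_M j" using wf_stk[OF y(4,2)] assms(3) by (simp add: ball_M_def depth_def)
  then show ?thesis using y by (auto simp: cross_M_def)
qed

text \<open>The union theorem for the cosets of \<open>A\<close> attached to the intermediate layer.
  The subtree above such a coset of depth \<open>Suc j\<close> can be left only through its entry
  coset, which is contained in \<open>cross_M j\<close>.\<close>

lemma asd_ball_Suc:
  assumes "asd A n" "asd (cross_M j) n"
  shows "asd (ball_M (Suc j)) n"
proof (rule asd_union[where I = "(\<lambda>x. x <# A) ` cross_M j" and P = "\<lambda>P. P"])
  have cM: "cross_M j \<subseteq> M" using M_closed(1) by (auto simp: cross_M_def ball_M_def)
  show "\<exists>B. \<forall>P\<in>(\<lambda>x. x <# A) ` cross_M j. colourable n r B P" for r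
    by (rule uniform_translate[OF assms(1) _ AM]) (use cM in auto)
  fix r
  define Y where "Y = {x. \<exists>z\<in>cross_M j. d x z \<le> r}"
  have cY: "cross_M j \<subseteq> Y" by (metis (mono_tags, lifting) Y_def d_refl le0 mem_Collect_eq subsetI)
  have lM: "x <# A \<subseteq> M" if "x \<in> cross_M j" for x
    using subsetD[OF cM that] M_closed(1) by (auto simp: l_coset_iff)
  have stk_cos: "stk u = stk x" if "x \<in> cross_M j" "u \<in> x <# A" for u x
    using that cM by (auto simp: l_coset_iff stk_A)
  have dep: "depth x \<le> Suc j" if x: "x \<in> cross_M j" for x
  proof -
    obtain y k where "y \<in> ball_M j" "k \<in> K" "x = y \<otimes> k" using x by (auto simp: cross_M_def)
    then show ?thesis using upd_length[of "stk y" y k] by (auto simp: stk_K depth_def ball_M_def)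
  qed
  have "P = P'" if P: "P \<in> (\<lambda>x. x <# A) ` cross_M j" "P' \<in> (\<lambda>x. x <# A) ` cross_M j"
    and uw: "u \<in> P - Y" "w \<in> P' - Y" "d u w \<le> r" for P P' u w
  proof -
    obtain x x' where x: "x \<in> cross_M j" "P = x <# A" "x' \<in> cross_M j" "P' = x' <# A"
      using P by auto
    have M: "u \<in> M" "w \<in> M" using x uw lM by auto
    have "u \<notin> ball_M j" using uw cY ball_sub by auto
    then have len: "length (stk u) = Suc j"
      using dep[OF x(1)] stk_cos[OF x(1), of u] x(2) uw M by (auto simp: ball_M_def depth_def)
    have "above (stk u) w"
    proof (rule ccontr)
      assume "\<not> above (stk u) w"
      then obtain z where z: "z \<in> entry (stk u)" "d u z \<le> d u w"
        using exit_above[of u w "stk u"] M by (auto simp: above_def)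
      then have "z \<in> cross_M j" "d u z \<le> r" using entry_cross[OF _ _ len] good[OF M(1)] uw(3) by auto
      then have "u \<in> Y" by (auto simp: Y_def)
      then show False using uw by simp
    qed
    then have "stk w = stk u"
      using len dep[OF x(3)] stk_cos[OF x(3), of w] x(4) uw by (auto simp: above_def depth_def)
    then have "w \<in> piece (stk u)" "u \<in> piece (stk u)" using good M by metis+
    moreover obtain g where "g \<in> M" "piece (stk u) = g <# A" using wf_coset good M by metis
    ultimately have "u <# A = g <# A" "w <# A = g <# A"
      using l_repr_independence[OF _ _ A] M_car by metis+
    moreover have "u <# A = P" "w <# A = P'"
      using l_repr_independence[OF _ _ A] x uw cM M_car by (metis Diff_iff subsetD)+
    ultimately show ?thesis by simp
  qed
  moreover have "ball_M (Suc j) \<subseteq> Y \<union> (\<Union>P\<in>(\<lambda>x. x <# A) ` cross_M j. P)"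
  proof
    fix u assume u: "u \<in> ball_M (Suc j)"
    show "u \<in> Y \<union> (\<Union>P\<in>(\<lambda>x. x <# A) ` cross_M j. P)"
    proof (cases "u \<in> ball_M j")
      case True
      then show ?thesis using ball_sub cY by auto
    next
      case False
      then have len: "length (stk u) = Suc j" "u \<in> M" using u by (auto simp: ball_M_def depth_def)
      obtain g where g: "piece (stk u) = g <# A" "stk u \<noteq> [] \<Longrightarrow> g \<in> entry (stk u)"
        using wf_coset good len by metis
      moreover have "stk u \<noteq> []" using len by auto
      ultimately have "g \<in> cross_M j" "u \<in> g <# A" using entry_cross good len by blast+
      then show ?thesis by auto
    qed
  qed
  ultimately show "\<exists>Y. asd Y n \<and> ball_M (Suc j) \<subseteq> Y \<union> (\<Union>P\<in>(\<lambda>x. x <# A) ` cross_M j. P) \<and>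
      (\<forall>i\<in>(\<lambda>x. x <# A) ` cross_M j. \<forall>j\<in>(\<lambda>x. x <# A) ` cross_M j.
        \<forall>x\<in>i - Y. \<forall>y\<in>j - Y. d x y \<le> r \<longrightarrow> i = j)"
    using asd_nbhd[OF assms(2), of r] unfolding Y_def[symmetric] by (intro exI[of _ Y]) blast
qed

lemma asd_ball:
  assumes "asd A n" "asd (C <#> K) n"
  shows "asd (ball_M j) n"
proof (induction j)
  case 0
  have "ball_M 0 \<subseteq> A" using good by (force simp: ball_M_def depth_def)
  then show ?case using asd_mono assms(1) by blast
next
  case (Suc j)
  then show ?case using asd_ball_Suc asd_cross assms by blast
qed

section \<open>Cutting the tree into regions\<close>

definition dist_to where "dist_to x T = Inf (d x ` T)"

lemma dist_to_attained: "T \<noteq> {} \<Longrightarrow> \<exists>z\<in>T. d x z = dist_to x T"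
  using Inf_nat_def1[of "d x ` T"] unfolding dist_to_def by force

lemma dist_to_le: "z \<in> T \<Longrightarrow> dist_to x T \<le> d x z"
  unfolding dist_to_def by (simp add: wellorder_Inf_le1)

lemma dist_to_lip: "T \<noteq> {} \<Longrightarrow> dist_to x T \<le> d x y + dist_to y T"
proof -
  assume "T \<noteq> {}"
  then obtain z where "z \<in> T" "d y z = dist_to y T" using dist_to_attained by blast
  then show ?thesis using dist_to_le[of z T x] d_tri[of x z y] by simp
qed

lemma entry_nonempty: "wf \<sigma> \<Longrightarrow> \<sigma> \<noteq> [] \<Longrightarrow> entry \<sigma> \<noteq> {}"
  using wf_coset by (metis empty_iff)

lemma depth_dist:
  assumes "x \<in> M" "wf \<sigma>" "\<sigma> \<noteq> []"
  shows "depth x \<le> length \<sigma> + dist_to x (entry \<sigma>)"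
proof -
  obtain z where z: "z \<in> entry \<sigma>" "d x z = dist_to x (entry \<sigma>)"
    using dist_to_attained entry_nonempty assms(2,3) by metis
  then show ?thesis
    using depth_lip[of x z] entry_depth[OF assms(2) z(1)] assms(1) by (simp add: depth_def)
qed

definition bot where "bot m \<sigma> = drop (length \<sigma> - m) \<sigma>"

lemma bot_append: "bot (length \<sigma>) (\<tau> @ \<sigma>) = \<sigma>"
  by (simp add: bot_def)

lemma above_bot: "above (bot m (stk x)) x"
  unfolding above_def bot_def by (metis append_take_drop_id)

lemma length_bot: "m \<le> length \<sigma> \<Longrightarrow> length (bot m \<sigma>) = m"
  by (simp add: bot_def)

lemma above_bot_eq: "above \<sigma> x \<Longrightarrow> bot (length \<sigma>) (stk x) = \<sigma> \<and> length \<sigma> \<le> depth x"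
  by (auto simp: above_def bot_append depth_def)

lemma above_wf: "x \<in> M \<Longrightarrow> above \<sigma> x \<Longrightarrow> wf \<sigma>"
  using good wf_suffix by (metis above_def)

lemma above_prefix: "above \<sigma> x \<Longrightarrow> above \<tau> x \<Longrightarrow> length \<sigma> \<le> length \<tau> \<Longrightarrow> bot (length \<sigma>) \<tau> = \<sigma>"
  by (auto simp: above_def bot_def append_eq_append_conv2)

text \<open>A subtree, up to a given height above its root coset, lies in a translate of the ball of
  that radius. This is why all regions can be coloured uniformly.\<close>

lemma ball_translate:
  assumes "wf \<sigma>" "piece \<sigma> = g <# A" "g \<in> M"
  shows "x \<in> M \<Longrightarrow> stk x = \<tau> @ \<sigma> \<Longrightarrow> \<exists>h\<in>ball_M (length \<tau>). x = g \<otimes> h"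
proof (induction \<tau> arbitrary: x)
  case Nil
  then obtain a where a: "a \<in> A" "x = g \<otimes> a"
    using good[OF Nil(1)] assms(2) by (auto simp: l_coset_iff)
  then have "stk a = []" using stk_A[of \<one> a] M_closed(3) by (simp add: stk_one)
  then show ?case using a by (intro bexI[of _ a]) (auto simp: ball_M_def depth_def)
next
  case (Cons q \<tau>)
  obtain Y s where q: "q = (Y, s)" by fastforce
  have wf: "wf ((Y, s) # \<tau> @ \<sigma>)" "x \<in> piece ((Y, s) # \<tau> @ \<sigma>)" using good[OF Cons.prems(1)] Cons.prems(2) q by auto
  obtain y where y: "y \<in> piece (\<tau> @ \<sigma>)" "s \<in> K" "wf (\<tau> @ \<sigma>)"
      "piece ((Y, s) # \<tau> @ \<sigma>) = (y \<otimes> s) <# A"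
    using wf_topE[OF wf(1)] by metis
  then obtain a where a: "a \<in> A" "x = y \<otimes> s \<otimes> a" using wf(2) by (auto simp del: piece.simps simp: l_coset_iff)
  obtain h where h: "h \<in> ball_M (length \<tau>)" "y = g \<otimes> h" using Cons.IH[of y] wf_stk[OF y(3,1)] by auto
  have hM: "h \<in> M" using h by (simp add: ball_M_def)
  have "stk (h \<otimes> s \<otimes> a) = upd h (stk h) s" using hM y a M_closed(1) by (simp add: stk_A stk_K)
  then have "h \<otimes> s \<otimes> a \<in> ball_M (length (q # \<tau>))"
    using upd_length[of "stk h" h s] h hM y a M_closed(1) by (simp add: ball_M_def depth_def)
  moreover have "x = g \<otimes> (h \<otimes> s \<otimes> a)" using a h y hM assms(3) by (simp add: m_assoc)
  ultimately show ?case by blast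
qed

text \<open>On \<open>g <# C\<close> the map \<open>p\<close> preserves distances, by
  \<open>p (g \<otimes> a) = p g \<otimes> a\<close> and left invariance. Moving \<open>x\<close>
  and \<open>y\<close> to that coset costs \<open>2 * \<rho>\<close>, and moving their images costs
  the same again.\<close>

lemma p_near:
  assumes "x \<in> M" "y \<in> M" "g \<in> M" "dist_to x (g <# C) \<le> \<rho>" "dist_to y (g <# C) \<le> \<rho>"
  shows "d x y \<le> d (p x) (p y) + 4 * \<rho>"
proof -
  have ne: "g <# C \<noteq> {}" using l_coset_self[OF C M_car[OF assms(3)]] by auto
  obtain z w where z: "z \<in> g <# C" "d x z \<le> \<rho>" "w \<in> g <# C" "d y w \<le> \<rho>"
    using dist_to_attained[OF ne, of x] dist_to_attained[OF ne, of y] assms(4,5) by auto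
  then obtain a b where ab: "a \<in> C" "z = g \<otimes> a" "b \<in> C" "w = g \<otimes> b" by (auto simp: l_coset_iff)
  have zM: "z \<in> M" "w \<in> M" using ab assms(3) M_closed(1) by auto
  have "d z w = d a b" using ab assms(3) by (simp add: d_mult)
  also have "\<dots> = d (p z) (p w)" using ab assms(3) p_C by (simp add: d_mult p_mult)
  finally have "d z w = d (p z) (p w)" .
  moreover have "d (p z) (p w) \<le> d (p x) (p z) + d (p x) (p y) + d (p y) (p w)"
    using d_tri[of "p z" "p w" "p x"] d_tri[of "p x" "p w" "p y"] d_sym[of "p z" "p x"] by linarith
  moreover have "d (p x) (p z) \<le> \<rho>" "d (p y) (p w) \<le> \<rho>"
    using p_lip[of x z] p_lip[of y w] z zM assms(1,2) by auto
  ultimately show ?thesis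
    using z d_tri[of x y z] d_tri[of z y w] d_sym[of w y] by linarith
qed

text \<open>The tree is cut at the levels divisible by \<open>L\<close>; the cut is moved by \<open>r\<close> away from the
  entry coset, so that points beyond different entries on the same level are not
  \<open>r\<close>-close.\<close>

lemma asd_amalgam:
  assumes "asd A n" "asd (C <#> K) n" "asd C m" "m < n"
  shows "asd M n"
  unfolding asd_def
proof
  fix r
  define \<rho> where "\<rho> = 2 * r + Suc n * Suc r + r"
  \<comment> \<open>Levels more than \<open>\<rho>\<close> apart keep the points next to an entry on
    the following level outside the entry zone of their own region.\<close>
  define L where "L = Suc \<rho>"
  have L: "L > 0" "r < L" "\<rho> < L" by (auto simp: L_def \<rho>_def)
  define J where "J x = depth x div L" for x
  define e where "e x = (if J x = 0 then [] else
     if dist_to x (entry (bot (J x * L) (stk x))) \<le> r then bot ((J x - 1) * L) (stk x)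
     else bot (J x * L) (stk x))" for x
  \<comment> \<open>The root region has no entry; the value \<open>Suc \<rho>\<close> keeps its
    points out of every entry zone.\<close>
  define f where "f x = (if e x = [] then Suc \<rho> else dist_to x (entry (e x)))" for x
  have JL: "J x * L \<le> depth x" "depth x < J x * L + L" for x
    using L(1) dividend_less_div_times[of L "depth x"] by (auto simp: J_def)
  have e_cases: "(e x = bot (J x * L) (stk x) \<and> length (e x) = J x * L \<and>
       (J x \<noteq> 0 \<longrightarrow> r < dist_to x (entry (e x)))) \<or>
      (J x \<noteq> 0 \<and> e x = bot ((J x - 1) * L) (stk x) \<and> length (e x) = (J x - 1) * L \<and>
       dist_to x (entry (bot (J x * L) (stk x))) \<le> r)" for x
  proof (cases "J x = 0")
    case True
    then show ?thesis by (simp add: e_def bot_def)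
  next
    case False
    have "(J x - 1) * L \<le> J x * L" by simp
    then have "length (bot ((J x - 1) * L) (stk x)) = (J x - 1) * L" "length (bot (J x * L) (stk x)) = J x * L"
      using JL(1)[of x] length_bot[of _ "stk x"] unfolding depth_def by (meson order_trans)+
    then show ?thesis using False by (auto simp: e_def)
  qed
  have pred: "(J x - 1) * L + L = J x * L" if "J x \<noteq> 0" for x
    using that by (cases "J x") auto
  have e_above: "above (e x) x" for x using e_cases[of x] above_bot by metis
  have e_wf: "wf (e x)" if "x \<in> M" for x using above_wf[OF that e_above] .
  have e_len: "\<exists>j. length (e x) = j * L" for x using e_cases[of x] by blast
  have e_depth: "depth x < length (e x) + 2 * L" for x
    using e_cases[of x] JL(2)[of x] pred[of x] by auto
  \<comment> \<open>For a shifted label the entry lies at least \<open>L\<close> levels below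
    \<open>x\<close>, and \<open>depth\<close> is 1-Lipschitz, so its distance exceeds
    \<open>r\<close> as well.\<close>
  have e_far: "r < dist_to x (entry (e x))" if "x \<in> M" "e x \<noteq> []" for x
    using e_cases[of x]
  proof (elim disjE conjE)
    assume *: "length (e x) = J x * L" "J x \<noteq> 0 \<longrightarrow> r < dist_to x (entry (e x))"
    have "length (e x) \<noteq> 0" using that by simp
    then have "J x \<noteq> 0" using *(1) by (metis mult_0)
    then show ?thesis using * by simp
  next
    assume "length (e x) = (J x - 1) * L" "J x \<noteq> 0"
    then show ?thesis
      using depth_dist[OF that(1) e_wf[OF that(1)] that(2)] pred[of x] JL(1)[of x] L(2) by linarith
  qed
  \<comment> \<open>A cut level that lies below \<open>x\<close> but beyond its label can only be
    the one skipped by the shift.\<close>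
  have e_next: "length \<mu> = length (e x) + L \<and> dist_to x (entry \<mu>) \<le> r"
    if "above \<mu> x" "length \<mu> = j * L" "length (e x) < length \<mu>" for x \<mu> j
  proof -
    have "length \<mu> \<le> depth x" using above_bot_eq[OF that(1)] by simp
    then have "j \<le> J x" unfolding J_def that(2)
      using L(1) by (metis div_le_mono nonzero_mult_div_cancel_right less_numeral_extra(3))
    then have jL: "j * L \<le> J x * L" by simp
    from e_cases[of x] show ?thesis
    proof (elim disjE conjE)
      assume "length (e x) = J x * L"
      then show ?thesis using that jL by simp
    next
      assume *: "length (e x) = (J x - 1) * L" "dist_to x (entry (bot (J x * L) (stk x))) \<le> r" "J x \<noteq> 0"
      then have "(J x - 1) * L < j * L" using that by simp
      then have "J x - 1 < j" by simp
      then have "j = J x" using \<open>j \<le> J x\<close> by simp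
      then show ?thesis using * pred[of x] that(2) above_bot_eq[OF that(1)] by simp
    qed
  qed
  \<comment> \<open>Applied to \<open>y\<close> and the crossing \<open>e x\<close>,
    \<open>e_next\<close> puts \<open>y\<close> within \<open>r\<close> of that entry, hence
    \<open>x\<close> within \<open>2 * r\<close>. At the same time \<open>y\<close> lies at least
    \<open>L\<close> levels above its own entry.\<close>
  have cross: "f x \<le> 2 * r \<and> \<rho> < f y \<and> bot (length (e x) - L) (e x) = e y"
    if M: "x \<in> M" "y \<in> M" and dxy: "d x y \<le> r" and ab: "above (e x) y" "above (e y) x"
      and len: "length (e y) < length (e x)" for x y
  proof -
    obtain j where "length (e x) = j * L" using e_len by blast
    note nx = e_next[OF ab(1) this len]
    have ne: "e x \<noteq> []" using len by auto
    have "f x \<le> 2 * r"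
      using nx dist_to_lip[OF entry_nonempty[OF e_wf[OF M(1)] ne], of x y] dxy ne by (simp add: f_def)
    moreover have "\<rho> < f y"
    proof (cases "e y = []")
      case False
      have "length (e x) \<le> depth y" using above_bot_eq[OF ab(1)] by simp
      then show ?thesis
        using depth_dist[OF M(2) e_wf[OF M(2)] False] nx L(3) False by (simp add: f_def)
    qed (simp add: f_def)
    moreover have "bot (length (e x) - L) (e x) = e y"
      using above_prefix[OF ab(2) e_above] nx by simp
    ultimately show ?thesis by blast
  qed
  have stay: "above (e x) y" if xy: "x \<in> M" "y \<in> M" "d x y \<le> r" for x y
  proof (rule ccontr)
    assume na: "\<not> above (e x) y"
    then obtain z where "z \<in> entry (e x)" "d x z \<le> d x y"
      using exit_above[OF xy(1,2) e_above] by blast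
    moreover have "e x \<noteq> []" using na by (auto simp: above_def)
    ultimately show False using e_far[OF xy(1)] dist_to_le[of z "entry (e x)" x] xy(3) by fastforce
  qed
  show "\<exists>B. colourable n r B M"
  proof (rule colourable_barrier[OF assms(3,4), of M p \<rho> r e f "\<lambda>\<sigma>. bot (length \<sigma> - L) \<sigma>"])
    show "f x \<le> f y + r" if "x \<in> M" "y \<in> M" "d x y \<le> r" "e x = e y" for x y
      using that dist_to_lip[OF entry_nonempty[OF e_wf[OF that(1)]], of x y] by (auto simp: f_def)
    show "(f x \<le> 2 * r \<and> \<rho> < f y \<and> bot (length (e x) - L) (e x) = e y) \<or>
       (f y \<le> 2 * r \<and> \<rho> < f x \<and> bot (length (e y) - L) (e y) = e x)"
      if "x \<in> M" "y \<in> M" "d x y \<le> r" "e x \<noteq> e y" for x y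
    proof -
      have yx: "d y x \<le> r" using that d_sym[of x y] by simp
      have ab: "above (e x) y" "above (e y) x" using stay that yx by auto
      \<comment> \<open>Both labels are suffixes of the stack of \<open>x\<close>, so distinct
        labels differ in length.\<close>
      have "length (e x) \<noteq> length (e y)"
        using above_bot_eq[OF e_above[of x]] above_bot_eq[OF ab(2)] that(4) by metis
      then show ?thesis
        using cross[OF that(1,2,3) ab] cross[OF that(2,1) yx ab(2,1)] by linarith
    qed
    show "\<exists>B. \<forall>i. colourable n s B {x \<in> M. e x = i}" for s
    proof -
      have "\<exists>g\<in>M. P \<subseteq> g <# ball_M (2 * L)" if P: "P \<in> range (\<lambda>i. {x \<in> M. e x = i})" for P
      proof (cases "P = {}")
        case False
        then obtain x0 where x0: "x0 \<in> M" "P = {x \<in> M. e x = e x0}" using P by auto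
        obtain g where g: "g \<in> M" "piece (e x0) = g <# A" using wf_coset[OF e_wf[OF x0(1)]] by metis
        have "x \<in> g <# ball_M (2 * L)" if x: "x \<in> M" "e x = e x0" for x
        proof -
          obtain \<tau> where \<tau>: "stk x = \<tau> @ e x0" using e_above[of x] x by (auto simp: above_def)
          have "length \<tau> \<le> 2 * L" using e_depth[of x] \<tau> x by (simp add: depth_def)
          then have "ball_M (length \<tau>) \<subseteq> ball_M (2 * L)" by (auto simp: ball_M_def)
          then show ?thesis
            using ball_translate[OF e_wf[OF x0(1)] g(2,1) x(1) \<tau>] unfolding l_coset_iff by blast
        qed
        then show ?thesis using g x0 by blast
      qed (use M_closed(3) in auto)
      then show ?thesis
        using uniform_translate[OF asd_ball[OF assms(1,2)], of "range (\<lambda>i. {x \<in> M. e x = i})"]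
        by (auto simp: ball_M_def)
    qed
    show "\<exists>b'. \<forall>x\<in>M. \<forall>y\<in>M. e x = e y \<longrightarrow> f x \<le> \<rho> \<longrightarrow> f y \<le> \<rho> \<longrightarrow> d (p x) (p y) \<le> b \<longrightarrow> d x y \<le> b'" for b
    proof (intro exI ballI impI)
      fix x y assume xy: "x \<in> M" "y \<in> M" "e x = e y" "f x \<le> \<rho>" "f y \<le> \<rho>" "d (p x) (p y) \<le> b"
      have ne: "e x \<noteq> []" using xy(4) by (auto simp: f_def)
      then obtain g where g: "g \<in> M" "entry (e x) = g <# C" using wf_coset[OF e_wf[OF xy(1)]] by metis
      show "d x y \<le> b + 4 * \<rho>"
        using p_near[OF xy(1,2) g(1), of \<rho>] xy ne g(2) by (auto simp: f_def)
    qed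
  qed (use p_C p_lip \<rho>_def in auto)
qed

end

section \<open>Graph products\<close>

locale gprod =
  fixes V :: "'v set" and E :: "'v \<Rightarrow> 'v \<Rightarrow> bool" and G :: "'v \<Rightarrow> ('g, 'b) monoid_scheme"
  assumes simplicial: "simplicial_graph V E" and vertex_group: "\<And>v. v \<in> V \<Longrightarrow> group (G v)"
begin

abbreviation "H \<equiv> graph_product V E G"
abbreviation "cl \<equiv> gp_class V E G"
abbreviation "eqv \<equiv> gp_eqv V E G"
abbreviation "word \<equiv> gp_word V G"

definition letter where "letter v g = cl [(v, g)]"

lemma edge: "E u w \<Longrightarrow> u \<in> V \<and> w \<in> V \<and> E w u \<and> u \<noteq> w"
  using simplicial unfolding simplicial_graph_def by metis

lemma gp_word_simps [simp]:
  "gp_word U G []" "gp_word U G (l # xs) \<longleftrightarrow> fst l \<in> U \<and> snd l \<in> carrier (G (fst l)) \<and> gp_word U G xs"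
  "gp_word U G (xs @ ys) \<longleftrightarrow> gp_word U G xs \<and> gp_word U G ys"
  by (auto simp: gp_word_def split: prod.splits)

lemma gp_word_mono: "gp_word U G xs \<Longrightarrow> U \<subseteq> U' \<Longrightarrow> gp_word U' G xs"
  by (auto simp: gp_word_def split: prod.splits)

lemma gp_word_vertices: "word xs \<Longrightarrow> fst ` set xs \<subseteq> U \<Longrightarrow> gp_word U G xs"
  by (induction xs) auto

lemma basic_word: "gp_basic V E G l r \<Longrightarrow> word l \<and> word r"
  by (erule gp_basic.cases)
    (auto simp: monoid.one_closed monoid.m_closed group.is_monoid vertex_group edge)

lemma step_word: "gp_step V E G xs ys \<Longrightarrow> word xs \<longleftrightarrow> word ys"
  unfolding gp_step_def using basic_word by fastforce

lemma eqv_refl: "eqv xs xs"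
  by (simp add: gp_eqv_def)

lemma eqv_sym: "eqv xs ys \<Longrightarrow> eqv ys xs"
  unfolding gp_eqv_def by (rule equivclp_sym)

lemma eqv_trans [trans]: "eqv xs ys \<Longrightarrow> eqv ys zs \<Longrightarrow> eqv xs zs"
  unfolding gp_eqv_def by (rule equivclp_trans)

lemma eqv_induct:
  assumes "eqv xs ys" "\<And>xs ys. gp_step V E G xs ys \<Longrightarrow> R xs ys"
    "\<And>xs. R xs xs" "\<And>xs ys. R xs ys \<Longrightarrow> R ys xs" "\<And>xs ys zs. R xs ys \<Longrightarrow> R ys zs \<Longrightarrow> R xs zs"
  shows "R xs ys"
  using assms(1) unfolding gp_eqv_def
proof (induction rule: equivclp_induct)
  case (step y z)
  then show ?case using assms(2,4,5) by blast
qed (rule assms(3))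

lemma basic_eqv: "gp_basic V E G l r \<Longrightarrow> eqv (a @ l @ b) (a @ r @ b)"
  unfolding gp_eqv_def by (rule r_into_equivclp) (auto simp: gp_step_def)

lemma eqv_context: "eqv xs ys \<Longrightarrow> eqv (a @ xs @ b) (a @ ys @ b)"
proof (erule eqv_induct)
  fix xs ys assume "gp_step V E G xs ys"
  then obtain a' b' l r where *: "gp_basic V E G l r" "xs = a' @ l @ b'" "ys = a' @ r @ b'"
    by (auto simp: gp_step_def)
  show "eqv (a @ xs @ b) (a @ ys @ b)"
    using basic_eqv[OF *(1), of "a @ a'" "b' @ b"] * by simp
qed (auto intro: eqv_refl eqv_sym eqv_trans)

lemma eqv_append: "eqv xs xs' \<Longrightarrow> eqv ys ys' \<Longrightarrow> eqv (xs @ ys) (xs' @ ys')"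
  using eqv_context[of xs xs' "[]" ys] eqv_context[of ys ys' xs' "[]"] eqv_trans by simp

lemma cl_eqI: "eqv xs ys \<Longrightarrow> cl xs = cl ys"
  unfolding gp_class_def by (auto intro: eqv_trans eqv_sym)

lemma cl_self: "word xs \<Longrightarrow> xs \<in> cl xs"
  by (simp add: gp_class_def eqv_refl)

lemma cl_eqD: "word xs \<Longrightarrow> cl xs = cl ys \<Longrightarrow> eqv xs ys"
  using cl_self by (auto simp: gp_class_def intro: eqv_sym)

lemma carrier_H: "carrier H = {cl xs | xs. word xs}"
  by (simp add: graph_product_def)

lemma cl_carrier [simp]: "word xs \<Longrightarrow> cl xs \<in> carrier H"
  by (auto simp: carrier_H)

lemma one_H: "\<one>\<^bsub>H\<^esub> = cl []"
  by (simp add: graph_product_def)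

lemma mult_cl: "word xs \<Longrightarrow> word ys \<Longrightarrow> cl xs \<otimes>\<^bsub>H\<^esub> cl ys = cl (xs @ ys)"
proof -
  assume w: "word xs" "word ys"
  have "eqv xs (SOME zs. zs \<in> cl xs)" "eqv ys (SOME zs. zs \<in> cl ys)"
    using someI[of "\<lambda>zs. zs \<in> cl xs", OF cl_self[OF w(1)]]
      someI[of "\<lambda>zs. zs \<in> cl ys", OF cl_self[OF w(2)]] by (auto simp: gp_class_def)
  then have "cl ((SOME zs. zs \<in> cl xs) @ (SOME zs. zs \<in> cl ys)) = cl (xs @ ys)"
    by (intro cl_eqI eqv_append) (auto intro: eqv_sym)
  then show ?thesis by (simp add: graph_product_def)
qed

definition inverse_word where "inverse_word xs = rev (map (\<lambda>(v, g). (v, inv\<^bsub>G v\<^esub> g)) xs)"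

lemma inverse_word: "gp_word U G xs \<Longrightarrow> U \<subseteq> V \<Longrightarrow> gp_word U G (inverse_word xs) \<and> eqv (inverse_word xs @ xs) []"
proof (induction xs)
  case (Cons l xs)
  obtain v g where l: "l = (v, g)" by fastforce
  have v: "v \<in> V" "g \<in> carrier (G v)" "v \<in> U" using Cons.prems l by auto
  interpret Gv: group "G v" using vertex_group v by blast
  have eq: "inverse_word (l # xs) = inverse_word xs @ [(v, inv\<^bsub>G v\<^esub> g)]"
    by (simp add: inverse_word_def l)
  have "eqv (inverse_word xs @ [(v, inv\<^bsub>G v\<^esub> g), (v, g)] @ xs) (inverse_word xs @ [(v, \<one>\<^bsub>G v\<^esub>)] @ xs)"
    using basic_eqv[OF gp_basic.mult[of v V "inv\<^bsub>G v\<^esub> g" G g E]] v by simp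
  also have "eqv (inverse_word xs @ [(v, \<one>\<^bsub>G v\<^esub>)] @ xs) (inverse_word xs @ [] @ xs)"
    by (rule basic_eqv[OF gp_basic.unit[OF v(1)]])
  also have "eqv (inverse_word xs @ [] @ xs) []" using Cons by simp
  finally show ?case using Cons v eq l by simp
qed (simp add: inverse_word_def eqv_refl)

sublocale H: group H
proof (rule groupI)
  fix x y z assume "x \<in> carrier H" "y \<in> carrier H" "z \<in> carrier H"
  then obtain a b c where "x = cl a" "word a" "y = cl b" "word b" "z = cl c" "word c"
    by (auto simp: carrier_H)
  then show "x \<otimes>\<^bsub>H\<^esub> y \<otimes>\<^bsub>H\<^esub> z = x \<otimes>\<^bsub>H\<^esub> (y \<otimes>\<^bsub>H\<^esub> z)" by (simp add: mult_cl)
next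
  fix x assume "x \<in> carrier H"
  then obtain a where "x = cl a" "word a" by (auto simp: carrier_H)
  moreover have "cl (inverse_word a @ a) = cl []"
    using inverse_word[OF \<open>word a\<close>] cl_eqI by blast
  ultimately show "\<exists>y\<in>carrier H. y \<otimes>\<^bsub>H\<^esub> x = \<one>\<^bsub>H\<^esub>"
    using inverse_word[OF \<open>word a\<close>] by (intro bexI[of _ "cl (inverse_word a)"]) (auto simp: mult_cl one_H)
qed (auto simp: carrier_H mult_cl one_H)

abbreviation mult_H (infixl "\<star>" 70) where "x \<star> y \<equiv> x \<otimes>\<^bsub>H\<^esub> y"

lemma letter_carrier [simp]: "v \<in> V \<Longrightarrow> g \<in> carrier (G v) \<Longrightarrow> letter v g \<in> carrier H"
  by (simp add: letter_def)

lemma cl_snoc: "word xs \<Longrightarrow> v \<in> V \<Longrightarrow> g \<in> carrier (G v) \<Longrightarrow> cl (xs @ [(v, g)]) = cl xs \<star> letter v g"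
  by (simp add: letter_def mult_cl)

lemma letter_one: "v \<in> V \<Longrightarrow> letter v \<one>\<^bsub>G v\<^esub> = \<one>\<^bsub>H\<^esub>"
  unfolding letter_def one_H using basic_eqv[OF gp_basic.unit, of v "[]" "[]"] by (simp add: cl_eqI)

lemma letter_mult:
  "v \<in> V \<Longrightarrow> g \<in> carrier (G v) \<Longrightarrow> h \<in> carrier (G v) \<Longrightarrow> letter v g \<star> letter v h = letter v (g \<otimes>\<^bsub>G v\<^esub> h)"
  using basic_eqv[OF gp_basic.mult[of v V g G h E], of "[]" "[]"]
  by (simp add: letter_def mult_cl cl_eqI)

lemma letter_comm:
  "E v w \<Longrightarrow> g \<in> carrier (G v) \<Longrightarrow> h \<in> carrier (G w) \<Longrightarrow> letter v g \<star> letter w h = letter w h \<star> letter v g"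
  using basic_eqv[OF gp_basic.comm[of E v w g G h V], of "[]" "[]"] edge[of v w]
  by (simp add: letter_def mult_cl cl_eqI)

lemma letter_inv:
  assumes "v \<in> V" "g \<in> carrier (G v)"
  shows "inv\<^bsub>H\<^esub> (letter v g) = letter v (inv\<^bsub>G v\<^esub> g)"
proof -
  interpret Gv: group "G v" using vertex_group assms by blast
  show ?thesis using assms by (intro H.inv_equality) (auto simp: letter_mult letter_one)
qed

section \<open>Subgroups spanned by sets of vertices\<close>

definition Sub where "Sub U = {cl xs | xs. gp_word U G xs}"

lemma Sub_mono: "U \<subseteq> U' \<Longrightarrow> Sub U \<subseteq> Sub U'"
  unfolding Sub_def using gp_word_mono by blast

lemma Sub_V: "Sub V = carrier H"
  by (simp add: Sub_def carrier_H)

lemma Sub_empty: "Sub {} = {\<one>\<^bsub>H\<^esub>}"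
proof -
  have "gp_word {} G xs \<longleftrightarrow> xs = []" for xs by (cases xs) auto
  then show ?thesis by (simp add: Sub_def one_H)
qed

lemma Sub_subgroup: "U \<subseteq> V \<Longrightarrow> subgroup (Sub U) H"
proof (rule H.subgroupI)
  assume U: "U \<subseteq> V"
  show "Sub U \<subseteq> carrier H" using Sub_mono[OF U] Sub_V by simp
  show "Sub U \<noteq> {}" unfolding Sub_def using gp_word_simps(1) by blast
  fix a b assume "a \<in> Sub U" "b \<in> Sub U"
  then obtain xs ys where xs: "a = cl xs" "gp_word U G xs" "b = cl ys" "gp_word U G ys"
    by (auto simp: Sub_def)
  then have w: "word xs" "word ys" using gp_word_mono U by auto
  then have "a \<star> b = cl (xs @ ys)" "gp_word U G (xs @ ys)" using xs by (auto simp: mult_cl)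
  then show "a \<star> b \<in> Sub U" unfolding Sub_def by blast
  have iw: "gp_word U G (inverse_word xs)" "eqv (inverse_word xs @ xs) []" using inverse_word[OF xs(2) U] by auto
  then have "cl (inverse_word xs) \<star> a = \<one>\<^bsub>H\<^esub>"
    using w xs gp_word_mono[OF iw(1) U] cl_eqI by (simp add: mult_cl one_H)
  then have "inv\<^bsub>H\<^esub> a = cl (inverse_word xs)"
    using w xs gp_word_mono[OF iw(1) U] by (intro H.inv_equality) auto
  then show "inv\<^bsub>H\<^esub> a \<in> Sub U" using iw unfolding Sub_def by blast
qed

lemma Sub_carrier: "U \<subseteq> V \<Longrightarrow> x \<in> Sub U \<Longrightarrow> x \<in> carrier H"
  using Sub_mono Sub_V by blast

lemma letter_Sub: "v \<in> U \<Longrightarrow> g \<in> carrier (G v) \<Longrightarrow> letter v g \<in> Sub U"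
  unfolding letter_def Sub_def by (auto intro!: exI[of _ "[(v, g)]"])

lemma Sub_induct [consumes 2, case_names one letter]:
  assumes "x \<in> Sub U" "U \<subseteq> V" "P \<one>\<^bsub>H\<^esub>"
    "\<And>x v g. x \<in> Sub U \<Longrightarrow> P x \<Longrightarrow> v \<in> U \<Longrightarrow> g \<in> carrier (G v) \<Longrightarrow> P (x \<star> letter v g)"
  shows "P x"
proof -
  obtain xs where "x = cl xs" "gp_word U G xs" using assms(1) by (auto simp: Sub_def)
  moreover have "gp_word U G xs \<Longrightarrow> P (cl xs)" for xs
  proof (induction xs rule: rev_induct)
    case (snoc l xs)
    have "cl (xs @ [(fst l, snd l)]) = cl xs \<star> letter (fst l) (snd l)"
      by (rule cl_snoc) (use snoc.prems gp_word_mono assms(2) in auto)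
    moreover have "cl xs \<in> Sub U" using snoc.prems by (auto simp: Sub_def)
    ultimately show ?case using snoc assms(4)[of "cl xs" "fst l" "snd l"] by simp
  qed (use assms(3) one_H in simp)
  ultimately show ?thesis by simp
qed

lemma Sub_single: "v \<in> V \<Longrightarrow> x \<in> Sub {v} \<Longrightarrow> \<exists>g\<in>carrier (G v). x = letter v g"
proof -
  assume v: "v \<in> V" and x: "x \<in> Sub {v}"
  interpret Gv: group "G v" using vertex_group v by blast
  have "{v} \<subseteq> V" using v by simp
  with x show ?thesis
  proof (induction rule: Sub_induct)
    case one
    show ?case using letter_one[OF v] by (intro bexI[of _ "\<one>\<^bsub>G v\<^esub>"]) auto
  next
    case (letter x w g)
    then show ?case using letter_mult[OF v] by auto
  qed
qed

text \<open>Functions of words that are invariant under the defining relations descend to the graph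
  product by evaluation at \<open>rep\<close>.\<close>

definition rep where "rep x = (SOME xs. word xs \<and> cl xs = x)"

lemma rep: "x \<in> carrier H \<Longrightarrow> word (rep x) \<and> cl (rep x) = x"
  unfolding rep_def by (rule someI_ex) (auto simp: carrier_H)

lemma rep_invariant:
  assumes "\<And>xs ys. gp_step V E G xs ys \<Longrightarrow> word xs \<Longrightarrow> f xs = f ys" "word xs"
  shows "f (rep (cl xs)) = f xs"
proof -
  have "eqv (rep (cl xs)) xs"
    using rep[of "cl xs"] assms(2) cl_eqD by auto
  then have "word xs \<longrightarrow> f (rep (cl xs)) = f xs"
    by (rule eqv_induct[where R = "\<lambda>ys xs. (word ys \<longleftrightarrow> word xs) \<and> (word xs \<longrightarrow> f ys = f xs)", THEN conjunct2])
      (auto simp: step_word assms(1))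
  then show ?thesis using assms(2) by simp
qed

section \<open>Retractions by deleting letters\<close>

definition restr where "restr U xs = filter (\<lambda>l. fst l \<in> U) xs"

lemma restr_simps [simp]:
  "restr U [] = []" "restr U (l # xs) = (if fst l \<in> U then l # restr U xs else restr U xs)"
  "restr U (xs @ ys) = restr U xs @ restr U ys"
  by (auto simp: restr_def)

lemma restr_word: "gp_word U' G xs \<Longrightarrow> gp_word (U \<inter> U') G (restr U xs)"
  by (induction xs) auto

lemma restr_id: "gp_word U G xs \<Longrightarrow> restr U xs = xs"
  by (induction xs) auto

text \<open>Both sides of a relation lose the letters of the same vertices, so the relation either
  persists or its two sides coincide.\<close>

lemma restr_basic: "gp_basic V E G l r \<Longrightarrow> eqv (restr U l) (restr U r)"
proof (erule gp_basic.cases)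
  fix v assume "l = [(v, \<one>\<^bsub>G v\<^esub>)]" "r = []" "v \<in> V"
  then show ?thesis using basic_eqv[OF gp_basic.unit, of v "[]" "[]"] by (auto simp: eqv_refl)
next
  fix v g h assume "l = [(v, g), (v, h)]" "r = [(v, g \<otimes>\<^bsub>G v\<^esub> h)]" "v \<in> V" "g \<in> carrier (G v)" "h \<in> carrier (G v)"
  then show ?thesis using basic_eqv[OF gp_basic.mult[of v V g G h E], of "[]" "[]"] by (auto simp: eqv_refl)
next
  fix v w g h assume "l = [(v, g), (w, h)]" "r = [(w, h), (v, g)]" "E v w" "g \<in> carrier (G v)" "h \<in> carrier (G w)"
  then show ?thesis using basic_eqv[OF gp_basic.comm[of E v w g G h V], of "[]" "[]"] by (auto simp: eqv_refl)
qed

definition proj where "proj U x = cl (restr U (rep x))"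

lemma proj_cl: "word xs \<Longrightarrow> proj U (cl xs) = cl (restr U xs)"
  unfolding proj_def
proof (rule rep_invariant)
  fix xs ys assume "gp_step V E G xs ys"
  then obtain a b l r where "gp_basic V E G l r" "xs = a @ l @ b" "ys = a @ r @ b"
    by (auto simp: gp_step_def)
  then show "cl (restr U xs) = cl (restr U ys)"
    using eqv_context[OF restr_basic] by (intro cl_eqI) simp
qed

lemma proj_Sub: "x \<in> Sub U' \<Longrightarrow> U' \<subseteq> V \<Longrightarrow> proj U x \<in> Sub (U \<inter> U')"
proof -
  assume "x \<in> Sub U'" "U' \<subseteq> V"
  then obtain xs where "x = cl xs" "gp_word U' G xs" "word xs" using gp_word_mono by (auto simp: Sub_def)
  then show ?thesis using restr_word[of U' xs U] by (auto simp: proj_cl Sub_def)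
qed

lemma proj_id: "x \<in> Sub U \<Longrightarrow> U \<subseteq> V \<Longrightarrow> proj U x = x"
proof -
  assume "x \<in> Sub U" "U \<subseteq> V"
  then obtain xs where "x = cl xs" "gp_word U G xs" "word xs" using gp_word_mono by (auto simp: Sub_def)
  then show ?thesis by (simp add: proj_cl restr_id)
qed

lemma proj_mult: "x \<in> carrier H \<Longrightarrow> y \<in> carrier H \<Longrightarrow> proj U (x \<star> y) = proj U x \<star> proj U y"
proof -
  assume "x \<in> carrier H" "y \<in> carrier H"
  then obtain xs ys where *: "x = cl xs" "word xs" "y = cl ys" "word ys" by (auto simp: carrier_H)
  then have "word (restr U xs)" "word (restr U ys)"
    using restr_word[of V xs U] restr_word[of V ys U] gp_word_mono by auto
  then show ?thesis using * by (simp add: proj_cl mult_cl)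
qed

lemma proj_letter: "v \<in> V \<Longrightarrow> g \<in> carrier (G v) \<Longrightarrow> proj U (letter v g) = (if v \<in> U then letter v g else \<one>\<^bsub>H\<^esub>)"
  by (simp add: letter_def proj_cl one_H)

lemma Sub_commute:
  assumes "U \<subseteq> V" "W \<subseteq> V" "\<And>u w. u \<in> U \<Longrightarrow> w \<in> W \<Longrightarrow> E u w" "x \<in> Sub U" "y \<in> Sub W"
  shows "x \<star> y = y \<star> x"
proof -
  have one_step: "letter u g \<star> y = y \<star> letter u g" if u: "u \<in> U" "g \<in> carrier (G u)" for u g
    using assms(5,2)
  proof (induction rule: Sub_induct)
    case one
    then show ?case using u assms(1) by auto
  next
    case (letter y w h)
    have cars: "u \<in> V" "w \<in> V" "y \<in> carrier H" using u letter assms Sub_carrier by auto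
    have "letter u g \<star> (y \<star> letter w h) = y \<star> (letter u g \<star> letter w h)"
      using cars letter u by (simp add: H.m_assoc[symmetric])
    also have "\<dots> = y \<star> letter w h \<star> letter u g"
      using cars letter u letter_comm[OF assms(3)] by (simp add: H.m_assoc)
    finally show ?case .
  qed
  have y: "y \<in> carrier H" using assms Sub_carrier by blast
  from assms(4,1) show ?thesis
  proof (induction rule: Sub_induct)
    case (letter x u g)
    have cars: "u \<in> V" "x \<in> carrier H" using letter assms Sub_carrier by auto
    have l: "letter u g \<in> carrier H" using cars letter by simp
    have "x \<star> letter u g \<star> y = x \<star> (letter u g \<star> y)" using cars l y by (simp add: H.m_assoc)
    also have "\<dots> = x \<star> (y \<star> letter u g)" using one_step[of u g] letter by simp
    also have "\<dots> = x \<star> y \<star> letter u g" using cars l y by (simp add: H.m_assoc)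
    also have "\<dots> = y \<star> x \<star> letter u g" using letter by simp
    also have "\<dots> = y \<star> (x \<star> letter u g)" using cars l y by (simp add: H.m_assoc)
    finally show ?case .
  qed (use y in simp)
qed

end

section \<open>Amalgam decomposition of a graph product\<close>

locale gprod_split = gprod +
  fixes U :: "'a set" and v :: 'a
  assumes U: "U \<subseteq> V" and v: "v \<in> V" "v \<notin> U"
begin

abbreviation "link \<equiv> {w \<in> U. E v w}"
abbreviation "star \<equiv> insert v U"

lemma subsets: "link \<subseteq> V" "{v} \<subseteq> V" "star \<subseteq> V"
  using U v by auto

sublocale amalgam H "Sub U" "Sub link" "Sub {v}"
proof (intro amalgam.intro amalgam_axioms.intro H.group_axioms)
  show "Sub link \<subseteq> Sub U" by (rule Sub_mono) auto
  show "c \<star> k = k \<star> c" if "c \<in> Sub link" "k \<in> Sub {v}" for c k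
    by (rule Sub_commute[OF subsets(1,2) _ that]) (use edge in auto)
qed (use U subsets in \<open>auto intro: Sub_subgroup\<close>)

text \<open>The element is carried along with the stack because \<open>upd\<close> has to test
  whether it lies in the current entry coset.\<close>

definition run where
  "run xs = foldl (\<lambda>(x, \<sigma>) l. (x \<star> cl [l], if fst l = v then upd x \<sigma> (cl [l]) else \<sigma>)) (\<one>\<^bsub>H\<^esub>, []) xs"

lemma run_simps [simp]:
  "run [] = (\<one>\<^bsub>H\<^esub>, [])"
  "run (xs @ [l]) = (fst (run xs) \<star> cl [l], if fst l = v then upd (fst (run xs)) (snd (run xs)) (cl [l])
     else snd (run xs))"
  by (simp_all add: run_def split_beta)

lemma run_two:
  "run (xs @ [l, l']) = (let (x, \<sigma>) = run (xs @ [l]) in (x \<star> cl [l'], if fst l' = v then upd x \<sigma> (cl [l']) else \<sigma>))"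
  using run_simps(2)[of "xs @ [l]" l'] by (simp add: Let_def)

lemma run_context: "run xs = run ys \<Longrightarrow> run (xs @ b) = run (ys @ b)"
  by (simp add: run_def)

lemma run_fst: "word xs \<Longrightarrow> fst (run xs) = cl xs"
proof (induction xs rule: rev_induct)
  case (snoc l xs)
  then show ?case using cl_snoc[of xs "fst l" "snd l"] by (simp add: letter_def)
qed (simp add: one_H)

lemma run_good: "gp_word star G xs \<Longrightarrow> wf (snd (run xs)) \<and> cl xs \<in> piece (snd (run xs))"
proof (induction xs rule: rev_induct)
  case Nil
  then show ?case using subgroup.one_closed[OF A] by (simp add: one_H)
next
  case (snoc l xs)
  obtain w g where l: "l = (w, g)" by fastforce
  have w: "w \<in> star" "g \<in> carrier (G w)" "gp_word star G xs" using snoc.prems l by auto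
  then have wx: "word xs" "w \<in> V" using gp_word_mono subsets by blast+
  have IH: "wf (snd (run xs))" "cl xs \<in> piece (snd (run xs))" using snoc.IH w by auto
  have cl: "cl (xs @ [l]) = cl xs \<star> letter w g" using cl_snoc wx w l by simp
  show ?case
  proof (cases "w = v")
    case True
    then have "letter w g \<in> Sub {v}" using letter_Sub w by auto
    then show ?thesis using upd_good[OF IH] True run_fst[OF wx(1)] cl l by (simp add: letter_def)
  next
    case False
    then have "letter w g \<in> Sub U" using letter_Sub w by auto
    then show ?thesis using piece_mult_A[OF IH] IH False cl l by simp
  qed
qed

text \<open>The three kinds of relation are absorbed by \<open>upd_one\<close>,
  \<open>upd_upd\<close> and \<open>upd_mult_C\<close>; the last applies because a letter of
  \<open>star\<close> adjacent to \<open>v\<close> belongs to the link.\<close>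

lemma run_basic:
  assumes "gp_basic V E G l r" "gp_word star G a"
  shows "run (a @ restr star l) = run (a @ restr star r)"
  using assms(1)
proof cases
  case (unit w)
  then show ?thesis using letter_one[of w] run_fst[of a] gp_word_mono[OF assms(2) subsets(3)]
    by (auto simp: letter_def prod_eq_iff)
next
  case (mult w g h)
  interpret Gw: group "G w" using vertex_group mult by blast
  have wa: "word a" using gp_word_mono[OF assms(2) subsets(3)] .
  have eq: "cl [(w, g)] \<star> cl [(w, h)] = cl [(w, g \<otimes>\<^bsub>G w\<^esub> h)]"
    using letter_mult[of w g h] mult by (simp add: letter_def)
  have K: "cl [(w, g)] \<in> Sub {v}" "cl [(w, h)] \<in> Sub {v}" if "w = v"
    using that mult letter_Sub[of w "{v}"] by (auto simp: letter_def)
  show ?thesis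
    using mult wa eq K run_good[OF assms(2)] upd_upd[of "snd (run a)" "cl a" "cl [(w, g)]" "cl [(w, h)]"]
    by (auto simp: run_two run_fst H.m_assoc)
next
  case (comm u w g h)
  have wa: "word a" using gp_word_mono[OF assms(2) subsets(3)] .
  note e = edge[OF comm(3)]
  have eq: "cl [(u, g)] \<star> cl [(w, h)] = cl [(w, h)] \<star> cl [(u, g)]"
    using letter_comm[OF comm(3-5)] by (simp add: letter_def)
  have cars: "cl a \<in> carrier H" "cl [(u, g)] \<in> carrier H" "cl [(w, h)] \<in> carrier H"
    using wa comm e by auto
  have eq': "cl a \<star> cl [(u, g)] \<star> cl [(w, h)] = cl a \<star> cl [(w, h)] \<star> cl [(u, g)]"
    using cars eq by (simp add: H.m_assoc)
  show ?thesis
  proof (cases "u \<in> star \<and> w \<in> star")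
    case False
    then show ?thesis using comm by auto
  next
    case True
    have wfa: "wf (snd (run a))" using run_good[OF assms(2)] by simp
    have "upd (cl a \<star> cl [(w, h)]) (snd (run a)) k = upd (cl a) (snd (run a)) k" if "u = v" for k
    proof -
      have "cl [(w, h)] \<in> Sub link" using that True e comm letter_Sub[of w link h] by (auto simp: letter_def)
      then show ?thesis using upd_mult_C[OF wfa cars(1)] by blast
    qed
    moreover have "upd (cl a \<star> cl [(u, g)]) (snd (run a)) k = upd (cl a) (snd (run a)) k" if "w = v" for k
    proof -
      have "cl [(u, g)] \<in> Sub link" using that True e comm letter_Sub[of u link g] by (auto simp: letter_def)
      then show ?thesis using upd_mult_C[OF wfa cars(1)] by blast
    qed
    ultimately show ?thesis
      using True comm e eq' by (auto simp: run_two run_fst[OF wa])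
  qed
qed

text \<open>\<open>rep x\<close> is an arbitrary word over \<open>V\<close>; the deletion makes it a
  word over \<open>star\<close>, where stacks are invariant under the relations.\<close>

definition stack where "stack x = snd (run (restr star (rep x)))"

lemma stack_cl: "gp_word star G xs \<Longrightarrow> stack (cl xs) = snd (run xs)"
proof -
  assume xs: "gp_word star G xs"
  have "snd (run (restr star (rep (cl xs)))) = snd (run (restr star xs))"
  proof (rule rep_invariant[where f = "\<lambda>xs. snd (run (restr star xs))"])
    fix xs ys assume st: "gp_step V E G xs ys" "word xs"
    then obtain a b l r where *: "gp_basic V E G l r" "xs = a @ l @ b" "ys = a @ r @ b"
      by (auto simp: gp_step_def)
    then have "gp_word star G (restr star a)"
      using restr_word[of V a star] st(2) gp_word_mono by auto
    from run_context[OF run_basic[OF *(1) this], of "restr star b"]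
    show "snd (run (restr star xs)) = snd (run (restr star ys))" using * by simp
  qed (use gp_word_mono[OF xs subsets(3)] in simp)
  then show ?thesis using restr_id[OF xs] by (simp add: stack_def)
qed

lemma stack_letter:
  assumes "x \<in> Sub star" "w \<in> star" "g \<in> carrier (G w)"
  shows "stack (x \<star> letter w g) = (if w = v then upd x (stack x) (letter w g) else stack x)"
proof -
  obtain xs where xs: "x = cl xs" "gp_word star G xs" using assms(1) by (auto simp: Sub_def)
  have wx: "word xs" "w \<in> V" using gp_word_mono xs(2) subsets assms(2) by blast+
  have "x \<star> letter w g = cl (xs @ [(w, g)])" using xs wx assms by (simp add: cl_snoc)
  moreover have "stack (cl (xs @ [(w, g)])) = snd (run (xs @ [(w, g)]))"
    by (rule stack_cl) (use xs assms in auto)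
  ultimately show ?thesis using xs stack_cl[OF xs(2)] run_fst[OF wx(1)] by (simp add: letter_def)
qed

lemma stack_one: "stack \<one>\<^bsub>H\<^esub> = []"
  using stack_cl[of "[]"] by (simp add: one_H)

lemma stack_A: "x \<in> Sub star \<Longrightarrow> a \<in> Sub U \<Longrightarrow> stack (x \<star> a) = stack x"
proof -
  assume x: "x \<in> Sub star" and "a \<in> Sub U"
  note M = Sub_subgroup[OF subsets(3)] and xc = Sub_carrier[OF subsets(3) x]
  from \<open>a \<in> Sub U\<close> U show ?thesis
  proof (induction rule: Sub_induct)
    case (letter a w g)
    have "a \<in> Sub star" using letter Sub_mono[of U star] by auto
    then have "x \<star> a \<in> Sub star" using subgroup.m_closed[OF M] x by auto
    then have "stack (x \<star> a \<star> letter w g) = stack x" using stack_letter[of "x \<star> a" w g] letter v by auto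
    moreover have "w \<in> V" using letter U by auto
    ultimately show ?case using letter xc Sub_carrier[OF U] by (simp add: H.m_assoc)
  qed (use xc in simp)
qed

lemma stack_K: "x \<in> Sub star \<Longrightarrow> k \<in> Sub {v} \<Longrightarrow> stack (x \<star> k) = upd x (stack x) k"
  using Sub_single[OF v(1)] stack_letter[of x v] by auto

end

section \<open>Word metrics on vertex subgroups\<close>

locale gprod_gen = gprod +
  fixes W :: "'a set" and S :: "'a \<Rightarrow> 'b set"
  assumes W: "W \<subseteq> V" and S: "\<And>v. v \<in> W \<Longrightarrow> finite_generating_set (G v) (S v)"
begin

definition "sym_gens v = S v \<union> m_inv (G v) ` S v"

definition "letters U = {letter v s | v s. v \<in> U \<and> s \<in> sym_gens v}"

definition adjw where "adjw U x y \<longleftrightarrow> x \<in> Sub U \<and> (\<exists>t\<in>letters U. y = x \<star> t)"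

text \<open>Elements outside \<open>Sub W\<close> are identified with the unit to make the distance total.\<close>

definition base where "base x = (if x \<in> Sub W then x else \<one>\<^bsub>H\<^esub>)"

definition wdist where "wdist x y = (LEAST l. (adjw W ^^ l) (base x) (base y))"

lemma sym_gens_carrier: "v \<in> W \<Longrightarrow> s \<in> sym_gens v \<Longrightarrow> s \<in> carrier (G v) \<and> inv\<^bsub>G v\<^esub> s \<in> sym_gens v"
proof -
  assume v: "v \<in> W" and s: "s \<in> sym_gens v"
  interpret Gv: group "G v" using vertex_group v W by blast
  have "S v \<subseteq> carrier (G v)" using S[OF v] by (simp add: finite_generating_set_def)
  then show ?thesis using s by (auto simp: sym_gens_def)
qed

lemma letters_Sub: "U \<subseteq> W \<Longrightarrow> t \<in> letters U \<Longrightarrow> t \<in> Sub U \<and> inv\<^bsub>H\<^esub> t \<in> letters U"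
proof -
  assume U: "U \<subseteq> W" and "t \<in> letters U"
  then obtain v s where vs: "t = letter v s" "v \<in> U" "s \<in> sym_gens v" by (auto simp: letters_def)
  have v: "v \<in> W" "v \<in> V" using vs U W by auto
  show ?thesis
    using vs v sym_gens_carrier[OF v(1) vs(3)] letter_inv[of v s] by (auto simp: letter_Sub letters_def)
qed

lemma Sub_closed:
  assumes "U \<subseteq> W"
  shows "\<one>\<^bsub>H\<^esub> \<in> Sub U" "x \<in> Sub U \<Longrightarrow> y \<in> Sub U \<Longrightarrow> x \<star> y \<in> Sub U" "x \<in> Sub U \<Longrightarrow> inv\<^bsub>H\<^esub> x \<in> Sub U"
    "x \<in> Sub U \<Longrightarrow> x \<in> carrier H" "x \<in> Sub U \<Longrightarrow> x \<in> Sub W"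
  using Sub_subgroup[of U] assms W Sub_mono[OF assms] Sub_carrier[of U]
  by (auto simp: subgroup_def)

lemma adj_Sub: "U \<subseteq> W \<Longrightarrow> adjw U x y \<Longrightarrow> x \<in> Sub U \<and> y \<in> Sub U"
  using letters_Sub Sub_closed by (auto simp: adjw_def)

lemma adj_pow_Sub: "U \<subseteq> W \<Longrightarrow> (adjw U ^^ l) x y \<Longrightarrow> x \<in> Sub U \<Longrightarrow> y \<in> Sub U"
  by (cases l) (auto dest: adj_Sub)

lemma adj_sym: "U \<subseteq> W \<Longrightarrow> adjw U x y \<Longrightarrow> adjw U y x"
proof -
  assume U: "U \<subseteq> W" and xy: "adjw U x y"
  then obtain t where t: "t \<in> letters U" "y = x \<star> t" by (auto simp: adjw_def)
  have cars: "x \<in> carrier H" "t \<in> carrier H"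
    using adj_Sub[OF U xy] letters_Sub[OF U t(1)] Sub_closed[OF U] by auto
  then have "x = y \<star> inv\<^bsub>H\<^esub> t" using t by (simp add: H.m_assoc)
  then show ?thesis using adj_Sub[OF U xy] letters_Sub[OF U t(1)] by (auto simp: adjw_def)
qed

lemma adj_pow_sym: "U \<subseteq> W \<Longrightarrow> (adjw U ^^ l) x y \<Longrightarrow> (adjw U ^^ l) y x"
proof (induction l arbitrary: y)
  case (Suc l)
  then obtain z where "(adjw U ^^ l) x z" "adjw U z y" by auto
  then show ?case using Suc adj_sym relpowp_Suc_I2 by metis
qed simp

lemma adj_pow_mult:
  assumes U: "U \<subseteq> W" and g: "g \<in> Sub U"
  shows "(adjw U ^^ l) x y \<Longrightarrow> x \<in> Sub U \<Longrightarrow> (adjw U ^^ l) (g \<star> x) (g \<star> y)"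
proof (induction l arbitrary: y)
  case (Suc l)
  then obtain z where z: "(adjw U ^^ l) x z" "adjw U z y" by auto
  then obtain t where t: "t \<in> letters U" "y = z \<star> t" "z \<in> Sub U" by (auto simp: adjw_def)
  then have "g \<star> y = g \<star> z \<star> t" "g \<star> z \<in> Sub U"
    using letters_Sub[OF U t(1)] Sub_closed[OF U] g by (auto simp: H.m_assoc)
  then have "adjw U (g \<star> z) (g \<star> y)" using t by (auto simp: adjw_def)
  then show ?case using Suc z by auto
qed simp

lemma adj_connected_letter:
  assumes U: "U \<subseteq> W" and v: "v \<in> U" and g: "g \<in> carrier (G v)" and "x \<in> Sub U"
  shows "\<exists>l. (adjw U ^^ l) x (x \<star> letter v g)"
proof -
  have vV: "v \<in> V" "v \<in> W" using U v W by auto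
  interpret Gv: group "G v" using vertex_group vV by blast
  have gen: "S v \<subseteq> carrier (G v)" "generate (G v) (S v) = carrier (G v)"
    using S[OF vV(2)] by (auto simp: finite_generating_set_def)
  have single: "\<exists>l. (adjw U ^^ l) x (x \<star> letter v s)" if "x \<in> Sub U" "s \<in> sym_gens v" for x s
  proof -
    have "adjw U x (x \<star> letter v s)" using that v by (auto simp: adjw_def letters_def)
    then have "(adjw U ^^ 1) x (x \<star> letter v s)" by (simp add: eq_OO)
    then show ?thesis by blast
  qed
  from g have "g \<in> generate (G v) (S v)" using gen by simp
  then show ?thesis using \<open>x \<in> Sub U\<close>
  proof (induction arbitrary: x)
    case one
    then have "(adjw U ^^ 0) x (x \<star> letter v \<one>\<^bsub>G v\<^esub>)"
      using letter_one[OF vV(1)] Sub_closed(4)[OF U] by simp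
    then show ?case by blast
  next
    case (eng h1 h2)
    have h: "h1 \<in> carrier (G v)" "h2 \<in> carrier (G v)" using eng gen by auto
    have x': "x \<star> letter v h1 \<in> Sub U" using eng h v letter_Sub Sub_closed(2)[OF U] by blast
    have "x \<star> letter v h1 \<star> letter v h2 = x \<star> letter v (h1 \<otimes>\<^bsub>G v\<^esub> h2)"
      using letter_mult[OF vV(1) h] h vV Sub_closed(4)[OF U eng.prems] by (simp add: H.m_assoc)
    then show ?case using eng.IH(1)[OF eng.prems] eng.IH(2)[OF x'] relpowp_trans by metis
  qed (auto intro: single simp: sym_gens_def)
qed

lemma adj_connected:
  assumes U: "U \<subseteq> W" and "x \<in> Sub U" "y \<in> Sub U"
  shows "\<exists>l. (adjw U ^^ l) x y"
proof -
  have one: "\<exists>l. (adjw U ^^ l) \<one>\<^bsub>H\<^esub> y" if "y \<in> Sub U" for y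
    using that subset_trans[OF U W]
  proof (induction rule: Sub_induct)
    case one
    have "(adjw U ^^ 0) \<one>\<^bsub>H\<^esub> \<one>\<^bsub>H\<^esub>" by simp
    then show ?case by blast
  next
    case (letter y v g)
    then show ?case using adj_connected_letter[OF U] relpowp_trans by metis
  qed
  then show ?thesis using assms adj_pow_sym[OF U] relpowp_trans by metis
qed

lemma base_Sub [simp]: "base x \<in> Sub W" "x \<in> Sub W \<Longrightarrow> base x = x"
  using Sub_closed(1)[of W] by (auto simp: base_def)

lemma wdist_path: "(adjw W ^^ wdist x y) (base x) (base y)"
  unfolding wdist_def by (rule LeastI_ex) (rule adj_connected; simp)

lemma wdist_le: "(adjw W ^^ l) (base x) (base y) \<Longrightarrow> wdist x y \<le> l"
  unfolding wdist_def by (rule Least_le)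

sublocale pseudo_metric wdist
proof
  show "wdist x x = 0" for x using wdist_le[of 0 x x] by simp
  have "wdist x y \<le> wdist y x" for x y by (rule wdist_le) (rule adj_pow_sym[OF subset_refl wdist_path])
  then show "wdist x y = wdist y x" for x y by (simp add: eq_iff)
  show "wdist x z \<le> wdist x y + wdist y z" for x y z
    by (rule wdist_le) (rule relpowp_trans[OF wdist_path wdist_path])
qed

lemma wdist_le': "U \<subseteq> W \<Longrightarrow> x \<in> Sub U \<Longrightarrow> (adjw U ^^ l) x y \<Longrightarrow> wdist x y \<le> l"
proof -
  assume U: "U \<subseteq> W" and x: "x \<in> Sub U" and xy: "(adjw U ^^ l) x y"
  have "letters U \<subseteq> letters W" using U by (auto simp: letters_def)
  then have "adjw U \<le> adjw W" using Sub_mono[OF U] unfolding adjw_def by blast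
  then have "(adjw W ^^ l) x y" using relpowp_mono[of "adjw U" "adjw W"] xy by (auto simp: le_fun_def)
  then show ?thesis using wdist_le Sub_closed(5)[OF U] x adj_pow_Sub[OF U xy x] by simp
qed

text \<open>The retraction contracts the edges labelled outside \<open>U\<close> and keeps the
  labels of the others, so no path gets longer.\<close>

lemma proj_path:
  assumes U: "U \<subseteq> W"
  shows "(adjw W ^^ l) x y \<Longrightarrow> x \<in> Sub W \<Longrightarrow> \<exists>l'\<le>l. (adjw U ^^ l') (proj U x) (proj U y)"
proof (induction l arbitrary: y)
  case (Suc l)
  then obtain z where z: "(adjw W ^^ l) x z" "adjw W z y" by auto
  then obtain l' where l': "l' \<le> l" "(adjw U ^^ l') (proj U x) (proj U z)" using Suc by blast
  obtain v s where t: "v \<in> W" "s \<in> sym_gens v" "y = z \<star> letter v s" "z \<in> Sub W"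
    using z(2) by (auto simp: adjw_def letters_def)
  have v: "v \<in> V" "s \<in> carrier (G v)" using t W sym_gens_carrier[OF t(1,2)] by auto
  have zc: "z \<in> carrier H" using Sub_closed(4)[of W] t by auto
  have UW: "U \<inter> W = U" using U by auto
  have zU: "proj U z \<in> Sub U" using proj_Sub[OF t(4) W, of U] UW by simp
  have py: "proj U y = proj U z \<star> (if v \<in> U then letter v s else \<one>\<^bsub>H\<^esub>)"
    using t v zc by (simp add: proj_mult proj_letter)
  show ?case
  proof (cases "v \<in> U")
    case True
    then have "adjw U (proj U z) (proj U y)" using py zU t by (auto simp: adjw_def letters_def)
    then show ?thesis using l' by (intro exI[of _ "Suc l'"]) auto
  next
    case False
    then show ?thesis using l' py Sub_closed(4)[OF U zU] by (intro exI[of _ l']) auto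
  qed
qed auto

text \<open>A shortest path in \<open>Sub W\<close> is retracted to \<open>Sub U\<close>, which
  fixes its ends; hence \<open>Sub U\<close> with its own word metric embeds isometrically.\<close>

lemma path_in_Sub:
  assumes U: "U \<subseteq> W" and "x \<in> Sub U" "y \<in> Sub U"
  shows "\<exists>l\<le>wdist x y. (adjw U ^^ l) x y"
  using proj_path[OF U, of "wdist x y" x y] wdist_path[of x y] Sub_closed(5)[OF U] assms
    proj_id subset_trans[OF U W] by simp

lemma wdist_proj:
  assumes U: "U \<subseteq> W" and "x \<in> Sub W" "y \<in> Sub W"
  shows "wdist (proj U x) (proj U y) \<le> wdist x y"
proof -
  have "proj U x \<in> Sub U" using proj_Sub[OF assms(2) W, of U] U by (simp add: Int_absorb2)
  moreover obtain l where "l \<le> wdist x y" "(adjw U ^^ l) (proj U x) (proj U y)"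
    using proj_path[OF U, of "wdist x y" x y] wdist_path[of x y] assms by auto
  ultimately show ?thesis using wdist_le'[OF U] order_trans by blast
qed

lemma wdist_mult:
  assumes "g \<in> Sub W" "x \<in> Sub W" "y \<in> Sub W"
  shows "wdist (g \<star> x) (g \<star> y) = wdist x y"
proof -
  have le: "wdist (g \<star> x) (g \<star> y) \<le> wdist x y" if "g \<in> Sub W" "x \<in> Sub W" "y \<in> Sub W" for g x y
    using adj_pow_mult[OF subset_refl that(1)] wdist_path[of x y] that Sub_closed(2)[of W]
    by (intro wdist_le) simp
  have "inv\<^bsub>H\<^esub> g \<star> (g \<star> x) = x" "inv\<^bsub>H\<^esub> g \<star> (g \<star> y) = y"
    using assms Sub_closed(4)[of W] by (simp_all add: H.m_assoc[symmetric])
  then have "wdist x y \<le> wdist (g \<star> x) (g \<star> y)"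
    using le[of "inv\<^bsub>H\<^esub> g" "g \<star> x" "g \<star> y"] assms Sub_closed[of W] by auto
  then show ?thesis using le[OF assms] by simp
qed

text \<open>The amalgam theorem for one vertex, with the retraction onto the link as the map to
  \<open>C\<close>. The other factor is a direct product, whose two coordinates are again
  retractions.\<close>

lemma asd_insert:
  assumes "v \<in> W" "U \<subseteq> W" "v \<notin> U"
    and "asd (Sub U) n" "asd (Sub {w \<in> U. E v w}) m" "asd (Sub {v}) q" "m + q \<le> n" "m < n"
  shows "asd (Sub (insert v U)) n"
proof -
  let ?L = "{w \<in> U. E v w}" and ?N = "insert v U"
  have sub: "?L \<subseteq> W" "{v} \<subseteq> W" "?N \<subseteq> W" using assms by auto
  interpret gprod_split V E G U v
    by unfold_locales (use assms W in auto)
  have NW: "Sub ?N \<subseteq> Sub W" using Sub_mono[OF sub(3)] .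
  interpret metric_amalgam H "Sub U" "Sub ?L" "Sub {v}" wdist "Sub ?N" "proj ?L" stack
  proof (intro metric_amalgam.intro metric_amalgam_axioms.intro amalgam_axioms pseudo_metric_axioms)
    show "subgroup (Sub ?N) H" by (rule Sub_subgroup[OF subset_trans[OF sub(3) W]])
    show "Sub U \<subseteq> Sub ?N" "Sub {v} \<subseteq> Sub ?N" by (auto intro!: Sub_mono)
    show "\<exists>l\<le>wdist x y. ((\<lambda>u w. u \<in> Sub ?N \<and> wdist u w \<le> 1 \<and> (\<exists>t\<in>Sub U \<union> Sub {v}. w = u \<star> t)) ^^ l) x y"
      if xy: "x \<in> Sub ?N" "y \<in> Sub ?N" for x y
    proof -
      obtain l where l: "l \<le> wdist x y" "(adjw ?N ^^ l) x y" using path_in_Sub[OF sub(3) xy] by blast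
      have "adjw ?N \<le> (\<lambda>u w. u \<in> Sub ?N \<and> wdist u w \<le> 1 \<and> (\<exists>t\<in>Sub U \<union> Sub {v}. w = u \<star> t))"
      proof (intro predicate2I)
        fix u w assume uw: "adjw ?N u w"
        have "u \<in> Sub ?N" using adj_Sub[OF sub(3) uw] by blast
        moreover have "wdist u w \<le> 1" using wdist_le'[OF sub(3) \<open>u \<in> Sub ?N\<close>, of 1] uw by (simp add: eq_OO)
        moreover obtain t where t: "t \<in> letters ?N" "w = u \<star> t" using uw by (auto simp: adjw_def)
        moreover have "t \<in> letters U \<or> t \<in> letters {v}" using t(1) by (auto simp: letters_def)
        then have "t \<in> Sub U \<union> Sub {v}" using letters_Sub[OF assms(2)] letters_Sub[OF sub(2)] by blast
        ultimately show "u \<in> Sub ?N \<and> wdist u w \<le> 1 \<and> (\<exists>t\<in>Sub U \<union> Sub {v}. w = u \<star> t)" by blast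
      qed
      then have "((\<lambda>u w. u \<in> Sub ?N \<and> wdist u w \<le> 1 \<and> (\<exists>t\<in>Sub U \<union> Sub {v}. w = u \<star> t)) ^^ l) x y"
        using relpowp_mono[OF _ l(2)] by (simp add: le_fun_def)
      then show ?thesis using l(1) by (intro exI conjI)
    qed
    show "wdist (g \<star> x) (g \<star> y) = wdist x y" if "g \<in> Sub ?N" "x \<in> Sub ?N" "y \<in> Sub ?N" for g x y
      using wdist_mult that NW by blast
    show "proj ?L x \<in> Sub ?L" if "x \<in> Sub ?N" for x
    proof -
      have "?L \<inter> ?N = ?L" by auto
      then show ?thesis using proj_Sub[OF that, of ?L] sub W by auto
    qed
    show "proj ?L (x \<star> c) = proj ?L x \<star> c" if "x \<in> Sub ?N" "c \<in> Sub ?L" for x c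
      using that Sub_closed(4)[OF sub(3)] Sub_closed(4)[OF sub(1)] proj_id[OF that(2)] sub W
      by (auto simp: proj_mult)
    show "wdist (proj ?L x) (proj ?L y) \<le> wdist x y" if "x \<in> Sub ?N" "y \<in> Sub ?N" for x y
      using wdist_proj[OF sub(1)] that NW by blast
  qed (use stack_one stack_A stack_K in auto)
  \<comment> \<open>The link and \<open>{v}\<close> are disjoint, so each retraction kills the other
    factor and reads off one coordinate.\<close>
  have decomp: "x \<in> Sub W \<and> proj ?L x \<in> Sub ?L \<and> proj {v} x \<in> Sub {v} \<and> x = proj ?L x \<star> proj {v} x"
    if x: "x \<in> Sub ?L <#>\<^bsub>H\<^esub> Sub {v}" for x
  proof -
    obtain c k where ck: "c \<in> Sub ?L" "k \<in> Sub {v}" "x = c \<star> k" using x by (auto simp: set_mult_def)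
    have cars: "c \<in> carrier H" "k \<in> carrier H" using ck by auto
    have V: "?L \<subseteq> V" "{v} \<subseteq> V" using sub W by auto
    have int: "?L \<inter> {v} = {}" "{v} \<inter> ?L = {}" using assms(3) by auto
    have "proj ?L k = \<one>\<^bsub>H\<^esub>" "proj {v} c = \<one>\<^bsub>H\<^esub>"
      using proj_Sub[OF ck(2) V(2), of ?L] proj_Sub[OF ck(1) V(1), of "{v}"] int by (auto simp: Sub_empty)
    then have "proj ?L x = c" "proj {v} x = k"
      using ck cars V by (auto simp: proj_mult proj_id)
    then show ?thesis using ck Sub_closed(2)[of W] Sub_closed(5)[OF sub(1)] Sub_closed(5)[OF sub(2)] by auto
  qed
  have "asd (Sub ?L <#>\<^bsub>H\<^esub> Sub {v}) (m + q)"
  proof (rule asd_product[OF assms(5,6), of _ "proj ?L" "proj {v}"])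
    fix x y assume xy: "x \<in> Sub ?L <#>\<^bsub>H\<^esub> Sub {v}" "y \<in> Sub ?L <#>\<^bsub>H\<^esub> Sub {v}"
    note x = decomp[OF xy(1)] and y = decomp[OF xy(2)]
    show "wdist (proj ?L x) (proj ?L y) \<le> wdist x y" "wdist (proj {v} x) (proj {v} y) \<le> wdist x y"
      using wdist_proj sub x y by blast+
    have W': "proj ?L x \<in> Sub W" "proj {v} x \<in> Sub W" "proj ?L y \<in> Sub W" "proj {v} y \<in> Sub W"
      using x y Sub_closed(5)[OF sub(1)] Sub_closed(5)[OF sub(2)] by auto
    \<comment> \<open>The corner of a rectangle, reached by changing one coordinate. As the factors
      commute, the change of the other coordinate is also a left-translated one.\<close>
    let ?z = "proj ?L x \<star> proj {v} y"
    have "wdist x ?z = wdist (proj {v} x) (proj {v} y)" using wdist_mult[OF W'(1,2,4)] x by simp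
    moreover have "wdist ?z y = wdist (proj ?L x) (proj ?L y)"
      using wdist_mult[OF W'(4,1,3)] x y CK[of "proj ?L x" "proj {v} y"] CK[of "proj ?L y" "proj {v} y"] by simp
    ultimately show "wdist x y \<le> wdist (proj ?L x) (proj ?L y) + wdist (proj {v} x) (proj {v} y)"
      using d_tri[of x y ?z] by simp
  qed (use decomp in auto)
  then have "asd (Sub ?L <#>\<^bsub>H\<^esub> Sub {v}) n" using asd_mono assms(7) by blast
  then show ?thesis using asd_amalgam assms(4,5,8) by blast
qed

end

section \<open>Asymptotic dimension of graph products\<close>

context gprod
begin

section \<open>Vertex groups inside the graph product\<close>

primrec eval where
  "eval v [] = \<one>\<^bsub>G v\<^esub>"
| "eval v (l # xs) = (if fst l = v then snd l \<otimes>\<^bsub>G v\<^esub> eval v xs else eval v xs)"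

text \<open>A left inverse of \<open>letter v\<close>; it shows that the vertex group embeds in the
  graph product.\<close>

definition coord where "coord v x = eval v (rep x)"

lemma eval_carrier: "v \<in> V \<Longrightarrow> word xs \<Longrightarrow> eval v xs \<in> carrier (G v)"
proof -
  assume v: "v \<in> V"
  interpret Gv: group "G v" using vertex_group v by blast
  show "word xs \<Longrightarrow> eval v xs \<in> carrier (G v)" by (induction xs) auto
qed

lemma eval_append: "v \<in> V \<Longrightarrow> word xs \<Longrightarrow> word ys \<Longrightarrow> eval v (xs @ ys) = eval v xs \<otimes>\<^bsub>G v\<^esub> eval v ys"
proof -
  assume v: "v \<in> V" and ys: "word ys"
  interpret Gv: group "G v" using vertex_group v by blast
  show "word xs \<Longrightarrow> eval v (xs @ ys) = eval v xs \<otimes>\<^bsub>G v\<^esub> eval v ys"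
    by (induction xs) (auto simp: eval_carrier v ys Gv.m_assoc)
qed

lemma coord_cl:
  assumes "v \<in> V" "word xs"
  shows "coord v (cl xs) = eval v xs"
  unfolding coord_def
proof (rule rep_invariant[OF _ assms(2)])
  interpret Gv: group "G v" using vertex_group assms by blast
  fix xs ys assume st: "gp_step V E G xs ys" "word xs"
  then obtain a b l r where *: "gp_basic V E G l r" "xs = a @ l @ b" "ys = a @ r @ b"
    by (auto simp: gp_step_def)
  have "eval v l = eval v r"
    using *(1)
  proof cases
    case (comm u w g h)
    then show ?thesis using edge[OF comm(3)] by auto
  qed auto
  then show "eval v xs = eval v ys"
    using st(2) * step_word[OF st(1)] assms(1) by (simp add: eval_append)
qed

lemma coord_letter: "v \<in> V \<Longrightarrow> g \<in> carrier (G v) \<Longrightarrow> coord v (letter v g) = g"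
  using vertex_group by (simp add: letter_def coord_cl group.is_monoid monoid.r_one)

end

context gprod_gen
begin

text \<open>Shortest paths between elements of \<open>Sub {v}\<close> can be taken inside
  \<open>Sub {v}\<close>, where their labels spell words in the generators of \<open>G v\<close>;
  injectivity of \<open>letter v\<close> makes these words evaluate correctly.\<close>

lemma word_metric_wdist:
  assumes v: "v \<in> W" and a: "a \<in> carrier (G v)" "b \<in> carrier (G v)"
  shows "word_metric (G v) (S v) a b = real (wdist (letter v a) (letter v b))"
proof -
  have vV: "v \<in> V" and vW: "{v} \<subseteq> W" using v W by auto
  interpret Gv: group "G v" using vertex_group vV by blast
  define pr where "pr xs = foldr (\<lambda>x acc. x \<otimes>\<^bsub>G v\<^esub> acc) xs \<one>\<^bsub>G v\<^esub>" for xs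
  have pr_Cons: "pr (s # xs) = s \<otimes>\<^bsub>G v\<^esub> pr xs" for s xs by (simp add: pr_def)
  have pr_carrier: "pr xs \<in> carrier (G v)" if "set xs \<subseteq> sym_gens v" for xs
    using that sym_gens_carrier[OF v] by (induction xs) (auto simp: pr_def)
  let ?len = "word_length (G v) (S v) (inv\<^bsub>G v\<^esub> a \<otimes>\<^bsub>G v\<^esub> b)"
  have len: "?len = (LEAST m. \<exists>xs. length xs = m \<and> set xs \<subseteq> sym_gens v \<and> pr xs = inv\<^bsub>G v\<^esub> a \<otimes>\<^bsub>G v\<^esub> b)"
    unfolding word_length_def sym_gens_def pr_def ..
  have path_word: "\<exists>xs. length xs = l \<and> set xs \<subseteq> sym_gens v \<and> pr xs = inv\<^bsub>G v\<^esub> a \<otimes>\<^bsub>G v\<^esub> b"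
    if "(adjw {v} ^^ l) (letter v a) y" "y = letter v b" "a \<in> carrier (G v)" "b \<in> carrier (G v)" for l a b y
    using that
  proof (induction l arbitrary: a)
    case 0
    then have "a = b" using coord_letter[OF vV] by (metis relpowp_0_E)
    then show ?case using 0 by (simp add: pr_def)
  next
    case (Suc l)
    obtain z where z: "adjw {v} (letter v a) z" "(adjw {v} ^^ l) z y"
      using relpowp_Suc_E2[OF Suc.prems(1)] by metis
    then obtain s where s: "s \<in> sym_gens v" "z = letter v a \<star> letter v s" by (auto simp: adjw_def letters_def)
    have sc: "s \<in> carrier (G v)" using sym_gens_carrier[OF v s(1)] by simp
    have z': "z = letter v (a \<otimes>\<^bsub>G v\<^esub> s)" using s sc Suc.prems vV by (simp add: letter_mult)
    obtain xs where "length xs = l" "set xs \<subseteq> sym_gens v" "pr xs = inv\<^bsub>G v\<^esub> (a \<otimes>\<^bsub>G v\<^esub> s) \<otimes>\<^bsub>G v\<^esub> b"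
      using Suc.IH[OF z(2)[unfolded z'] Suc.prems(2)] sc Suc.prems by auto
    moreover have "s \<otimes>\<^bsub>G v\<^esub> (inv\<^bsub>G v\<^esub> (a \<otimes>\<^bsub>G v\<^esub> s) \<otimes>\<^bsub>G v\<^esub> b) = inv\<^bsub>G v\<^esub> a \<otimes>\<^bsub>G v\<^esub> b"
      using sc Suc.prems by (simp add: Gv.inv_mult_group Gv.m_assoc[symmetric])
    ultimately show ?case using s by (intro exI[of _ "s # xs"]) (auto simp: pr_Cons)
  qed
  have word_path: "(adjw {v} ^^ length xs) (letter v a) (letter v (a \<otimes>\<^bsub>G v\<^esub> pr xs))"
    if "set xs \<subseteq> sym_gens v" "a \<in> carrier (G v)" for xs a
    using that
  proof (induction xs arbitrary: a)
    case (Cons s xs)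
    have sc: "s \<in> carrier (G v)" using sym_gens_carrier[OF v, of s] Cons.prems by simp
    have "adjw {v} (letter v a) (letter v (a \<otimes>\<^bsub>G v\<^esub> s))"
      using Cons.prems vV sc letter_Sub[of v "{v}" a]
      by (auto simp: adjw_def letters_def letter_mult intro!: exI[of _ "letter v s"])
    moreover have "(adjw {v} ^^ length xs) (letter v (a \<otimes>\<^bsub>G v\<^esub> s)) (letter v (a \<otimes>\<^bsub>G v\<^esub> s \<otimes>\<^bsub>G v\<^esub> pr xs))"
      using Cons sc by auto
    moreover have "a \<otimes>\<^bsub>G v\<^esub> s \<otimes>\<^bsub>G v\<^esub> pr xs = a \<otimes>\<^bsub>G v\<^esub> pr (s # xs)"
      using Cons.prems sc pr_carrier[of xs] by (simp add: pr_Cons Gv.m_assoc)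
    ultimately show ?case by (metis length_Cons relpowp_Suc_I2)
  qed (simp add: pr_def)
  have Sv: "letter v a \<in> Sub {v}" "letter v b \<in> Sub {v}" using letter_Sub a by auto
  obtain l where l: "l \<le> wdist (letter v a) (letter v b)" "(adjw {v} ^^ l) (letter v a) (letter v b)"
    using path_in_Sub[OF vW Sv] by blast
  note pw = path_word[OF l(2) refl a]
  have "?len \<le> l" unfolding len using pw by (rule Least_le)
  obtain xs where xs: "length xs = ?len" "set xs \<subseteq> sym_gens v" "pr xs = inv\<^bsub>G v\<^esub> a \<otimes>\<^bsub>G v\<^esub> b"
    using LeastI[of "\<lambda>m. \<exists>xs. length xs = m \<and> set xs \<subseteq> sym_gens v \<and> pr xs = inv\<^bsub>G v\<^esub> a \<otimes>\<^bsub>G v\<^esub> b", OF pw]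
    unfolding len by blast
  have "a \<otimes>\<^bsub>G v\<^esub> pr xs = b" using xs(3) a by (simp add: Gv.m_assoc[symmetric])
  then have "wdist (letter v a) (letter v b) \<le> ?len"
    using wdist_le'[OF vW Sv(1) word_path[OF xs(2) a(1)]] xs(1) by simp
  then show ?thesis using \<open>?len \<le> l\<close> l(1) unfolding word_metric_def by simp
qed

text \<open>A chain with steps at most \<open>r\<close> cannot leave a member of an
  \<open>r\<close>-disjoint family, so the diameter bound of the members applies.\<close>

lemma asd_vertex:
  assumes v: "v \<in> W" and asdim: "asdim_le (carrier (G v)) (word_metric (G v) (S v)) n"
  shows "asd (Sub {v}) n"
  unfolding asd_def
proof
  fix r :: nat
  have vV: "v \<in> V" using v W by auto
  \<comment> \<open>Scales have to be positive, so \<open>r + 1\<close> replaces \<open>r\<close> to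
    include \<open>r = 0\<close>.\<close>
  obtain \<U> where cover: "carrier (G v) = (\<Union>i\<le>n. \<Union>(\<U> i))"
    and bd: "\<And>i. i \<le> n \<Longrightarrow> \<exists>B. \<forall>A\<in>\<U> i. \<forall>x\<in>A. \<forall>y\<in>A. word_metric (G v) (S v) x y \<le> B"
    and disj: "\<And>i A A' x y. i \<le> n \<Longrightarrow> A \<in> \<U> i \<Longrightarrow> A' \<in> \<U> i \<Longrightarrow> A \<noteq> A' \<Longrightarrow> x \<in> A \<Longrightarrow> y \<in> A' \<Longrightarrow>
        word_metric (G v) (S v) x y > real r + 1"
    using asdim[unfolded asdim_le_def, rule_format, of "real r + 1"] by auto
  obtain B where B: "\<And>i A x y. i \<le> n \<Longrightarrow> A \<in> \<U> i \<Longrightarrow> x \<in> A \<Longrightarrow> y \<in> A \<Longrightarrow> word_metric (G v) (S v) x y \<le> B i"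
    using bd by metis
  define K where "K = nat \<lceil>Max (B ` {..n})\<rceil>"
  have BK: "B i \<le> real K" if "i \<le> n" for i
  proof -
    have "B i \<le> Max (B ` {..n})" using that by simp
    then show ?thesis unfolding K_def by linarith
  qed
  define C where "C i = letter v ` \<Union>(\<U> i)" for i
  have "chain_bounded r K (C i)" if i: "i \<le> n" for i
    unfolding chain_bounded_def
  proof (intro allI impI)
    fix x y assume xy: "(step r (C i))\<^sup>*\<^sup>* x y"
    show "wdist x y \<le> K"
    proof (cases "x = y")
      case False
      then have "x \<in> C i" using conn_source[OF xy] by simp
      then obtain a A where a: "x = letter v a" "a \<in> A" "A \<in> \<U> i" by (auto simp: C_def)
      have Ui: "b \<in> carrier (G v)" if "b \<in> A'" "A' \<in> \<U> i" for b A' using cover that i by blast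
      from xy have "\<exists>b\<in>A. y = letter v b"
      proof (induction rule: rtranclp_induct)
        case (step y z)
        then obtain b c A' where b: "b \<in> A" "y = letter v b" "c \<in> A'" "A' \<in> \<U> i" "z = letter v c" "wdist y z \<le> r"
          by (auto simp: step_def C_def)
        then have "word_metric (G v) (S v) b c \<le> real r"
          using word_metric_wdist[OF v] Ui a by auto
        then have "A' = A" using disj[OF i a(3) b(4) _ b(1,3)] by fastforce
        then show ?case using b by blast
      qed (use a in blast)
      then obtain b where "b \<in> A" "y = letter v b" by blast
      then have "real (wdist x y) \<le> B i"
        using B[OF i a(3,2)] word_metric_wdist[OF v] Ui a by auto
      then show ?thesis using BK[OF i] by linarith
    qed simp
  qed
  moreover have "Sub {v} \<subseteq> (\<Union>i\<le>n. C i)"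
  proof
    fix x assume "x \<in> Sub {v}"
    then obtain g where "g \<in> carrier (G v)" "x = letter v g" using Sub_single[OF vV] by blast
    then show "x \<in> (\<Union>i\<le>n. C i)" unfolding C_def using cover by blast
  qed
  ultimately show "\<exists>B. colourable n r B (Sub {v})" unfolding colourable_def by blast
qed

text \<open>A clique of the link becomes a clique of \<open>U\<close> when \<open>v\<close> is
  added, so the link is treated with \<open>k - 1\<close>, and the induction varies \<open>k\<close>
  together with \<open>U\<close>.\<close>

lemma asd_Sub:
  assumes "finite W" "\<And>v. v \<in> W \<Longrightarrow> asd (Sub {v}) n" "W \<noteq> {} \<Longrightarrow> 0 < n"
  shows "U \<subseteq> W \<Longrightarrow> (\<And>C. is_clique U E C \<Longrightarrow> card C \<le> k) \<Longrightarrow> asd (Sub U) (n * k)"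
proof (induction "card U" arbitrary: U k rule: less_induct)
  case less
  show ?case
  proof (cases "U = {}")
    case True
    have "Sub U = {\<one>\<^bsub>H\<^esub>}" using True Sub_empty by simp
    moreover have "chain_bounded r 0 {\<one>\<^bsub>H\<^esub>}" for r
      unfolding chain_bounded_def
    proof (intro allI impI)
      fix x y assume "(step r {\<one>\<^bsub>H\<^esub>})\<^sup>*\<^sup>* x y"
      then show "wdist x y \<le> 0" by (induction rule: rtranclp_induct) (auto simp: step_def)
    qed
    ultimately show ?thesis unfolding asd_def colourable_def by (intro allI exI[of _ 0] exI[of _ "\<lambda>_. {\<one>\<^bsub>H\<^esub>}"]) auto
  next
    case False
    then obtain v where v: "v \<in> U" by blast
    define U' where "U' = U - {v}"
    let ?L = "{w \<in> U'. E v w}"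
    have fin: "finite U" "finite U'" using less.prems(1) assms(1) finite_subset unfolding U'_def by auto
    have U: "insert v U' = U" "v \<notin> U'" "U' \<subseteq> W" "v \<in> W" using v less.prems(1) by (auto simp: U'_def)
    have cU': "card U' < card U" using v fin unfolding U'_def by (meson card_Diff1_less)
    have cL: "card ?L < card U" using cU' card_mono[OF fin(2), of ?L] by auto
    have "is_clique U E {v}" using v by (simp add: is_clique_def)
    then have k: "1 \<le> k" using less.prems(2)[of "{v}"] by simp
    have "asd (Sub U') (n * k)"
    proof (rule less.hyps[OF cU' U(3)])
      fix C assume "is_clique U' E C"
      then show "card C \<le> k" using less.prems(2)[of C] by (auto simp: is_clique_def U'_def)
    qed
    moreover have "asd (Sub ?L) (n * (k - 1))"
    proof (rule less.hyps[OF cL])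
      fix C assume C: "is_clique ?L E C"
      have "E w v" if "E v w" for w using edge[OF that] by simp
      then have "is_clique U E (insert v C)" using C v by (auto simp: is_clique_def U'_def)
      moreover have "finite C" "v \<notin> C" using C U fin(2) finite_subset[of C U'] by (auto simp: is_clique_def)
      ultimately show "card C \<le> k - 1" using less.prems(2)[of "insert v C"] by simp
    qed (use U in auto)
    moreover have "n * (k - 1) + n = n * k" using k by (cases k) auto
    moreover have "0 < n" using assms(3) U by auto
    ultimately have "asd (Sub (insert v U')) (n * k)"
      using assms(2)[OF U(4)] U k by (intro asd_insert[of v U' _ "n * (k - 1)" n]) auto
    then show ?thesis using U by simp
  qed
qed

end

text \<open>\<open>d\<close> is compared with a word metric only on one subgroup
  \<open>Sub W\<close>, which is chosen after the scale \<open>R\<close>; left invariance carries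
  the colouring of \<open>Sub W\<close> to all its cosets with the same bound.\<close>

lemma (in gprod) asdim_le_coarse:
  assumes d: "proper_metric_on (carrier H) d" "left_invariant H d"
    and asd: "\<And>W. finite W \<Longrightarrow> W \<subseteq> V \<Longrightarrow> gprod_gen V E G W S \<and>
      pseudo_metric.asd (gprod_gen.wdist V E G W S) (Sub W) n"
  shows "asdim_le (carrier H) d n"
  unfolding asdim_le_def
proof (intro allI impI)
  fix R :: real assume "R > 0"
  have m: "d x y = d y x" "d x x = 0" "0 \<le> d x y" if "x \<in> carrier H" "y \<in> carrier H" for x y
    using d(1) that unfolding proper_metric_on_def metric_on_def by blast+
  have tri: "d x z \<le> d x y + d y z" if "x \<in> carrier H" "y \<in> carrier H" "z \<in> carrier H" for x y z
    using d(1) that unfolding proper_metric_on_def metric_on_def by blast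
  have inv: "d (g \<star> x) (g \<star> y) = d x y" if "g \<in> carrier H" "x \<in> carrier H" "y \<in> carrier H" for g x y
    using d(2) that unfolding left_invariant_def by blast
  define F where "F = {g \<in> carrier H. d \<one>\<^bsub>H\<^esub> g \<le> R}"
  have F: "finite F" using d(1) unfolding F_def proper_metric_on_def by auto
  define W where "W = (\<Union>g\<in>F. fst ` set (rep g))"
  have rep_word: "word (rep g)" "cl (rep g) = g" if "g \<in> F" for g using rep that by (auto simp: F_def)
  have fW: "finite W" "W \<subseteq> V"
    using F rep_word(1) by (fastforce simp: W_def gp_word_def)+
  have FW: "F \<subseteq> Sub W"
  proof
    fix g assume g: "g \<in> F"
    then have "gp_word W G (rep g)" using g by (intro gp_word_vertices[OF rep_word(1)[OF g]]) (auto simp: W_def)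
    then show "g \<in> Sub W" using rep_word(2)[OF g] unfolding Sub_def by force
  qed
  interpret gprod_gen V E G W S using asd fW by blast
  have asdW: "asd (Sub W) n" using asd fW by blast
  note sg = Sub_subgroup[OF fW(2)]
  have finL: "finite (letters W)"
  proof -
    have "finite (sym_gens v)" if "v \<in> W" for v
      using S[OF that] by (simp add: sym_gens_def finite_generating_set_def)
    moreover have "letters W = (\<Union>v\<in>W. letter v ` sym_gens v)" by (auto simp: letters_def)
    ultimately show ?thesis using fW(1) by simp
  qed
  \<comment> \<open>The largest \<open>d\<close>-norm of a letter is a Lipschitz constant of
    \<open>d\<close> with respect to \<open>wdist\<close>.\<close>
  define c where "c = Max (insert 0 (d \<one>\<^bsub>H\<^esub> ` letters W))"
  have c: "0 \<le> c" "\<And>t. t \<in> letters W \<Longrightarrow> d \<one>\<^bsub>H\<^esub> t \<le> c" using finL by (auto simp: c_def)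
  have lip: "d x y \<le> c * real (wdist x y)" if xy: "x \<in> Sub W" "y \<in> Sub W" for x y
  proof -
    have "(adjw W ^^ l) x y \<Longrightarrow> d x y \<le> c * real l" for l y
    proof (induction l arbitrary: y)
      case 0
      then show ?case using m(2)[of x x] Sub_closed(4)[of W] xy by simp
    next
      case (Suc l)
      then obtain z where z: "(adjw W ^^ l) x z" "adjw W z y" by auto
      then obtain t where t: "t \<in> letters W" "y = z \<star> t" "z \<in> Sub W" by (auto simp: adjw_def)
      have cars: "x \<in> carrier H" "z \<in> carrier H" "t \<in> carrier H" "y \<in> carrier H"
        using t xy letters_Sub[OF subset_refl t(1)] Sub_closed(4)[OF subset_refl] by auto
      have "d z y = d \<one>\<^bsub>H\<^esub> t" using inv[of z "\<one>\<^bsub>H\<^esub>" t] cars t by simp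
      then show ?case
        using Suc.IH[OF z(1)] c(2)[OF t(1)] tri[of x z y] cars by (simp add: algebra_simps)
    qed
    then show ?thesis using wdist_path[of x y] xy by simp
  qed
  \<comment> \<open>The reverse comparison is needed only for elements of norm at most
    \<open>R\<close>, of which there are finitely many.\<close>
  define r where "r = Max (insert 0 (wdist \<one>\<^bsub>H\<^esub> ` F))"
  have r: "wdist \<one>\<^bsub>H\<^esub> f \<le> r" if "f \<in> F" for f using F that by (simp add: r_def)
  obtain B C where C: "Sub W \<subseteq> (\<Union>i\<le>n. C i)" "\<And>i. i \<le> n \<Longrightarrow> chain_bounded r B (C i)"
    using asdW unfolding asd_def colourable_def by meson
  \<comment> \<open>The choice depends on the coset only, so \<open>h\<close> carries each coset
    into \<open>Sub W\<close> by a single left translation.\<close>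
  define q where "q x = (SOME y. y \<in> x <#\<^bsub>H\<^esub> Sub W)" for x
  define h where "h x = inv\<^bsub>H\<^esub> (q x) \<star> x" for x
  have q: "q x \<in> x <#\<^bsub>H\<^esub> Sub W" "q x \<in> carrier H" if "x \<in> carrier H" for x
  proof -
    show "q x \<in> x <#\<^bsub>H\<^esub> Sub W"
      unfolding q_def using H.l_coset_self[OF sg that] by (rule someI)
    then show "q x \<in> carrier H"
      using H.l_coset_subset_G[OF subgroup.subset[OF sg] that] by blast
  qed
  have h: "h x \<in> Sub W" "x = q x \<star> h x" if x: "x \<in> carrier H" for x
  proof -
    obtain s where s: "s \<in> Sub W" "q x = x \<star> s" using q(1)[OF x] unfolding H.l_coset_iff by blast
    have sc: "s \<in> carrier H" using s Sub_closed(4)[OF subset_refl] by blast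
    have "h x = inv\<^bsub>H\<^esub> s" using s x sc by (simp add: h_def H.inv_mult_group H.m_assoc)
    then show "h x \<in> Sub W" using Sub_closed(3)[OF subset_refl s(1)] by simp
    show "x = q x \<star> h x" using q(2)[OF x] x by (simp add: h_def H.m_assoc[symmetric])
  qed
  have close: "q x = q y \<and> wdist (h x) (h y) \<le> r" if xy: "x \<in> carrier H" "y \<in> carrier H" "d x y \<le> R" for x y
  proof -
    let ?f = "inv\<^bsub>H\<^esub> x \<star> y"
    have y: "y = x \<star> ?f" using xy by (simp add: H.m_assoc[symmetric])
    have "d \<one>\<^bsub>H\<^esub> ?f = d x y" using inv[of x "\<one>\<^bsub>H\<^esub>" ?f] xy y by simp
    then have f: "?f \<in> F" using xy by (simp add: F_def)
    then have f': "?f \<in> Sub W" using FW by blast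
    have "x <#\<^bsub>H\<^esub> Sub W = y <#\<^bsub>H\<^esub> Sub W"
      using H.l_coset_mult[OF sg xy(1) f'] y by simp
    then have qq: "q x = q y" by (simp add: q_def)
    have "h x \<star> ?f = inv\<^bsub>H\<^esub> (q x) \<star> (x \<star> ?f)"
      unfolding h_def using xy q(2)[OF xy(1)] by (intro H.m_assoc) auto
    then have "h y = h x \<star> ?f" unfolding y[symmetric] h_def[of y] qq by simp
    then have "wdist (h x) (h y) = wdist \<one>\<^bsub>H\<^esub> ?f"
      using wdist_mult[OF h(1)[OF xy(1)] Sub_closed(1)[OF subset_refl] f'] h(1)[OF xy(1)]
        Sub_closed(4)[OF subset_refl] by simp
    then show ?thesis using qq r[OF f] by simp
  qed
  define rel where "rel i x y \<longleftrightarrow> x \<in> carrier H \<and> y \<in> carrier H \<and> h x \<in> C i \<and> h y \<in> C i \<and> d x y \<le> R" for i x y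
  have rel_sym: "(rel i)\<^sup>*\<^sup>* y x" if "(rel i)\<^sup>*\<^sup>* x y" for i x y
  proof -
    have "symp (rel i)" unfolding symp_def rel_def using m(1) by metis
    then show ?thesis using that symp_rtranclp by (metis sympD)
  qed
  \<comment> \<open>The members are components under steps of size at most \<open>R\<close>, so
    distinct ones are automatically more than \<open>R\<close> apart.\<close>
  define \<U> where "\<U> i = {{y. (rel i)\<^sup>*\<^sup>* x y} | x. x \<in> carrier H \<and> h x \<in> C i}" for i
  have chain: "y \<in> carrier H \<and> h y \<in> C i \<and> q y = q x \<and> (step r (C i))\<^sup>*\<^sup>* (h x) (h y)"
    if "(rel i)\<^sup>*\<^sup>* x y" "x \<in> carrier H" "h x \<in> C i" for i x y
    using that
  proof (induction rule: rtranclp_induct)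
    case (step y z)
    then have "step r (C i) (h y) (h z)" "q y = q z" using close[of y z] by (auto simp: rel_def step_def)
    then show ?case using step by (auto simp: rel_def)
  qed auto
  have bound: "d x y \<le> c * real B"
    if xy: "(rel i)\<^sup>*\<^sup>* x y" "x \<in> carrier H" "h x \<in> C i" and i: "i \<le> n" for i x y
  proof -
    note ch = chain[OF xy]
    have cars: "h x \<in> carrier H" "h y \<in> carrier H" using h(1) ch xy(2) Sub_closed(4)[OF subset_refl] by auto
    have "d x y = d (q x \<star> h x) (q x \<star> h y)" using h(2)[OF xy(2)] h(2)[of y] ch by simp
    also have "\<dots> = d (h x) (h y)" using inv q(2)[OF xy(2)] cars by simp
    also have "\<dots> \<le> c * real (wdist (h x) (h y))" using lip h(1) ch xy(2) by blast
    also have "\<dots> \<le> c * real B" using chain_boundedD[OF C(2)[OF i]] ch c(1) by (intro mult_left_mono) auto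
    finally show ?thesis .
  qed
  show "\<exists>U. carrier H = (\<Union>i\<le>n. \<Union>(U i)) \<and>
      (\<forall>i\<le>n. \<exists>B::real. \<forall>A\<in>U i. \<forall>x\<in>A. \<forall>y\<in>A. d x y \<le> B) \<and>
      (\<forall>i\<le>n. \<forall>A\<in>U i. \<forall>A'\<in>U i. A \<noteq> A' \<longrightarrow> (\<forall>x\<in>A. \<forall>y\<in>A'. d x y > R))"
  proof (intro exI[of _ \<U>] conjI allI impI)
    have "x \<in> (\<Union>i\<le>n. \<Union>(\<U> i))" if x: "x \<in> carrier H" for x
    proof -
      obtain i where "i \<le> n" "h x \<in> C i" using h(1)[OF x] C(1) by blast
      moreover have "x \<in> \<Union>(\<U> i)" unfolding \<U>_def using x \<open>h x \<in> C i\<close> by blast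
      ultimately show ?thesis by blast
    qed
    moreover have "y \<in> carrier H" if "y \<in> \<Union>(\<U> i)" for y i
      using that chain unfolding \<U>_def by auto
    ultimately show "carrier H = (\<Union>i\<le>n. \<Union>(\<U> i))" by (intro equalityI subsetI; blast)
  next
    fix i assume i: "i \<le> n"
    \<comment> \<open>Two points of a component are compared through its base point, whence the
      factor 2.\<close>
    have "d y z \<le> 2 * (c * real B)" if yz: "A \<in> \<U> i" "y \<in> A" "z \<in> A" for A y z
    proof -
      obtain x where x: "x \<in> carrier H" "h x \<in> C i" "(rel i)\<^sup>*\<^sup>* x y" "(rel i)\<^sup>*\<^sup>* x z"
        using yz unfolding \<U>_def by blast
      have cars: "y \<in> carrier H" "z \<in> carrier H" using chain[OF x(3,1,2)] chain[OF x(4,1,2)] by auto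
      show ?thesis
        using tri[OF cars(1) x(1) cars(2)] m(1)[OF cars(1) x(1)] bound[OF x(3,1,2) i] bound[OF x(4,1,2) i] by linarith
    qed
    then show "\<exists>B::real. \<forall>A\<in>\<U> i. \<forall>x\<in>A. \<forall>y\<in>A. d x y \<le> B" by blast
  next
    fix i assume i: "i \<le> n"
    have "A = A'" if yz: "A \<in> \<U> i" "A' \<in> \<U> i" "y \<in> A" "z \<in> A'" "d y z \<le> R" for A A' y z
    proof -
      obtain x where x: "x \<in> carrier H" "h x \<in> C i" "A = {y. (rel i)\<^sup>*\<^sup>* x y}" "(rel i)\<^sup>*\<^sup>* x y"
        using yz unfolding \<U>_def by blast
      obtain w where w: "w \<in> carrier H" "h w \<in> C i" "A' = {y. (rel i)\<^sup>*\<^sup>* w y}" "(rel i)\<^sup>*\<^sup>* w z"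
        using yz unfolding \<U>_def by blast
      have "rel i y z" using chain[OF x(4,1,2)] chain[OF w(4,1,2)] yz(5) by (simp add: rel_def)
      then have xw: "(rel i)\<^sup>*\<^sup>* x w" using x(4) rel_sym[OF w(4)] by (meson rtranclp.rtrancl_into_rtrancl rtranclp_trans)
      show ?thesis unfolding x(3) w(3) using xw rel_sym[OF xw] by (auto intro: rtranclp_trans)
    qed
    then show "\<forall>A\<in>\<U> i. \<forall>A'\<in>\<U> i. A \<noteq> A' \<longrightarrow> (\<forall>x\<in>A. \<forall>y\<in>A'. d x y > R)" by (meson not_less)
  qed
qed

theorem theorem3p4:
  fixes V :: "'v set" and E :: "'v \<Rightarrow> 'v \<Rightarrow> bool"
    and G :: "'v \<Rightarrow> ('g, 'b) monoid_scheme" and n k :: nat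
  assumes "countable V"
    and "simplicial_graph V E"
    and "clique_number_le V E k"
    and "\<forall>v\<in>V. group (G v)"
    and "\<forall>v\<in>V. \<exists>S. finite_generating_set (G v) S \<and>
            asdim_le (carrier (G v)) (word_metric (G v) S) n \<and>
            \<not> asdim_le (carrier (G v)) (word_metric (G v) S) 0"
  shows "\<forall>d. proper_metric_on (carrier (graph_product V E G)) d \<and>
             left_invariant (graph_product V E G) d \<longrightarrow>
             asdim_le (carrier (graph_product V E G)) d (n * k)"
proof (intro allI impI, elim conjE)
  fix d assume d: "proper_metric_on (carrier (graph_product V E G)) d" "left_invariant (graph_product V E G) d"
  interpret gprod V E G by (rule gprod.intro) (use assms(2,4) in auto)
  obtain S where gens: "\<And>v. v \<in> V \<Longrightarrow> finite_generating_set (G v) (S v)"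
      "\<And>v. v \<in> V \<Longrightarrow> asdim_le (carrier (G v)) (word_metric (G v) (S v)) n"
      "\<And>v. v \<in> V \<Longrightarrow> \<not> asdim_le (carrier (G v)) (word_metric (G v) (S v)) 0"
    using assms(5) by metis
  show "asdim_le (carrier (graph_product V E G)) d (n * k)"
  proof (rule asdim_le_coarse[OF d, of S])
    fix W assume fW: "finite W" "W \<subseteq> V"
    interpret gprod_gen V E G W S by unfold_locales (use fW gens(1) in auto)
    have "asd (Sub W) (n * k)"
    proof (rule asd_Sub[OF fW(1) _ _ subset_refl])
      show "asd (Sub {v}) n" if "v \<in> W" for v using asd_vertex[OF that] gens(2) fW that by blast
      \<comment> \<open>A vertex group of positive dimension at most \<open>n\<close> excludes
        \<open>n = 0\<close>; this gives the strict inequality between the link and the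
        whole.\<close>
      show "0 < n" if "W \<noteq> {}" using that fW gens(2,3) by (metis bot_nat_0.not_eq_extremum equals0I subsetD)
      show "card C \<le> k" if "is_clique W E C" for C
        using assms(3) that fW unfolding clique_number_le_def is_clique_def by blast
    qed
    then show "gprod_gen V E G W S \<and> pseudo_metric.asd (gprod_gen.wdist V E G W S) (Sub W) (n * k)"
      using gprod_gen_axioms by blast
  qed
qed

end
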